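(* For any $0<\varepsilon<1$ there are a constant $\beta_\varepsilon>0$ and an integer $n_0(\varepsilon)$ such that for any integer $n\ge n_0(\varepsilon)$, any integer $N\ge 1$, and any specified integer multiplicity $d\ge 1$ (in particular $d=1$), there exist a group $G$, a generating set $S\subset G$ with $|S|=n$, and a finite dimensional unitary representation $\pi$ of $G$ satisfying $$\lambda(\pi\otimes\overline{\pi},S)\le 1-\varepsilon$$ and admitting a decomposition $\pi=\bigoplus_{t\in T}\pi_t$ into distinct (i.e. pairwise not unitarily equivalent) irreducible unitary representations $\pi_t$, each appearing with multiplicity $d$ and each acting on an $N$-dimensional space, with $$|T|\ge \exp\left(\beta_\varepsilon\, n N^2\right).$$
   Context: For a group $G$, a finite subset $S\subset G$ with $|S|=n$, and a unitary representation $\rho$ of $G$ on a Hilbert space $H_\rho$, let $H_\rho^{\mathrm{inv}}\subset H_\rho$ denote the subspace of all $\rho$-invariant vectors (vectors fixed by $\rho(g)$ for all $g\in G$), and define $$\lambda(\rho,S)=n^{-1}\sup\Big\{\Re\Big\langle \sum_{s\in S}\rho(s)\xi,\xi\Big\rangle \;\Big|\; \xi\in (H_\rho^{\mathrm{inv}})^\perp,\ \|\xi\|_{H_\rho}=1\Big\}.$$ If $(H_\rho^{\mathrm{inv}})^\perp=\{0\}$ the supremum over the empty set is taken to be $-\infty$ (so the condition $\lambda(\rho,S)\le 1-\varepsilon$ holds vacuously). Here $\overline{\pi}$ denotes the complex conjugate representation of $\pi$, acting on the conjugate Hilbert space $\overline{H}$, and $\pi\otimes\overline{\pi}$ is the representation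 $g\mapsto \pi(g)\otimes\overline{\pi(g)}$ on $H\otimes\overline{H}$. *)

theory Defs
  imports
    Complex_Main
    "HOL-Library.Extended_Real"
    "HOL-Algebra.Generated_Groups"
    "Jordan_Normal_Form.Schur_Decomposition"
    "Jordan_Normal_Form.VS_Connect"
begin

text \<open>
  A Hilbert space of finite dimension \<open>m\<close> is taken in orthonormal coordinates, as
  \<open>carrier_vec m\<close> over the complex numbers with the inner product \<open>v \<bullet>c w\<close>,
  which is linear in \<open>v\<close> and conjugate linear in \<open>w\<close>.
\<close>

definition unitary_group :: "nat \<Rightarrow> complex mat monoid" where
  "unitary_group m =
     \<lparr>carrier = {U \<in> carrier_mat m m. mat_adjoint U * U = 1\<^sub>m m \<and> U * mat_adjoint U = 1\<^sub>m m},
      monoid.mult = (*), one = 1\<^sub>m m\<rparr>"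

definition unitary_rep ::
  "('g, 'x) monoid_scheme \<Rightarrow> nat \<Rightarrow> ('g \<Rightarrow> complex mat) \<Rightarrow> bool" where
  "unitary_rep G m \<rho> \<longleftrightarrow> \<rho> \<in> hom G (unitary_group m)"

definition unitarily_equivalent ::
  "('g, 'x) monoid_scheme \<Rightarrow> nat \<Rightarrow> ('g \<Rightarrow> complex mat) \<Rightarrow> ('g \<Rightarrow> complex mat) \<Rightarrow> bool" where
  "unitarily_equivalent G m \<rho> \<sigma> \<longleftrightarrow>
     (\<exists>U \<in> carrier (unitary_group m). \<forall>g \<in> carrier G. \<sigma> g = U * \<rho> g * mat_adjoint U)"

definition irreducible_rep ::
  "('g, 'x) monoid_scheme \<Rightarrow> nat \<Rightarrow> ('g \<Rightarrow> complex mat) \<Rightarrow> bool" where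
  "irreducible_rep G m \<rho> \<longleftrightarrow>
     m > 0 \<and>
     (\<forall>W. VectorSpace.subspace class_ring W (module_vec TYPE(complex) m) \<longrightarrow>
        (\<forall>g \<in> carrier G. \<forall>w \<in> W. \<rho> g *\<^sub>v w \<in> W) \<longrightarrow>
        W = {0\<^sub>v m} \<or> W = carrier_vec m)"

definition invariant_vectors ::
  "('g, 'x) monoid_scheme \<Rightarrow> nat \<Rightarrow> ('g \<Rightarrow> complex mat) \<Rightarrow> complex vec set" where
  "invariant_vectors G m \<rho> = {v \<in> carrier_vec m. \<forall>g \<in> carrier G. \<rho> g *\<^sub>v v = v}"

text \<open>
  The library constant \<open>orthogonal_complement\<close> refers to the bilinear form \<open>v \<bullet> w\<close>,
  so it is not the orthogonal complement in the Hilbert space.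
\<close>

definition hermitian_complement :: "nat \<Rightarrow> complex vec set \<Rightarrow> complex vec set" where
  "hermitian_complement m W = {v \<in> carrier_vec m. \<forall>w \<in> W. v \<bullet>c w = 0}"

text \<open>
  The supremum is taken in the extended reals, so it is \<open>-\<infinity>\<close> for the empty set.
  The normalisation \<open>\<xi> \<bullet>c \<xi> = 1\<close> says that \<open>\<xi>\<close> has norm 1.
\<close>

definition rep_lambda ::
  "('g, 'x) monoid_scheme \<Rightarrow> nat \<Rightarrow> ('g \<Rightarrow> complex mat) \<Rightarrow> 'g set \<Rightarrow> ereal" where
  "rep_lambda G m \<rho> S =
     ereal (inverse (real (card S))) *
     Sup {ereal (Re (finsum_vec TYPE(complex) m (\<lambda>s. \<rho> s *\<^sub>v \<xi>) S \<bullet>c \<xi>)) | \<xi>.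
            \<xi> \<in> hermitian_complement m (invariant_vectors G m \<rho>) \<and> \<xi> \<bullet>c \<xi> = 1}"

text \<open>
  Kronecker product: the matrix of \<open>A \<otimes> B\<close> in the product basis, where the basis vector
  \<open>e\<^sub>i \<otimes> e\<^sub>j\<close> has the index \<open>i * k + j\<close> with \<open>k\<close> the dimension of the second factor.
\<close>

definition kronecker_mat :: "complex mat \<Rightarrow> complex mat \<Rightarrow> complex mat" where
  "kronecker_mat A B =
     mat (dim_row A * dim_row B) (dim_col A * dim_col B)
       (\<lambda>(i, j). A $$ (i div dim_row B, j div dim_col B) * B $$ (i mod dim_row B, j mod dim_col B))"

definition tensor_rep ::
  "('g \<Rightarrow> complex mat) \<Rightarrow> ('g \<Rightarrow> complex mat) \<Rightarrow> 'g \<Rightarrow> complex mat" where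
  "tensor_rep \<rho> \<sigma> = (\<lambda>g. kronecker_mat (\<rho> g) (\<sigma> g))"

text \<open>
  In the basis of the conjugate Hilbert space formed by the same vectors, the conjugate
  representation is given by the entrywise complex conjugate matrices.
\<close>

definition conj_rep :: "('g \<Rightarrow> complex mat) \<Rightarrow> 'g \<Rightarrow> complex mat" where
  "conj_rep \<rho> = (\<lambda>g. map_mat cnj (\<rho> g))"

text \<open>The direct sum over \<open>t \<in> T\<close> of \<open>d\<close> copies of \<open>\<sigma> t\<close>, for a finite set \<open>T\<close>.\<close>

definition isotypic_sum ::
  "nat set \<Rightarrow> nat \<Rightarrow> (nat \<Rightarrow> 'g \<Rightarrow> complex mat) \<Rightarrow> 'g \<Rightarrow> complex mat" where
  "isotypic_sum T d \<sigma> =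
     (\<lambda>g. diag_block_mat (concat (map (\<lambda>t. replicate d (\<sigma> t g)) (sorted_list_of_set T))))"

end

theory Submission
  imports
    Defs
    "HOL-Library.FuncSet"
    "HOL-Library.Countable_Set"
    "HOL-Analysis.L2_Norm"
    "HOL-Algebra.Weak_Morphisms"
    "HOL-Algebra.Product_Groups"
begin

text \<open>
  A spectral gap for \<open>\<pi> \<otimes> \<pi>\<close>-bar says that the maps \<open>X \<mapsto> \<Sum>\<^sub>i u\<^sub>i X v\<^sub>i\<^sup>*\<close> have norm at most
  \<open>n (1 - \<epsilon>)\<close>, where \<open>u\<close> and \<open>v\<close> run through the generator tuples of two of the \<open>\<pi>\<^sub>t\<close> (on trace
  zero \<open>X\<close> if \<open>u = v\<close>).  Irreducibility and inequivalence follow from this, so the task is to find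
  \<open>exp (\<beta> n N\<^sup>2)\<close> such tuples.  Start with a bounded number of fixed unitaries which form a quantum
  expander in dimension \<open>N\<close>, and adjoin a few orthogonal matrices from a packing of size
  \<open>exp (N\<^sup>2 / 32)\<close>.  If \<open>X\<close> almost intertwines two such tuples, then the expander forces \<open>X\<close> to be
  almost scalar, and separation of the packing excludes this.  This gives a small gap for each pair of
  letters; passing to words of a fixed length brings the norm close to 0, and a Gilbert-Varshamov
  code over the alphabet of letters makes the number of tuples exponential in \<open>n\<close>.
\<close>

section \<open>A packing of the orthogonal group\<close>

text \<open>The constants \<open>\<beta>\<close> and \<open>n0\<close> may depend on \<epsilon> only
  while \<open>N\<close> and \<open>n\<close> vary freely. Hence the expander matrices are explicit
  in every dimension, N = 1 included, and only the count of tuples rests on an entropy argument.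
  Against the factor 2 per coordinate that the code loses, one packed matrix per letter would be too
  little for small \<open>N\<close>; a letter therefore carries \<open>m\<close> of them, which
  raises the alphabet to exp (m N^2 / 32), with \<open>m\<close> chosen from \<epsilon>. Since the
  gap of a letter is raised to a power, a bound on the norm is needed and not just on the real part;
  for this the identity is one of the generators of every letter, as otherwise all terms could be
  one common rotation of \<open>X\<close>. The sum over all words of length l is the l-th power of
  the sum over the generators, so a letter fills a block of k^l positions. Orthogonal matrices are
  enough for the packing because their number already has the order N^2 in the exponent.\<close>

lemma exp_add_exp_minus_le: "exp x + exp (- x) \<le> 2 * exp (x\<^sup>2 / 2)" for x :: real
proof -
  have tanh_le: "tanh y \<le> y" if "0 \<le> y" for y :: real
  proof -
    have "(\<lambda>t. t - tanh t) 0 \<le> (\<lambda>t. t - tanh t) y"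
    proof (rule DERIV_nonneg_imp_nondecreasing[OF that])
      fix t :: real
      have "((\<lambda>t. t - tanh t) has_real_derivative (tanh t)\<^sup>2) (at t)"
        by (auto intro!: derivative_eq_intros)
      then show "\<exists>d. ((\<lambda>t. t - tanh t) has_real_derivative d) (at t) \<and> 0 \<le> d"
        by (meson zero_le_power2)
    qed
    then show ?thesis by simp
  qed
  \<comment> \<open>Second integration: ln cosh has derivative tanh, so \<open>tanh_le\<close>
    yields cosh y <= exp (y^2 / 2), the subgaussian bound for one random sign.\<close>
  have "ln (cosh y) \<le> y\<^sup>2 / 2" if "0 \<le> y" for y :: real
  proof -
    have "(\<lambda>t. t\<^sup>2 / 2 - ln (cosh t)) 0 \<le> (\<lambda>t. t\<^sup>2 / 2 - ln (cosh t)) y"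
    proof (rule DERIV_nonneg_imp_nondecreasing[OF that])
      fix t :: real assume "0 \<le> t"
      have "((\<lambda>t. t\<^sup>2 / 2 - ln (cosh t)) has_real_derivative (t - tanh t)) (at t)"
        by (auto intro!: derivative_eq_intros simp: tanh_def cosh_real_pos)
      with tanh_le[OF \<open>0 \<le> t\<close>]
      show "\<exists>d. ((\<lambda>t. t\<^sup>2 / 2 - ln (cosh t)) has_real_derivative d) (at t) \<and> 0 \<le> d"
        by (intro exI[of _ "t - tanh t"]) auto
    qed
    then show ?thesis by simp
  qed
  from this[of "\<bar>x\<bar>"] have "cosh x \<le> exp (x\<^sup>2 / 2)"
    by (metis abs_ge_zero cosh_real_abs cosh_real_pos power2_abs exp_le_cancel_iff exp_ln)
  then show ?thesis by (simp add: cosh_def)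
qed

section \<open>Random sign vectors\<close>

definition signs :: "nat \<Rightarrow> (nat \<Rightarrow> real) set" where
  "signs n = {..<n} \<rightarrow>\<^sub>E {- 1, 1}"

definition dot :: "nat \<Rightarrow> (nat \<Rightarrow> real) \<Rightarrow> (nat \<Rightarrow> real) \<Rightarrow> real" where
  "dot n x y = (\<Sum>j<n. x j * y j)"

lemma finite_signs [simp]: "finite (signs n)"
  by (auto simp: signs_def intro: finite_PiE)

lemma card_signs [simp]: "card (signs n) = 2 ^ n"
  by (simp add: signs_def card_funcsetE numeral_2_eq_2)

lemma dot_signs: "a \<in> signs n \<Longrightarrow> dot n a a = n"
proof -
  assume "a \<in> signs n"
  then have "a j * a j = 1" if "j < n" for j using that by (auto simp: signs_def dest!: PiE_mem)
  then show ?thesis by (simp add: dot_def)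
qed

text \<open>Moment generating function of a uniform sign vector: the coordinates are independent, so
  the sum factorises into factors 2 cosh (x j), each bounded by
  \<open>exp_add_exp_minus_le\<close>.\<close>

lemma sum_signs_exp:
  "(\<Sum>a\<in>signs n. exp (dot n a x)) \<le> 2 ^ n * exp (dot n x x / 2)"
proof -
  have "(\<Sum>a\<in>signs n. exp (dot n a x)) = (\<Sum>a\<in>signs n. \<Prod>j<n. exp (a j * x j))"
    by (simp add: dot_def exp_sum)
  also have "\<dots> = (\<Prod>j<n. \<Sum>s\<in>{- 1, 1}. exp (s * x j))"
    unfolding signs_def by (subst prod_sum_PiE) auto
  also have "\<dots> \<le> (\<Prod>j<n. 2 * exp ((x j)\<^sup>2 / 2))"
    using exp_add_exp_minus_le by (intro prod_mono) (auto simp: add.commute add_nonneg_nonneg)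
  also have "\<dots> = 2 ^ n * exp (dot n x x / 2)"
    by (simp add: prod.distrib dot_def exp_sum sum_divide_distrib power2_eq_square)
  finally show ?thesis .
qed

lemma sum_signs_Suc:
  "(\<Sum>a\<in>signs (Suc n). F a) = (\<Sum>a\<in>signs n. F (a(n := 1)) + F (a(n := - 1)))" for F :: "_ \<Rightarrow> real"
proof -
  have "signs (Suc n) = (\<lambda>(y, g). g(n := y)) ` ({- 1, 1} \<times> signs n)"
    unfolding signs_def lessThan_Suc by (rule PiE_insert_eq)
  moreover have "inj_on (\<lambda>(y, g). g(n := y)) ({- 1, 1} \<times> signs n)"
    unfolding signs_def by (rule inj_combinator) simp
  ultimately have "(\<Sum>a\<in>signs (Suc n). F a) = (\<Sum>(y, g)\<in>{- 1, 1} \<times> signs n. F (g(n := y)))"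
    by (simp add: sum.reindex case_prod_unfold)
  also have "\<dots> = (\<Sum>y\<in>{- 1, 1}. \<Sum>g\<in>signs n. F (g(n := y)))"
    by (rule sum.cartesian_product[symmetric])
  finally show ?thesis by (simp add: sum.distrib)
qed

lemma dot_upd: "dot (Suc n) (a(n := c)) x = dot n a x + c * x n"
  by (simp add: dot_def)

text \<open>Adding the two choices of the last sign cancels the cross term.\<close>

lemma sum_signs_dot_squared: "(\<Sum>a\<in>signs n. (dot n a x)\<^sup>2) = 2 ^ n * dot n x x"
proof (induction n)
  case 0
  show ?case by (simp add: signs_def dot_def)
next
  case (Suc n)
  have "(\<Sum>a\<in>signs (Suc n). (dot (Suc n) a x)\<^sup>2) = (\<Sum>a\<in>signs n. 2 * (dot n a x)\<^sup>2 + 2 * (x n)\<^sup>2)"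
    unfolding sum_signs_Suc dot_upd by (simp add: power2_eq_square algebra_simps)
  also have "\<dots> = 2 * (2 ^ n * dot n x x) + 2 * 2 ^ n * (x n)\<^sup>2"
    by (simp add: sum.distrib flip: Suc sum_distrib_left)
  also have "\<dots> = 2 ^ Suc n * dot (Suc n) x x"
    by (simp add: dot_def power2_eq_square algebra_simps)
  finally show ?case .
qed

lemma dot_commute: "dot n x y = dot n y x"
  by (simp add: dot_def mult.commute)

lemma dot_diff_sum:
  "dot n (\<lambda>j. x j - (\<Sum>k<i. c k * u k j)) y = dot n x y - (\<Sum>k<i. c k * dot n (u k) y)"
proof -
  have "dot n (\<lambda>j. x j - (\<Sum>k<i. c k * u k j)) y
      = dot n x y - (\<Sum>j<n. \<Sum>k<i. c k * (u k j * y j))"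
    by (simp add: dot_def left_diff_distrib sum_subtractf sum_distrib_right mult.assoc)
  also have "(\<Sum>j<n. \<Sum>k<i. c k * (u k j * y j)) = (\<Sum>k<i. c k * dot n (u k) y)"
    by (subst sum.swap) (simp add: dot_def sum_distrib_left)
  finally show ?thesis .
qed

lemma dot_scale: "dot n (\<lambda>j. c * x j) y = c * dot n x y"
  by (simp add: dot_def sum_distrib_left mult.assoc)

lemma dot_nonneg: "0 \<le> dot n x x"
  by (simp add: dot_def sum_nonneg)

section \<open>Orthonormal systems and the greedy orthogonal matrix\<close>

definition orthonormal :: "nat \<Rightarrow> nat \<Rightarrow> (nat \<Rightarrow> nat \<Rightarrow> real) \<Rightarrow> bool" where
  "orthonormal n i u \<longleftrightarrow> (\<forall>k<i. \<forall>l<i. dot n (u k) (u l) = (if k = l then 1 else 0))"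

text \<open>\<open>r\<close> is the squared length of the component \<open>w\<close> of
  \<open>x\<close> orthogonal to all \<open>u k\<close>, because
  \<open>dot n w w = dot n w x\<close>. If it is positive, \<open>w\<close> normalised has
  correlation exactly \<open>sqrt r\<close> with \<open>x\<close>.\<close>

lemma orthonormal_residual:
  fixes x :: "nat \<Rightarrow> real"
  assumes u: "orthonormal n i u"
  defines "r \<equiv> dot n x x - (\<Sum>k<i. (dot n x (u k))\<^sup>2)"
  shows "0 \<le> r"
    and "0 < r \<Longrightarrow> \<exists>v. dot n v v = 1 \<and> (\<forall>k<i. dot n v (u k) = 0) \<and> dot n x v = sqrt r"
proof -
  define w where "w = (\<lambda>j. x j - (\<Sum>k<i. dot n x (u k) * u k j))"
  have orth: "dot n w (u l) = 0" if "l < i" for l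
  proof -
    have "(\<Sum>k<i. dot n x (u k) * dot n (u k) (u l)) = (\<Sum>k<i. if k = l then dot n x (u l) else 0)"
      using u that by (intro sum.cong) (auto simp: orthonormal_def)
    then show ?thesis unfolding w_def dot_diff_sum using that by simp
  qed
  have xw: "dot n w x = r"
    unfolding w_def dot_diff_sum r_def by (simp add: dot_commute[of n "u _" x] power2_eq_square)
  have "dot n w w = dot n x w - (\<Sum>k<i. dot n x (u k) * dot n (u k) w)"
    unfolding w_def by (rule dot_diff_sum)
  also have "\<dots> = r" using orth xw by (simp add: dot_commute[of n "u _" w] dot_commute[of n x w])
  finally have ww: "dot n w w = r" .
  then show "0 \<le> r" using dot_nonneg[of n w] by simp
  assume "0 < r"
  show "\<exists>v. dot n v v = 1 \<and> (\<forall>k<i. dot n v (u k) = 0) \<and> dot n x v = sqrt r"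
  proof (intro exI conjI allI impI)
    let ?v = "\<lambda>j. (1 / sqrt r) * w j"
    show "dot n ?v ?v = 1"
      using \<open>0 < r\<close> by (subst dot_scale, subst dot_commute, subst dot_scale) (simp add: ww field_simps)
    show "dot n ?v (u k) = 0" if "k < i" for k using orth[OF that] by (subst dot_scale) simp
    show "dot n x ?v = sqrt r"
      using \<open>0 < r\<close> by (subst dot_commute, subst dot_scale) (simp add: xw real_div_sqrt)
  qed
qed

text \<open>The residuals of the n standard basis vectors add up to n - i > 0, so some basis vector
  has a nonzero component orthogonal to the system.\<close>

lemma orthonormal_extend:
  assumes u: "orthonormal n i u" and "i < n"
  shows "\<exists>v. dot n v v = 1 \<and> (\<forall>k<i. dot n v (u k) = 0)"
proof -
  define e where "e = (\<lambda>j l::nat. if l = j then 1 else 0 :: real)"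
  have e: "dot n (e j) x = x j" if "j < n" for j x
    using that by (simp add: e_def dot_def if_distrib[where f = "\<lambda>c. c * _"] cong: if_cong)
  have "(\<Sum>j<n. dot n (e j) (e j) - (\<Sum>k<i. (dot n (e j) (u k))\<^sup>2)) = (\<Sum>j<n. 1 - (\<Sum>k<i. (u k j)\<^sup>2))"
    by (intro sum.cong) (auto simp: e, simp add: e_def)
  also have "\<dots> = n - (\<Sum>k<i. dot n (u k) (u k))"
  proof -
    have "(\<Sum>j<n. \<Sum>k<i. (u k j)\<^sup>2) = (\<Sum>k<i. dot n (u k) (u k))"
      by (subst sum.swap) (simp add: dot_def power2_eq_square)
    then show ?thesis by (simp add: sum_subtractf)
  qed
  also have "\<dots> = real n - real i" using u by (simp add: orthonormal_def)
  also have "\<dots> > 0" using \<open>i < n\<close> by simp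
  finally obtain j where "0 < dot n (e j) (e j) - (\<Sum>k<i. (dot n (e j) (u k))\<^sup>2)"
    by (meson linorder_not_le sum_nonpos)
  from orthonormal_residual(2)[OF u this] show ?thesis by blast
qed

text \<open>The correlation reached is \<open>sqrt r\<close>. As r <= n, it satisfies r <= sqrt n *
  sqrt r, and this form is linear in the squares of the \<open>dot n x (u k)\<close>, so that it can
  be averaged exactly.\<close>

lemma orthonormal_extend_aligned:
  assumes u: "orthonormal n i u" and "i < n" and x: "dot n x x = n"
  shows "\<exists>v. dot n v v = 1 \<and> (\<forall>k<i. dot n v (u k) = 0) \<and>
    n - (\<Sum>k<i. (dot n x (u k))\<^sup>2) \<le> sqrt n * dot n x v"
proof -
  define r where "r = dot n x x - (\<Sum>k<i. (dot n x (u k))\<^sup>2)"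
  show ?thesis
  proof (cases "0 < r")
    case True
    with orthonormal_residual(2)[OF u] obtain v
      where v: "dot n v v = 1" "\<forall>k<i. dot n v (u k) = 0" "dot n x v = sqrt r"
      unfolding r_def by metis
    have "r = sqrt r * sqrt r" using True by simp
    also have "\<dots> \<le> sqrt n * sqrt r"
      using True by (intro mult_right_mono) (auto simp: r_def x sum_nonneg)
    finally show ?thesis using v x by (auto simp: r_def)
  next
    case False
    with orthonormal_residual(1)[OF u, of x] have r: "r = 0" by (simp add: r_def)
    obtain v where v: "dot n v v = 1" "\<forall>k<i. dot n v (u k) = 0"
      using orthonormal_extend[OF u \<open>i < n\<close>] by blast
    \<comment> \<open>Degenerate case: any new unit vector serves. Choosing its sign makes the
      correlation nonnegative without a proof that it vanishes.\<close>
    define s :: real where "s = (if 0 \<le> dot n x v then 1 else - 1)"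
    have sv: "dot n (\<lambda>j. s * v j) y = s * dot n v y" for y by (rule dot_scale)
    have "dot n (\<lambda>j. s * v j) (\<lambda>j. s * v j) = 1"
      by (subst sv, subst dot_commute, subst sv) (simp add: v s_def)
    moreover have "0 \<le> dot n x (\<lambda>j. s * v j)"
      by (subst dot_commute, subst sv) (simp add: s_def dot_commute[of n v])
    ultimately show ?thesis using v(2) r x
      by (intro exI[of _ "\<lambda>j. s * v j"]) (auto simp: sv r_def)
  qed
qed

text \<open>Gram-Schmidt from the end of the list: the rows built from \<open>as\<close> do not see
  \<open>a\<close>, so \<open>a\<close> stays independent of them in averages. The choice includes
  the degenerate residual; \<open>orthonormal_extend_aligned\<close> shows that it succeeds while
  fewer than \<open>n\<close> rows are present.\<close>

primrec greedy_rows :: "nat \<Rightarrow> (nat \<Rightarrow> real) list \<Rightarrow> (nat \<Rightarrow> real) list" where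
  "greedy_rows n [] = []"
| "greedy_rows n (a # as) =
    greedy_rows n as @ [SOME v. dot n v v = 1 \<and> (\<forall>k<length as. dot n v (greedy_rows n as ! k) = 0) \<and>
      n - (\<Sum>k<length as. (dot n a (greedy_rows n as ! k))\<^sup>2) \<le> sqrt n * dot n a v]"

lemma length_greedy_rows [simp]: "length (greedy_rows n as) = length as"
  by (induction as) auto

abbreviation sign_rows :: "nat \<Rightarrow> nat \<Rightarrow> (nat \<Rightarrow> real) list set" where
  "sign_rows n i \<equiv> {as. set as \<subseteq> signs n \<and> length as = i}"

lemma greedy_rows_step:
  assumes "orthonormal n i ((!) (greedy_rows n as))" "as \<in> sign_rows n i" "a \<in> signs n" "i < n"
  shows "dot n (greedy_rows n (a # as) ! i) (greedy_rows n (a # as) ! i) = 1"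
    and "\<And>k. k < i \<Longrightarrow> dot n (greedy_rows n (a # as) ! i) (greedy_rows n as ! k) = 0"
    and "n - (\<Sum>k<i. (dot n a (greedy_rows n as ! k))\<^sup>2) \<le> sqrt n * dot n a (greedy_rows n (a # as) ! i)"
proof -
  have i: "length as = i" using assms by auto
  have "\<exists>v. dot n v v = 1 \<and> (\<forall>k<i. dot n v (greedy_rows n as ! k) = 0) \<and>
      n - (\<Sum>k<i. (dot n a (greedy_rows n as ! k))\<^sup>2) \<le> sqrt n * dot n a v"
    using assms by (intro orthonormal_extend_aligned dot_signs) auto
  note v = someI_ex[OF this]
  have g: "greedy_rows n (a # as) ! i = (SOME v. dot n v v = 1 \<and> (\<forall>k<i. dot n v (greedy_rows n as ! k) = 0) \<and>
      n - (\<Sum>k<i. (dot n a (greedy_rows n as ! k))\<^sup>2) \<le> sqrt n * dot n a v)"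
    using nth_append_length[of "greedy_rows n as"] by (simp only: greedy_rows.simps length_greedy_rows i)
  show "dot n (greedy_rows n (a # as) ! i) (greedy_rows n (a # as) ! i) = 1"
    "\<And>k. k < i \<Longrightarrow> dot n (greedy_rows n (a # as) ! i) (greedy_rows n as ! k) = 0"
    "n - (\<Sum>k<i. (dot n a (greedy_rows n as ! k))\<^sup>2) \<le> sqrt n * dot n a (greedy_rows n (a # as) ! i)"
    using v unfolding g by blast+
qed

lemma orthonormal_greedy_rows:
  "as \<in> sign_rows n i \<Longrightarrow> i \<le> n \<Longrightarrow> orthonormal n i ((!) (greedy_rows n as))"
proof (induction as arbitrary: i)
  case Nil
  then show ?case by (simp add: orthonormal_def)
next
  case (Cons a as)
  then obtain i' where i: "i = Suc i'" "as \<in> sign_rows n i'" "a \<in> signs n" "i' < n" by auto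
  have IH: "orthonormal n i' ((!) (greedy_rows n as))" using Cons.IH i by simp
  note step = greedy_rows_step[OF IH i(2-4)]
  have old: "greedy_rows n (a # as) ! k = greedy_rows n as ! k" if "k < i'" for k
    using i that by (auto simp: nth_append)
  show ?case
    unfolding orthonormal_def i
  proof (intro allI impI)
    fix k l assume "k < Suc i'" "l < Suc i'"
    then consider "k < i'" "l < i'" | "k < i'" "l = i'" | "k = i'" "l < i'" | "k = i'" "l = i'"
      by linarith
    then show "dot n (greedy_rows n (a # as) ! k) (greedy_rows n (a # as) ! l) = (if k = l then 1 else 0)"
    proof cases
      case 1
      then show ?thesis using IH by (simp add: old orthonormal_def del: greedy_rows.simps)
    next
      case 2
      then show ?thesis using step(2)[of k] by (simp add: old dot_commute[of n "greedy_rows n as ! k"] del: greedy_rows.simps)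
    next
      case 3
      then show ?thesis using step(2)[of l] by (simp add: old del: greedy_rows.simps)
    next
      case 4
      then show ?thesis using step(1) by simp
    qed
  qed
qed

lemma sum_sign_rows_Suc:
  "(\<Sum>as\<in>sign_rows n (Suc i). F as) = (\<Sum>as\<in>sign_rows n i. \<Sum>a\<in>signs n. F (a # as))"
  for F :: "_ \<Rightarrow> real"
  by (subst lists_length_Suc_eq, subst sum.reindex)
    (auto simp: inj_on_def sum.cartesian_product case_prod_unfold)

lemma card_sign_rows: "card (sign_rows n i) = 2 ^ (n * i)"
  by (simp add: card_lists_length_eq power_mult)

text \<open>New rows are prepended to \<open>as\<close> but appended by \<open>greedy_rows\<close>, hence the \<open>rev\<close>.\<close>

definition pairing :: "nat \<Rightarrow> nat \<Rightarrow> (nat \<Rightarrow> real) list \<Rightarrow> (nat \<Rightarrow> nat \<Rightarrow> real) \<Rightarrow> real" where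
  "pairing n i as u = (\<Sum>k<i. dot n (rev as ! k) (u k))"

lemma pairing_Suc:
  "as \<in> sign_rows n i \<Longrightarrow> pairing n (Suc i) (a # as) u = pairing n i as u + dot n a (u i)"
  by (auto simp: pairing_def nth_append)

text \<open>The rows of \<open>as\<close> are independent and each contributes a factor bounded by
  \<open>sum_signs_exp\<close>. Here \<open>u\<close> is fixed; the greedy matrix, which depends on
  \<open>as\<close>, is treated in \<open>sum_pairing_greedy\<close>.\<close>

lemma sum_exp_pairing:
  "(\<Sum>as\<in>sign_rows n i. exp (pairing n i as u))
    \<le> 2 ^ (n * i) * exp ((\<Sum>k<i. dot n (u k) (u k)) / 2)"
proof (induction i)
  case 0
  have "sign_rows n 0 = {[]}" by auto
  then show ?case by (simp add: pairing_def)
next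
  case (Suc i)
  have "(\<Sum>as\<in>sign_rows n (Suc i). exp (pairing n (Suc i) as u))
    = (\<Sum>as\<in>sign_rows n i. exp (pairing n i as u) * (\<Sum>a\<in>signs n. exp (dot n a (u i))))"
    unfolding sum_sign_rows_Suc by (intro sum.cong refl) (simp add: pairing_Suc exp_add sum_distrib_left)
  also have "\<dots> \<le> (\<Sum>as\<in>sign_rows n i. exp (pairing n i as u) * (2 ^ n * exp (dot n (u i) (u i) / 2)))"
    by (intro sum_mono mult_left_mono sum_signs_exp) simp
  also have "\<dots> \<le> 2 ^ (n * i) * exp ((\<Sum>k<i. dot n (u k) (u k)) / 2) * (2 ^ n * exp (dot n (u i) (u i) / 2))"
    unfolding sum_distrib_right[symmetric] by (intro mult_right_mono Suc) simp
  also have "\<dots> = 2 ^ (n * Suc i) * exp ((\<Sum>k<Suc i. dot n (u k) (u k)) / 2)"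
    by (simp add: power_add exp_add add_divide_distrib algebra_simps)
  finally show ?case .
qed

lemma pairing_greedy_Cons:
  assumes "as \<in> sign_rows n i"
  shows "pairing n (Suc i) (a # as) ((!) (greedy_rows n (a # as)))
    = pairing n i as ((!) (greedy_rows n as)) + dot n a (greedy_rows n (a # as) ! i)"
proof -
  have i: "length as = i" using assms by simp
  have "pairing n i as ((!) (greedy_rows n (a # as))) = pairing n i as ((!) (greedy_rows n as))"
    unfolding pairing_def by (intro sum.cong refl) (simp add: nth_append i)
  then show ?thesis using pairing_Suc[OF assms] by simp
qed

text \<open>Over a fresh sign row, the squared correlation with a unit vector averages 1
  (\<open>sum_signs_dot_squared\<close>), so the residual against i earlier rows averages n - i, and
  \<open>greedy_rows_step\<close> turns it into correlation. At i = n the left sum is n (n + 1) /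
  2.\<close>

lemma sum_pairing_greedy:
  "i \<le> n \<Longrightarrow> 2 ^ (n * i) * (\<Sum>k<i. real n - real k)
    \<le> sqrt n * (\<Sum>as\<in>sign_rows n i. pairing n i as ((!) (greedy_rows n as)))"
proof (induction i)
  case 0
  then show ?case by (simp add: pairing_def)
next
  case (Suc i)
  let ?g = "\<lambda>as. (!) (greedy_rows n as)"
  have row: "2 ^ n * (real n - real i) \<le> (\<Sum>a\<in>signs n. sqrt n * dot n a (?g (a # as) i))"
    if as: "as \<in> sign_rows n i" for as
  proof -
    have on: "orthonormal n i (?g as)" using orthonormal_greedy_rows[OF as] Suc.prems by linarith
    have "(\<Sum>a\<in>signs n. \<Sum>k<i. (dot n a (?g as k))\<^sup>2) = (\<Sum>k<i. 2 ^ n * dot n (?g as k) (?g as k))"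
      by (subst sum.swap) (simp add: sum_signs_dot_squared)
    also have "\<dots> = 2 ^ n * real i" using on by (simp add: orthonormal_def)
    finally have "(\<Sum>a\<in>signs n. n - (\<Sum>k<i. (dot n a (?g as k))\<^sup>2)) = 2 ^ n * (real n - real i)"
      by (simp add: sum_subtractf algebra_simps)
    moreover have "(\<Sum>a\<in>signs n. n - (\<Sum>k<i. (dot n a (?g as k))\<^sup>2)) \<le> (\<Sum>a\<in>signs n. sqrt n * dot n a (?g (a # as) i))"
      using greedy_rows_step(3)[OF on as] Suc.prems by (intro sum_mono) simp
    ultimately show ?thesis by simp
  qed
  have "2 ^ (n * Suc i) * (\<Sum>k<Suc i. real n - real k)
      = 2 ^ n * (2 ^ (n * i) * (\<Sum>k<i. real n - real k)) + 2 ^ (n * i) * (2 ^ n * (real n - real i))"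
    by (simp add: power_add algebra_simps)
  also have "\<dots> \<le> 2 ^ n * (sqrt n * (\<Sum>as\<in>sign_rows n i. pairing n i as (?g as)))
      + (\<Sum>as\<in>sign_rows n i. \<Sum>a\<in>signs n. sqrt n * dot n a (?g (a # as) i))"
  proof (intro add_mono mult_left_mono)
    show "2 ^ (n * i) * (\<Sum>k<i. real n - real k) \<le> sqrt n * (\<Sum>as\<in>sign_rows n i. pairing n i as (?g as))"
      using Suc by simp
    have "2 ^ (n * i) * (2 ^ n * (real n - real i)) = (\<Sum>as\<in>sign_rows n i. 2 ^ n * (real n - real i))"
      using card_sign_rows[of n i] by simp
    also have "\<dots> \<le> (\<Sum>as\<in>sign_rows n i. \<Sum>a\<in>signs n. sqrt n * dot n a (?g (a # as) i))"
      using row by (rule sum_mono)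
    finally show "2 ^ (n * i) * (2 ^ n * (real n - real i))
      \<le> (\<Sum>as\<in>sign_rows n i. \<Sum>a\<in>signs n. sqrt n * dot n a (?g (a # as) i))" .
  qed simp
  also have "\<dots> = sqrt n * (\<Sum>as\<in>sign_rows n (Suc i). pairing n (Suc i) as (?g as))"
  proof -
    have "(\<Sum>as\<in>sign_rows n (Suc i). pairing n (Suc i) as (?g as))
      = (\<Sum>as\<in>sign_rows n i. \<Sum>a\<in>signs n. pairing n i as (?g as) + dot n a (?g (a # as) i))"
      unfolding sum_sign_rows_Suc by (intro sum.cong refl pairing_greedy_Cons) 
    then show ?thesis by (simp add: sum.distrib distrib_left sum_distrib_left mult.left_commute del: greedy_rows.simps)
  qed
  finally show ?case .
qed

section \<open>Covering and packing by orthogonal matrices\<close>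

definition sqdist :: "nat \<Rightarrow> (nat \<Rightarrow> nat \<Rightarrow> real) \<Rightarrow> (nat \<Rightarrow> nat \<Rightarrow> real) \<Rightarrow> real" where
  "sqdist n u v = (\<Sum>i<n. \<Sum>j<n. (u i j - v i j)\<^sup>2)"

text \<open>Cauchy-Schwarz; the factor n is the Hilbert-Schmidt norm of a sign matrix.\<close>

lemma pairing_le_sqdist:
  assumes "as \<in> sign_rows n n"
  shows "pairing n n as u - pairing n n as v \<le> n * sqrt (sqdist n u v)"
proof -
  let ?S = "{..<n} \<times> {..<n}"
  have sq: "(rev as ! i) j * (rev as ! i) j = 1" if "i < n" "j < n" for i j
  proof -
    have "rev as ! i \<in> set (rev as)" using assms that by (intro nth_mem) simp
    then have "rev as ! i \<in> signs n" using assms by auto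
    then have "(rev as ! i) j \<in> {- 1, 1}" using that unfolding signs_def by blast
    then show ?thesis by auto
  qed
  have "pairing n n as u - pairing n n as v = (\<Sum>(i, j)\<in>?S. (rev as ! i) j * (u i j - v i j))"
    by (simp add: pairing_def dot_def sum.cartesian_product[symmetric] right_diff_distrib sum_subtractf)
  also have "\<dots> \<le> (\<Sum>x\<in>?S. \<bar>case x of (i, j) \<Rightarrow> (rev as ! i) j\<bar> * \<bar>case x of (i, j) \<Rightarrow> u i j - v i j\<bar>)"
    by (intro sum_mono) (auto simp flip: abs_mult)
  also have "\<dots> \<le> L2_set (\<lambda>(i, j). (rev as ! i) j) ?S * L2_set (\<lambda>(i, j). u i j - v i j) ?S"
    by (rule L2_set_mult_ineq)
  also have "L2_set (\<lambda>(i, j). (rev as ! i) j) ?S = sqrt (\<Sum>x\<in>?S. 1)"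
    unfolding L2_set_def by (intro arg_cong[of _ _ sqrt] sum.cong) (auto simp: power2_eq_square sq)
  also have "\<dots> = n" by simp
  also have "L2_set (\<lambda>(i, j). u i j - v i j) ?S = sqrt (sqdist n u v)"
    by (simp add: L2_set_def sqdist_def sum.cartesian_product case_prod_unfold)
  finally show ?thesis .
qed

text \<open>
  A random sign matrix \<open>A\<close> correlates with some orthogonal matrix, chosen by Gram-Schmidt on the rows
  of \<open>A\<close>, by \<open>n\<^sup>3\<^sup>/\<^sup>2 / 2\<close> on average, while its correlation with a fixed centre is subgaussian.
  So few centres cannot come close to every orthogonal matrix.
\<close>

lemma orthogonal_covering_number:
  assumes "finite C" and "0 < n"
    and orth: "\<And>v. v \<in> C \<Longrightarrow> orthonormal n n v"
    and cover: "\<And>u. orthonormal n n u \<Longrightarrow> \<exists>v\<in>C. sqdist n u v < n / 16"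
  shows "exp ((real n)\<^sup>2 / 32) \<le> card C"
proof -
  let ?S = "sign_rows n n"
  let ?g = "\<lambda>as. pairing n n as ((!) (greedy_rows n as))"
  define s where "s = sqrt (real n)"
  have s: "s * s = n" "0 < s" using \<open>0 < n\<close> by (auto simp: s_def)
  let ?sc = "\<lambda>v (k :: nat) (j :: nat). (s / 4) * v k j"
  \<comment> \<open>The scaled greedy pairing averages at least n^2 / 8. Moving from the greedy
    matrix to a centre at distance s / 4 costs (s / 4) * n * (s / 4) = n^2 / 16, which
    \<open>y\<close> subtracts; n^2 / 16 is left on average.\<close>
  define y where "y as = (s / 4) * ?g as - n * n / 16" for as
  have avg: "2 ^ (n * n) * (n * n / 16) \<le> (\<Sum>as\<in>?S. y as)"
  proof -
    have "(\<Sum>k<m. real n - real k) = m * n - m * (m - 1) / 2" for m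
      by (induction m) (auto simp: field_simps of_nat_diff)
    from this[of n] have "n * n / 2 \<le> (\<Sum>k<n. real n - real k)"
      using \<open>0 < n\<close> by (simp add: field_simps)
    then have "2 ^ (n * n) * (n * n / 2) \<le> (2 ^ (n * n) * (\<Sum>k<n. real n - real k) :: real)"
      by (intro mult_left_mono) auto
    also have "\<dots> \<le> s * (\<Sum>as\<in>?S. ?g as)"
      using sum_pairing_greedy[of n n] by (simp add: s_def)
    finally have "2 ^ (n * n) * (n * n / 2) \<le> s * (\<Sum>as\<in>?S. ?g as)" .
    moreover have "(\<Sum>as\<in>?S. y as) = (s * (\<Sum>as\<in>?S. ?g as)) / 4 - 2 ^ (n * n) * (n * n / 16)"
      using card_sign_rows[of n n] by (simp add: y_def sum_subtractf sum_distrib_left sum_divide_distrib)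
    ultimately show ?thesis by (simp add: algebra_simps)
  qed
  \<comment> \<open>Jensen's inequality through the tangent of exp at n^2 / 16.\<close>
  have "2 ^ (n * n) * exp (n * n / 16) \<le> (\<Sum>as\<in>?S. exp (n * n / 16) * (1 + (y as - n * n / 16)))"
  proof -
    have "(\<Sum>as\<in>?S. exp (n * n / 16) * (1 + (y as - n * n / 16)))
      = exp (n * n / 16) * (2 ^ (n * n) + ((\<Sum>as\<in>?S. y as) - 2 ^ (n * n) * (n * n / 16)))"
      using card_sign_rows[of n n]
      by (simp add: sum_distrib_left[symmetric] sum.distrib sum_subtractf)
    also have "\<dots> \<ge> exp (n * n / 16) * 2 ^ (n * n)"
      using avg by (intro mult_left_mono) auto
    finally show ?thesis by (simp add: mult.commute)
  qed
  also have "\<dots> \<le> (\<Sum>as\<in>?S. exp (y as))"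
  proof (intro sum_mono)
    fix as
    have "exp (y as) = exp (n * n / 16) * exp (y as - n * n / 16)" by (simp flip: exp_add)
    then show "exp (n * n / 16) * (1 + (y as - n * n / 16)) \<le> exp (y as)"
      using exp_ge_add_one_self by (simp add: mult_left_mono)
  qed
  also have "\<dots> \<le> (\<Sum>as\<in>?S. \<Sum>v\<in>C. exp (pairing n n as (?sc v)))"
  proof (intro sum_mono)
    fix as assume as: "as \<in> ?S"
    obtain v where v: "v \<in> C" "sqdist n ((!) (greedy_rows n as)) v < n / 16"
      using cover[OF orthonormal_greedy_rows[OF as]] by auto
    have "sqrt (sqdist n ((!) (greedy_rows n as)) v) \<le> sqrt (n / 16)" using v by simp
    also have "sqrt (n / 16) = s / 4" by (simp add: s_def real_sqrt_divide)
    finally have "?g as - pairing n n as v \<le> n * (s / 4)"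
      using pairing_le_sqdist[OF as, of "(!) (greedy_rows n as)" v] by (meson mult_left_mono of_nat_0_le_iff order_trans)
    then have "(s / 4) * (?g as - pairing n n as v) \<le> (s / 4) * (n * (s / 4))"
      using s by (intro mult_left_mono) auto
    also have "\<dots> = n * n / 16" using s by (simp add: algebra_simps)
    finally have "y as \<le> (s / 4) * pairing n n as v" by (simp add: y_def algebra_simps)
    also have "\<dots> = pairing n n as (?sc v)"
      by (simp add: pairing_def dot_def sum_distrib_left algebra_simps)
    finally have "exp (y as) \<le> exp (pairing n n as (?sc v))" by simp
    also have "\<dots> \<le> (\<Sum>v\<in>C. exp (pairing n n as (?sc v)))"
      by (rule member_le_sum) (use v \<open>finite C\<close> in auto)
    finally show "exp (y as) \<le> (\<Sum>v\<in>C. exp (pairing n n as (?sc v)))" .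
  qed
  also have "\<dots> = (\<Sum>v\<in>C. \<Sum>as\<in>?S. exp (pairing n n as (?sc v)))"
    by (rule sum.swap)
  \<comment> \<open>After scaling, a fixed centre has total squared length n^2 / 16, so its
    exponential moment is at most exp (n^2 / 32). Against the average exp (n^2 / 16) this leaves exp
    (n^2 / 32) for the number of centres.\<close>
  also have "\<dots> \<le> (\<Sum>v\<in>C. 2 ^ (n * n) * exp (n * n / 32))"
  proof (intro sum_mono)
    fix v assume "v \<in> C"
    have "dot n (\<lambda>j. (s / 4) * v k j) (\<lambda>j. (s / 4) * v k j) = n / 16" if "k < n" for k
    proof -
      have "dot n (v k) (v k) = 1" using orth[OF \<open>v \<in> C\<close>] that by (simp add: orthonormal_def)
      then show ?thesis by (subst dot_scale, subst dot_commute, subst dot_scale) (use s in simp)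
    qed
    then have "(\<Sum>k<n. dot n (\<lambda>j. (s / 4) * v k j) (\<lambda>j. (s / 4) * v k j)) = (\<Sum>k<n. n / 16)"
      by (intro sum.cong refl) (simp only: lessThan_iff)
    then show "(\<Sum>as\<in>?S. exp (pairing n n as (?sc v))) \<le> 2 ^ (n * n) * exp (n * n / 32)"
      using sum_exp_pairing[of n n "?sc v"] by (simp del: times_divide_eq_left times_divide_eq_right) (simp add: field_simps)
  qed
  also have "\<dots> = 2 ^ (n * n) * (card C * exp (n * n / 32))" by simp
  finally have "exp (n * n / 16) \<le> card C * exp (n * n / 32)" by simp
  moreover have "exp (real (n * n) / 16) = exp (n * n / 32) * exp (n * n / 32)"
    by (simp flip: exp_add)
  ultimately show ?thesis by (simp add: power2_eq_square)
qed

text \<open>A separated set below the bound is not a covering by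
  \<open>orthogonal_covering_number\<close>, so some orthogonal matrix is far from all its points
  and can be added; induction on the size.\<close>

lemma orthogonal_packing:
  assumes "0 < n"
  obtains C where "finite C" "exp ((real n)\<^sup>2 / 32) \<le> card C" "\<And>v. v \<in> C \<Longrightarrow> orthonormal n n v"
    "\<And>u v. u \<in> C \<Longrightarrow> v \<in> C \<Longrightarrow> u \<noteq> v \<Longrightarrow> n / 16 \<le> sqdist n u v"
proof -
  let ?P = "\<lambda>C. finite C \<and> (\<forall>v\<in>C. orthonormal n n v) \<and>
    (\<forall>u\<in>C. \<forall>v\<in>C. u \<noteq> v \<longrightarrow> n / 16 \<le> sqdist n u v)"
  have "\<exists>C. ?P C \<and> (exp ((real n)\<^sup>2 / 32) \<le> card C \<or> card C = m)" for m
  proof (induction m)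
    case 0
    show ?case by (intro exI[of _ "{}"]) auto
  next
    case (Suc m)
    then obtain C where C: "?P C" "exp ((real n)\<^sup>2 / 32) \<le> card C \<or> card C = m" by blast
    show ?case
    proof (cases "exp ((real n)\<^sup>2 / 32) \<le> card C")
      case False
      with orthogonal_covering_number[of C n] C assms
      obtain u where u: "orthonormal n n u" "\<And>v. v \<in> C \<Longrightarrow> n / 16 \<le> sqdist n u v"
        by (meson not_le)
      have "sqdist n u u = 0" by (simp add: sqdist_def)
      then have "u \<notin> C" using u(2)[of u] assms by auto
      have "n / 16 \<le> sqdist n v u" if "v \<in> C" for v
        using u(2)[OF that] by (simp add: sqdist_def power2_commute)
      then have "?P (insert u C)" using C(1) u by simp
      moreover have "card (insert u C) = Suc m" using C False \<open>u \<notin> C\<close> by simp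
      ultimately show ?thesis by blast
    qed (use C in blast)
  qed
  from this[of "nat \<lceil>exp ((real n)\<^sup>2 / 32)\<rceil>"] obtain C where C: "?P C"
    "exp ((real n)\<^sup>2 / 32) \<le> card C \<or> card C = nat \<lceil>exp ((real n)\<^sup>2 / 32)\<rceil>" by blast
  then have "exp ((real n)\<^sup>2 / 32) \<le> card C" by (auto intro: real_nat_ceiling_ge)
  with C show ?thesis by (intro that[of C]) auto
qed

section \<open>Codes with small agreement\<close>

text \<open>The neighbourhoods of a maximal independent set cover \<open>\<Omega>\<close>, and each
  has at most \<open>K\<close> elements.\<close>

lemma greedy_independent_set:
  assumes "finite \<Omega>"
    and refl: "\<And>x. x \<in> \<Omega> \<Longrightarrow> near x x"
    and sym: "\<And>x y. near x y \<Longrightarrow> near y x"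
    and K: "\<And>x. x \<in> \<Omega> \<Longrightarrow> real (card {y \<in> \<Omega>. near x y}) \<le> K"
  shows "\<exists>C. C \<subseteq> \<Omega> \<and> (\<forall>x\<in>C. \<forall>y\<in>C. x \<noteq> y \<longrightarrow> \<not> near x y) \<and>
    real (card \<Omega>) \<le> real (card C) * K"
proof -
  let ?I = "{C. C \<subseteq> \<Omega> \<and> (\<forall>x\<in>C. \<forall>y\<in>C. x \<noteq> y \<longrightarrow> \<not> near x y)}"
  have "finite ?I" "?I \<noteq> {}" using \<open>finite \<Omega>\<close> by auto
  from finite_has_maximal[OF this] obtain C
    where C: "C \<in> ?I" and max: "\<forall>D\<in>?I. C \<subseteq> D \<longrightarrow> C = D" ..
  have "\<Omega> \<subseteq> (\<Union>x\<in>C. {y \<in> \<Omega>. near x y})"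
  proof
    fix y assume y: "y \<in> \<Omega>"
    show "y \<in> (\<Union>x\<in>C. {y \<in> \<Omega>. near x y})"
    proof (rule ccontr)
      assume not_near: "y \<notin> (\<Union>x\<in>C. {y \<in> \<Omega>. near x y})"
      then have "\<not> near x y" if "x \<in> C" for x using that y by auto
      then have "insert y C \<in> ?I" using C y sym by auto
      from max[rule_format, OF this subset_insertI] have "C = insert y C" .
      then have "y \<in> C" by auto
      with not_near refl[OF y] y show False by blast
    qed
  qed
  moreover from C have fC: "finite C" using \<open>finite \<Omega>\<close> finite_subset by blast
  ultimately have "card \<Omega> \<le> card (\<Union>x\<in>C. {y \<in> \<Omega>. near x y})"
    using \<open>finite \<Omega>\<close> by (intro card_mono) auto
  also have "\<dots> \<le> (\<Sum>x\<in>C. card {y \<in> \<Omega>. near x y})"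
    using fC by (rule card_UN_le)
  finally have "card \<Omega> \<le> (\<Sum>x\<in>C. card {y \<in> \<Omega>. near x y})" .
  then have "real (card \<Omega>) \<le> (\<Sum>x\<in>C. real (card {y \<in> \<Omega>. near x y}))"
    by (simp flip: of_nat_sum)
  also have "\<dots> \<le> (\<Sum>x\<in>C. K)" using C K by (intro sum_mono) auto
  finally show ?thesis using C by auto
qed

text \<open>Chernoff bound: weight each word \<open>y\<close> by q to the number of its agreements
  with \<open>x\<close>. The total weight factorises over the positions, and each position
  contributes q + (q - 1) <= 2 q.\<close>

lemma card_agreeing_words:
  fixes \<theta> :: real
  assumes "finite Q" "x \<in> {..<B} \<rightarrow>\<^sub>E Q"
  shows "card {y \<in> {..<B} \<rightarrow>\<^sub>E Q. \<theta> * B < card {b \<in> {..<B}. x b = y b}} * card Q powr (\<theta> * B) \<le> (2 * real (card Q)) ^ B"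
proof -
  let ?q = "real (card Q)" and ?W = "{..<B} \<rightarrow>\<^sub>E Q"
  let ?near = "{y \<in> ?W. \<theta> * B < card {b \<in> {..<B}. x b = y b}}"
  have fin: "finite ?W" using assms by (intro finite_PiE) auto
  have "card ?near * ?q powr (\<theta> * B) = (\<Sum>y\<in>?near. ?q powr (\<theta> * B))" by simp
  also have "\<dots> \<le> (\<Sum>y\<in>?near. ?q ^ card {b \<in> {..<B}. x b = y b})"
  proof (intro sum_mono)
    fix y assume y: "y \<in> ?near"
    show "?q powr (\<theta> * B) \<le> ?q ^ card {b \<in> {..<B}. x b = y b}"
    proof (cases "card Q = 0")
      case False
      then have "?q powr (\<theta> * B) \<le> ?q powr (card {b \<in> {..<B}. x b = y b})"
        using y by (intro powr_mono) auto
      then show ?thesis using False by (simp add: powr_realpow)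
    qed simp
  qed
  also have "\<dots> \<le> (\<Sum>y\<in>?W. ?q ^ card {b \<in> {..<B}. x b = y b})"
    using fin by (intro sum_mono2) auto
  also have "\<dots> = (\<Sum>y\<in>?W. \<Prod>b<B. if x b = y b then ?q else 1)"
    by (intro sum.cong refl) (simp add: prod.If_cases Int_def)
  also have "\<dots> = (\<Prod>b<B. \<Sum>s\<in>Q. if x b = s then ?q else 1)"
    using assms by (subst prod_sum_PiE) auto
  also have "\<dots> \<le> (\<Prod>b<B. 2 * ?q)"
  proof (intro prod_mono conjI sum_nonneg)
    fix b assume "b \<in> {..<B}"
    have "(\<Sum>s\<in>Q. if x b = s then ?q else 1) \<le> (\<Sum>s\<in>Q. (if x b = s then ?q else 0) + 1)"
      by (intro sum_mono) auto
    also have "\<dots> \<le> 2 * ?q" using assms by (simp add: sum.distrib)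
    finally show "(\<Sum>s\<in>Q. if x b = s then ?q else 1) \<le> 2 * ?q" .
  qed auto
  finally show ?thesis by simp
qed

text \<open>The count is q^B divided by the ball bound (2 q)^B / q^(\<theta> B). The factor 2 lost
  per position is harmless once q powr \<theta> is well above 2.\<close>

lemma gilbert_varshamov:
  fixes \<theta> :: real
  assumes "finite Q" "Q \<noteq> {}" "\<theta> < 1" "0 < B"
  obtains C where "C \<subseteq> {..<B} \<rightarrow>\<^sub>E Q"
    "\<And>x y. x \<in> C \<Longrightarrow> y \<in> C \<Longrightarrow> x \<noteq> y \<Longrightarrow> card {b \<in> {..<B}. x b = y b} \<le> \<theta> * B"
    "(card Q powr \<theta> / 2) ^ B \<le> card C"
proof -
  let ?q = "real (card Q)" and ?W = "{..<B} \<rightarrow>\<^sub>E Q"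
  have q: "0 < ?q" using assms by (simp add: card_gt_0_iff)
  have fin: "finite ?W" using assms by (intro finite_PiE) auto
  let ?near = "\<lambda>x y :: nat \<Rightarrow> 'a. \<theta> * B < card {b \<in> {..<B}. x b = y b}"
  have refl: "?near x x" for x using assms by simp
  have sym: "?near y x" if "?near x y" for x y using that by (simp add: eq_commute)
  have K: "card {y \<in> ?W. ?near x y} \<le> (2 * ?q) ^ B / ?q powr (\<theta> * B)" if "x \<in> ?W" for x
    using card_agreeing_words[OF assms(1) that, of \<theta>] q by (simp add: pos_le_divide_eq)
  from greedy_independent_set[where near = ?near, OF fin refl sym K]
  obtain C where C: "C \<subseteq> ?W" "\<forall>x\<in>C. \<forall>y\<in>C. x \<noteq> y \<longrightarrow> \<not> ?near x y"
    "real (card ?W) \<le> real (card C) * ((2 * ?q) ^ B / ?q powr (\<theta> * B))"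
    by blast
  have "?q ^ B \<le> real (card C) * ((2 * ?q) ^ B / ?q powr (\<theta> * B))"
    using C(3) by (simp add: card_funcsetE)
  then have "?q powr (\<theta> * B) \<le> card C * 2 ^ B"
    using q by (simp add: field_simps power_mult_distrib)
  moreover have "?q powr (\<theta> * B) = (?q powr \<theta>) ^ B"
    using q by (simp add: powr_powr[symmetric] powr_realpow)
  ultimately have "(?q powr \<theta> / 2) ^ B \<le> card C" by (simp add: power_divide field_simps)
  then show ?thesis using C by (intro that[of C]) (auto simp: not_less)
qed

section \<open>Weyl coefficients and expansion\<close>

definition omega :: "nat \<Rightarrow> int \<Rightarrow> complex" where
  "omega N z = cis (2 * pi * of_int z / of_nat N)"

lemma omega_add: "omega N (a + b) = omega N a * omega N b"
  by (simp add: omega_def cis_mult add_divide_distrib distrib_left)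

lemma omega_0 [simp]: "omega N 0 = 1"
  by (simp add: omega_def)

lemma norm_omega [simp]: "cmod (omega N a) = 1"
  by (simp add: omega_def)

lemma cnj_omega: "cnj (omega N a) = omega N (- a)"
  by (simp add: omega_def cis_cnj)

lemma omega_multiple: "omega N (int N * b) = 1"
  using cis_multiple_2pi[of "of_int b"] by (cases "N = 0") (simp_all add: omega_def mult.assoc)

lemma omega_eq_1_iff:
  assumes "0 < N"
  shows "omega N m = 1 \<longleftrightarrow> int N dvd m"
proof
  assume "omega N m = 1"
  then have "cos (2 * pi * of_int m / of_nat N) = 1"
    by (simp add: omega_def complex_eq_iff)
  then obtain x :: int where "2 * pi * of_int m / of_nat N = of_int x * 2 * pi"
    using cos_one_2pi_int by blast
  then have "real_of_int m = real_of_int (x * int N)" using assms by (simp add: field_simps)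
  then show "int N dvd m" by (metis dvd_triv_right of_int_eq_iff)
qed (auto simp: omega_multiple)

lemma omega_cong: "a mod int N = b mod int N \<Longrightarrow> omega N a = omega N b"
proof -
  assume "a mod int N = b mod int N"
  then obtain c where "a = b + int N * c" by (metis mod_eqE)
  then show ?thesis by (simp add: omega_add omega_multiple)
qed

section \<open>Periodic functions and sums over residues\<close>

abbreviation residues :: "nat \<Rightarrow> int set" where
  "residues N \<equiv> {0..<int N}"

text \<open>Least absolute residues; for even \<open>N\<close> they contain -N/2 but not N/2. With
  them, cones and shears in the torus become plain integer inequalities.\<close>

definition centred :: "nat \<Rightarrow> int set" where
  "centred N = {x. - int N \<le> 2 * x \<and> 2 * x < int N}"

text \<open>Functions modulo \<open>N\<close> are kept as periodic functions on the integers, so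
  that index arithmetic such as i - u needs no reduction.\<close>

definition periodic :: "nat \<Rightarrow> (int \<Rightarrow> 'a) \<Rightarrow> bool" where
  "periodic N f \<longleftrightarrow> (\<forall>x y. x mod int N = y mod int N \<longrightarrow> f x = f y)"

lemma periodicD: "periodic N f \<Longrightarrow> x mod int N = y mod int N \<Longrightarrow> f x = f y"
  unfolding periodic_def by blast

lemma periodic_sum_reindex:
  fixes f :: "int \<Rightarrow> 'a::comm_monoid_add"
  assumes "periodic N f" "0 < N" "bij_betw (\<lambda>x. g x mod int N) A (residues N)"
  shows "(\<Sum>x\<in>A. f (g x)) = (\<Sum>x\<in>residues N. f x)"
proof -
  have "(\<Sum>x\<in>A. f (g x)) = (\<Sum>x\<in>A. f (g x mod int N))"
    by (intro sum.cong refl periodicD[OF assms(1)]) simp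
  also have "\<dots> = (\<Sum>x\<in>residues N. f x)"
    by (rule sum.reindex_bij_betw[OF assms(3)])
  finally show ?thesis .
qed

lemma bij_betw_mod_int:
  assumes "0 < N" "inj_on (\<lambda>x. g x mod int N) A" "finite A" "card A = N"
  shows "bij_betw (\<lambda>x. g x mod int N) A (residues N)"
  unfolding bij_betw_def
proof
  show "(\<lambda>x. g x mod int N) ` A = residues N"
    using assms by (intro card_subset_eq) (auto simp: card_image)
qed fact

lemma residues_eq_iff: "a \<in> residues N \<Longrightarrow> b \<in> residues N \<Longrightarrow> a mod int N = b mod int N \<longleftrightarrow> a = b"
  by (metis atLeastLessThan_iff mod_pos_pos_trivial)

lemma sum_residues_shift:
  fixes f :: "int \<Rightarrow> 'a::comm_monoid_add"
  assumes "periodic N f" "0 < N"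
  shows "(\<Sum>x\<in>residues N. f (x + a)) = (\<Sum>x\<in>residues N. f x)"
proof (intro periodic_sum_reindex[OF assms] bij_betw_mod_int)
  show "inj_on (\<lambda>x. (x + a) mod int N) (residues N)"
  proof (intro inj_onI)
    fix x y assume xy: "x \<in> residues N" "y \<in> residues N" "(x + a) mod int N = (y + a) mod int N"
    then have "int N dvd (x + a) - (y + a)" unfolding mod_eq_dvd_iff by simp
    then have "x mod int N = y mod int N" by (simp only: mod_eq_dvd_iff add_diff_cancel_right)
    with xy show "x = y" by (simp only: residues_eq_iff)
  qed
qed (use assms in auto)

lemma sum_residues_neg:
  fixes f :: "int \<Rightarrow> 'a::comm_monoid_add"
  assumes "periodic N f" "0 < N"
  shows "(\<Sum>x\<in>residues N. f (- x)) = (\<Sum>x\<in>residues N. f x)"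
proof (intro periodic_sum_reindex[OF assms] bij_betw_mod_int)
  show "inj_on (\<lambda>x. - x mod int N) (residues N)"
  proof (intro inj_onI)
    fix x y assume xy: "x \<in> residues N" "y \<in> residues N" "- x mod int N = - y mod int N"
    then have "int N dvd - (x - y)" unfolding mod_eq_dvd_iff by simp
    then have "x mod int N = y mod int N" unfolding dvd_minus_iff mod_eq_dvd_iff .
    with xy show "x = y" by (simp only: residues_eq_iff)
  qed
qed (use assms in auto)

lemma bij_betw_centred:
  assumes "0 < N"
  shows "bij_betw (\<lambda>x. x mod int N) (centred N) (residues N)"
proof (rule bij_betw_byWitness[where f' = "\<lambda>y. if 2 * y < int N then y else y - int N"])
  show "\<forall>x\<in>centred N. (if 2 * (x mod int N) < int N then x mod int N else x mod int N - int N) = x"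
  proof
    fix x assume x: "x \<in> centred N"
    show "(if 2 * (x mod int N) < int N then x mod int N else x mod int N - int N) = x"
    proof (cases "0 \<le> x")
      case True
      then show ?thesis using x by (simp add: centred_def)
    next
      case False
      have "x mod int N = (x + int N) mod int N" by simp
      also have "\<dots> = x + int N" using x False assms by (intro mod_pos_pos_trivial) (auto simp: centred_def)
      finally show ?thesis using x False by (auto simp: centred_def)
    qed
  qed
  have "(y - int N) mod int N = y" if "0 \<le> y" "y < int N" for y using that by simp
  then show "\<forall>y\<in>residues N. (if 2 * y < int N then y else y - int N) mod int N = y" by auto
qed (use assms in \<open>auto simp: centred_def\<close>)

lemma finite_centred: "0 < N \<Longrightarrow> finite (centred N)"
  using bij_betw_finite[OF bij_betw_centred] by simp

lemma sum_centred:
  fixes f :: "int \<Rightarrow> 'a::comm_monoid_add"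
  assumes "periodic N f" "0 < N"
  shows "(\<Sum>x\<in>centred N. f x) = (\<Sum>x\<in>residues N. f x)"
  using periodic_sum_reindex[OF assms bij_betw_centred] assms by simp

text \<open>A nontrivial character sums to zero: shifting \<open>k\<close> by 1 multiplies the sum
  by \<open>omega N m\<close>, which differs from 1.\<close>

lemma sum_omega:
  assumes "0 < N"
  shows "(\<Sum>k\<in>residues N. omega N (k * m)) = (if int N dvd m then of_nat N else 0)"
proof (cases "int N dvd m")
  case True
  then have "omega N (k * m) = 1" for k
    using omega_eq_1_iff[OF assms] by (simp add: dvd_mult)
  with True show ?thesis by simp
next
  case False
  have "periodic N (\<lambda>k. omega N (k * m))"
    unfolding periodic_def by (intro allI impI omega_cong mod_mult_cong refl)
  note shift = sum_residues_shift[OF this assms, of 1]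
  have "omega N ((k + 1) * m) = omega N m * omega N (k * m)" for k
    unfolding omega_add[symmetric] by (rule arg_cong[where f = "omega N"]) (simp add: algebra_simps)
  then have "omega N m * (\<Sum>k\<in>residues N. omega N (k * m)) = (\<Sum>k\<in>residues N. omega N (k * m))"
    using shift by (simp only: sum_distrib_left)
  moreover have "omega N m \<noteq> 1" using omega_eq_1_iff[OF assms] False by simp
  ultimately show ?thesis using False by (metis mult_cancel_right1)
qed

lemma parseval:
  assumes "0 < N"
  shows "(\<Sum>k\<in>residues N. (cmod (\<Sum>i\<in>residues N. g i * omega N (- k * i)))\<^sup>2)
    = N * (\<Sum>i\<in>residues N. (cmod (g i))\<^sup>2)"
proof -
  let ?R = "residues N" and ?w = "omega N"
  have "complex_of_real (\<Sum>k\<in>?R. (cmod (\<Sum>i\<in>?R. g i * ?w (- k * i)))\<^sup>2)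
    = (\<Sum>k\<in>?R. (\<Sum>i\<in>?R. g i * ?w (- k * i)) * (\<Sum>j\<in>?R. cnj (g j) * ?w (k * j)))"
    unfolding of_real_sum complex_norm_square by (simp add: cnj_omega)
  also have "\<dots> = (\<Sum>k\<in>?R. \<Sum>i\<in>?R. \<Sum>j\<in>?R. g i * cnj (g j) * ?w (k * (j - i)))"
    unfolding sum_product
  proof (intro sum.cong refl)
    fix k i j
    have "?w (- k * i) * ?w (k * j) = ?w (k * (j - i))"
      unfolding omega_add[symmetric] by (rule arg_cong[where f = ?w]) (simp add: algebra_simps)
    then show "g i * ?w (- k * i) * (cnj (g j) * ?w (k * j)) = g i * cnj (g j) * ?w (k * (j - i))"
      by (metis (no_types, lifting) mult.assoc mult.left_commute)
  qed
  also have "\<dots> = (\<Sum>i\<in>?R. \<Sum>k\<in>?R. \<Sum>j\<in>?R. g i * cnj (g j) * ?w (k * (j - i)))"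
    by (rule sum.swap)
  also have "\<dots> = (\<Sum>i\<in>?R. \<Sum>j\<in>?R. g i * cnj (g j) * (\<Sum>k\<in>?R. ?w (k * (j - i))))"
    unfolding sum_distrib_left by (rule sum.cong[OF refl], rule sum.swap)
  also have "\<dots> = (\<Sum>i\<in>?R. \<Sum>j\<in>?R. if j = i then of_nat N * (g i * cnj (g i)) else 0)"
  proof (intro sum.cong refl)
    fix i j assume "i \<in> ?R" "j \<in> ?R"
    then have "int N dvd (j - i) \<longleftrightarrow> j = i" by (metis mod_eq_dvd_iff residues_eq_iff)
    then show "g i * cnj (g j) * (\<Sum>k\<in>?R. ?w (k * (j - i)))
      = (if j = i then of_nat N * (g i * cnj (g i)) else 0)"
      unfolding sum_omega[OF assms] by simp
  qed
  also have "\<dots> = complex_of_real (N * (\<Sum>i\<in>?R. (cmod (g i))\<^sup>2))"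
    unfolding of_real_mult of_real_sum complex_norm_square by (simp add: sum_distrib_left)
  finally show ?thesis using of_real_eq_iff by blast
qed

text \<open>Coefficients in the clock-and-shift (Weyl-Heisenberg) basis: \<open>u\<close> selects
  the cyclic diagonal i - j = u, and \<open>k\<close> is the frequency along it. The factor 1 / sqrt
  N makes the transform unitary.\<close>

definition weyl :: "nat \<Rightarrow> (int \<Rightarrow> int \<Rightarrow> complex) \<Rightarrow> int \<Rightarrow> int \<Rightarrow> complex" where
  "weyl N x u k = (\<Sum>i\<in>residues N. x i (i - u) * omega N (- k * i)) / sqrt N"

definition biperiodic :: "nat \<Rightarrow> (int \<Rightarrow> int \<Rightarrow> 'a) \<Rightarrow> bool" where
  "biperiodic N x \<longleftrightarrow> (\<forall>i j i' j'. i mod int N = i' mod int N \<longrightarrow> j mod int N = j' mod int N \<longrightarrow> x i j = x i' j')"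

lemma biperiodicD:
  "biperiodic N x \<Longrightarrow> i mod int N = i' mod int N \<Longrightarrow> j mod int N = j' mod int N \<Longrightarrow> x i j = x i' j'"
  unfolding biperiodic_def by blast

lemma biperiodic_weyl:
  assumes x: "biperiodic N x"
  shows "biperiodic N (weyl N x)"
  unfolding biperiodic_def weyl_def
  by (intro allI impI arg_cong2[where f = "(/)"] refl sum.cong arg_cong2[where f = "(*)"] omega_cong
      biperiodicD[OF x] mod_diff_cong mod_mult_cong mod_minus_cong; assumption)

lemma weyl_diff: "weyl N (\<lambda>i j. x i j - y i j) u k = weyl N x u k - weyl N y u k"
  by (simp add: weyl_def left_diff_distrib sum_subtractf diff_divide_distrib)

text \<open>Parseval on each cyclic diagonal; the diagonals partition the entries.\<close>

lemma plancherel_residues: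
  assumes x: "biperiodic N x" and N: "0 < N"
  shows "(\<Sum>u\<in>residues N. \<Sum>k\<in>residues N. (cmod (weyl N x u k))\<^sup>2)
    = (\<Sum>i\<in>residues N. \<Sum>j\<in>residues N. (cmod (x i j))\<^sup>2)"
proof -
  let ?R = "residues N"
  have "(\<Sum>k\<in>?R. (cmod (weyl N x u k))\<^sup>2) = (\<Sum>i\<in>?R. (cmod (x i (i - u)))\<^sup>2)" for u
  proof -
    have "(\<Sum>k\<in>?R. (cmod (weyl N x u k))\<^sup>2)
      = (\<Sum>k\<in>?R. (cmod (\<Sum>i\<in>?R. x i (i - u) * omega N (- k * i)))\<^sup>2) / N"
      by (simp add: weyl_def norm_divide power_divide flip: sum_divide_distrib)
    then show ?thesis using N by (simp only: parseval[OF N]) simp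
  qed
  then have "(\<Sum>u\<in>?R. \<Sum>k\<in>?R. (cmod (weyl N x u k))\<^sup>2) = (\<Sum>i\<in>?R. \<Sum>u\<in>?R. (cmod (x i (i - u)))\<^sup>2)"
    by (simp only:) (rule sum.swap)
  also have "\<dots> = (\<Sum>i\<in>?R. \<Sum>j\<in>?R. (cmod (x i j))\<^sup>2)"
  proof (rule sum.cong[OF refl])
    fix i
    have "periodic N (\<lambda>j. (cmod (x i (i + j)))\<^sup>2)" "periodic N (\<lambda>j. (cmod (x i j))\<^sup>2)"
      unfolding periodic_def
      by (intro allI impI arg_cong2[where f = power] arg_cong[where f = cmod] refl biperiodicD[OF x] mod_add_cong; assumption)+
    from sum_residues_neg[OF this(1) N] sum_residues_shift[OF this(2) N, of i]
    show "(\<Sum>u\<in>?R. (cmod (x i (i - u)))\<^sup>2) = (\<Sum>j\<in>?R. (cmod (x i j))\<^sup>2)"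
      by (simp add: add.commute)
  qed
  finally show ?thesis .
qed

section \<open>Norms of Weyl coefficients on parts of the torus\<close>

definition l2 :: "(int \<Rightarrow> int \<Rightarrow> complex) \<Rightarrow> (int \<times> int) set \<Rightarrow> real" where
  "l2 f S = L2_set (\<lambda>(u, k). cmod (f u k)) S"

lemma l2_power2: "(l2 f S)\<^sup>2 = (\<Sum>(u, k)\<in>S. (cmod (f u k))\<^sup>2)"
  by (simp add: l2_def L2_set_def sum_nonneg case_prod_unfold)

lemma l2_nonneg [simp]: "0 \<le> l2 f S"
  by (simp add: l2_def)

lemma l2_eqI: "(\<Sum>(u, k)\<in>S. (cmod (f u k))\<^sup>2) = (\<Sum>(u, k)\<in>T. (cmod (g u k))\<^sup>2) \<Longrightarrow> l2 f S = l2 g T"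
  by (simp add: l2_def L2_set_def case_prod_unfold)

lemma plancherel:
  assumes x: "biperiodic N x" and N: "0 < N"
  shows "l2 (weyl N x) (centred N \<times> centred N) = l2 x (residues N \<times> residues N)"
proof (rule l2_eqI)
  note w = biperiodicD[OF biperiodic_weyl[OF x]]
  have "(\<Sum>(u, k)\<in>centred N \<times> centred N. (cmod (weyl N x u k))\<^sup>2)
    = (\<Sum>u\<in>centred N. \<Sum>k\<in>centred N. (cmod (weyl N x u k))\<^sup>2)"
    by (rule sum.cartesian_product[symmetric])
  also have "\<dots> = (\<Sum>u\<in>centred N. \<Sum>k\<in>residues N. (cmod (weyl N x u k))\<^sup>2)"
    by (intro sum.cong refl sum_centred N, unfold periodic_def,
        intro allI impI arg_cong2[where f = power] arg_cong[where f = cmod] refl w)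
  also have "\<dots> = (\<Sum>u\<in>residues N. \<Sum>k\<in>residues N. (cmod (weyl N x u k))\<^sup>2)"
    by (intro sum_centred N, unfold periodic_def,
        intro allI impI sum.cong arg_cong2[where f = power] arg_cong[where f = cmod] refl w)
  also have "\<dots> = (\<Sum>(i, j)\<in>residues N \<times> residues N. (cmod (x i j))\<^sup>2)"
    using plancherel_residues[OF x N] by (simp only: sum.cartesian_product)
  finally show "(\<Sum>(u, k)\<in>centred N \<times> centred N. (cmod (weyl N x u k))\<^sup>2)
    = (\<Sum>(i, j)\<in>residues N \<times> residues N. (cmod (x i j))\<^sup>2)" .
qed

lemma l2_mono:
  assumes "S \<subseteq> T" "finite T"
  shows "l2 f S \<le> l2 f T"
  unfolding l2_def L2_set_def using assms by (intro real_sqrt_le_mono sum_mono2) auto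

lemma l2_mono_fun:
  assumes "\<And>u k. (u, k) \<in> S \<Longrightarrow> cmod (f u k) \<le> cmod (g u k)"
  shows "l2 f S \<le> l2 g S"
  unfolding l2_def using assms by (intro L2_set_mono) auto

lemma l2_triangle: "l2 f S \<le> l2 g S + l2 (\<lambda>u k. f u k - g u k) S"
proof -
  have "l2 f S \<le> L2_set (\<lambda>p. (case p of (u, k) \<Rightarrow> cmod (g u k)) + (case p of (u, k) \<Rightarrow> cmod (f u k - g u k))) S"
    unfolding l2_def
  proof (intro L2_set_mono; clarsimp)
    fix u k
    show "cmod (f u k) \<le> cmod (g u k) + cmod (f u k - g u k)"
      using norm_triangle_ineq[of "g u k" "f u k - g u k"] by simp
  qed
  also have "\<dots> \<le> l2 g S + l2 (\<lambda>u k. f u k - g u k) S"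
    unfolding l2_def by (rule L2_set_triangle_ineq)
  finally show ?thesis .
qed

text \<open>Linearity and Plancherel carry almost-invariance of the matrix over to its coefficients
  on every part \<open>S\<close> of the torus.\<close>

lemma l2_weyl_close:
  assumes "biperiodic N x" "biperiodic N y" "0 < N" "S \<subseteq> centred N \<times> centred N"
    and close: "l2 (\<lambda>i j. y i j - x i j) (residues N \<times> residues N) \<le> \<eta>"
  shows "l2 (\<lambda>u k. weyl N y u k - weyl N x u k) S \<le> \<eta>"
    and "l2 (weyl N y) S \<le> l2 (weyl N x) S + \<eta>"
    and "l2 (weyl N x) S \<le> l2 (weyl N y) S + \<eta>"
proof -
  have bi: "biperiodic N (\<lambda>i j. y i j - x i j)"
    using assms(1,2) unfolding biperiodic_def by metis
  have "l2 (\<lambda>u k. weyl N y u k - weyl N x u k) S \<le> l2 (weyl N (\<lambda>i j. y i j - x i j)) (centred N \<times> centred N)"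
    unfolding weyl_diff using assms finite_centred by (intro l2_mono) auto
  also have "\<dots> \<le> \<eta>" using plancherel[OF bi] assms by simp
  finally show d: "l2 (\<lambda>u k. weyl N y u k - weyl N x u k) S \<le> \<eta>" .
  then show "l2 (weyl N y) S \<le> l2 (weyl N x) S + \<eta>"
    using l2_triangle[of "weyl N y" S "weyl N x"] by simp
  have "l2 (\<lambda>u k. weyl N y u k - weyl N x u k) S = l2 (\<lambda>u k. weyl N x u k - weyl N y u k) S"
    by (intro l2_eqI) (simp add: norm_minus_commute)
  then show "l2 (weyl N x) S \<le> l2 (weyl N y) S + \<eta>"
    using d l2_triangle[of "weyl N x" S "weyl N y"] by simp
qed

text \<open>The factor omega N (i - j) comes from conjugation by the clock matrix; it is constant on
  the diagonal i - j = u.\<close>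

lemma weyl_clock:
  "weyl N (\<lambda>i j. omega N (i - j) * x i j) u k = omega N u * weyl N x u k"
  by (simp add: weyl_def sum_distrib_left mult_ac)

text \<open>Conjugation by the quadratic phase: i^2 - (i - u)^2 = 2 u i - u^2 is linear in
  \<open>i\<close> along a diagonal, hence shifts the frequency by 2 u.\<close>

lemma weyl_quadratic:
  "weyl N (\<lambda>i j. omega N (i * i - j * j) * x i j) u k = omega N (- u * u) * weyl N x u (k - 2 * u)"
proof -
  have "omega N (i * i - (i - u) * (i - u)) * x i (i - u) * omega N (- k * i)
    = omega N (- u * u) * (x i (i - u) * omega N (- (k - 2 * u) * i))" for i
  proof -
    have "omega N (i * i - (i - u) * (i - u)) * omega N (- k * i)
      = omega N (- u * u) * omega N (- (k - 2 * u) * i)"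
      unfolding omega_add[symmetric] by (rule arg_cong[where f = "omega N"]) (simp add: algebra_simps)
    then show ?thesis by (simp add: mult_ac)
  qed
  then show ?thesis by (simp only: weyl_def sum_distrib_left times_divide_eq_right)
qed

text \<open>Conjugation by the unitary Fourier matrix, written in entries; see
  \<open>conj_by_fourier_index\<close>.\<close>

definition fourier_conj :: "nat \<Rightarrow> (int \<Rightarrow> int \<Rightarrow> complex) \<Rightarrow> int \<Rightarrow> int \<Rightarrow> complex" where
  "fourier_conj N x i j = (\<Sum>a\<in>residues N. \<Sum>b\<in>residues N. omega N (i * a - j * b) * x a b) / of_nat N"

lemma biperiodic_fourier_conj: "biperiodic N (fourier_conj N x)"
  unfolding biperiodic_def fourier_conj_def
  by (intro allI impI arg_cong2[where f = "(/)"] refl sum.cong arg_cong2[where f = "(*)"] omega_cong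
      mod_diff_cong mod_mult_cong; assumption)

text \<open>Up to a phase, conjugation by the Fourier matrix is a quarter turn of the torus: summing
  over \<open>i\<close> first leaves only a = b + k, by orthogonality of characters.\<close>

lemma weyl_fourier:
  assumes x: "biperiodic N x" and N: "0 < N"
  shows "weyl N (fourier_conj N x) u k = omega N (- u * k) * weyl N x k (- u)"
proof -
  let ?R = "residues N" and ?w = "omega N"
  have N0: "complex_of_nat N \<noteq> 0" using N by simp
  have inner: "(\<Sum>a\<in>?R. (\<Sum>i\<in>?R. ?w (i * (a - b - k))) * (?w (u * b) * x a b)) = of_nat N * (?w (u * b) * x (b + k) b)"
    if "b \<in> ?R" for b
  proof -
    have "(\<Sum>a\<in>?R. (\<Sum>i\<in>?R. ?w (i * (a - b - k))) * (?w (u * b) * x a b))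
      = (\<Sum>a\<in>?R. if a = (b + k) mod int N then of_nat N * (?w (u * b) * x (b + k) b) else 0)"
    proof (intro sum.cong refl)
      fix a assume "a \<in> ?R"
      then have "int N dvd (a - b - k) \<longleftrightarrow> a = (b + k) mod int N"
        by (metis (no_types, lifting) atLeastLessThan_iff diff_diff_add mod_eq_dvd_iff mod_pos_pos_trivial)
      moreover have "x ((b + k) mod int N) b = x (b + k) b"
        by (intro biperiodicD[OF x]) simp_all
      ultimately show "(\<Sum>i\<in>?R. ?w (i * (a - b - k))) * (?w (u * b) * x a b)
        = (if a = (b + k) mod int N then of_nat N * (?w (u * b) * x (b + k) b) else 0)"
        unfolding sum_omega[OF N] by auto
    qed
    also have "\<dots> = of_nat N * (?w (u * b) * x (b + k) b)" using N by simp
    finally show ?thesis .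
  qed
  have "(\<Sum>i\<in>?R. (\<Sum>a\<in>?R. \<Sum>b\<in>?R. ?w (i * a - (i - u) * b) * x a b) * ?w (- k * i))
    = (\<Sum>i\<in>?R. \<Sum>a\<in>?R. \<Sum>b\<in>?R. ?w (i * (a - b - k)) * (?w (u * b) * x a b))"
  proof (unfold sum_distrib_right, intro sum.cong refl)
    fix i a b
    have "?w (i * a - (i - u) * b) * ?w (- k * i) = ?w (i * (a - b - k)) * ?w (u * b)"
      unfolding omega_add[symmetric] by (rule arg_cong[where f = ?w]) (simp add: algebra_simps)
    then show "?w (i * a - (i - u) * b) * x a b * ?w (- k * i) = ?w (i * (a - b - k)) * (?w (u * b) * x a b)"
      by (simp add: mult_ac)
  qed
  also have "\<dots> = (\<Sum>b\<in>?R. \<Sum>a\<in>?R. \<Sum>i\<in>?R. ?w (i * (a - b - k)) * (?w (u * b) * x a b))"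
  proof -
    have "(\<Sum>i\<in>?R. \<Sum>a\<in>?R. \<Sum>b\<in>?R. h i a b) = (\<Sum>b\<in>?R. \<Sum>a\<in>?R. \<Sum>i\<in>?R. h i a b)"
      for h :: "int \<Rightarrow> int \<Rightarrow> int \<Rightarrow> complex"
    proof -
      have "(\<Sum>i\<in>?R. \<Sum>a\<in>?R. \<Sum>b\<in>?R. h i a b) = (\<Sum>i\<in>?R. \<Sum>b\<in>?R. \<Sum>a\<in>?R. h i a b)"
        by (rule sum.cong[OF refl], rule sum.swap)
      also have "\<dots> = (\<Sum>b\<in>?R. \<Sum>i\<in>?R. \<Sum>a\<in>?R. h i a b)" by (rule sum.swap)
      also have "\<dots> = (\<Sum>b\<in>?R. \<Sum>a\<in>?R. \<Sum>i\<in>?R. h i a b)"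
        by (rule sum.cong[OF refl], rule sum.swap)
      finally show ?thesis .
    qed
    then show ?thesis .
  qed
  also have "\<dots> = (\<Sum>b\<in>?R. of_nat N * (?w (u * b) * x (b + k) b))"
    by (intro sum.cong refl) (simp only: sum_distrib_right[symmetric] inner)
  also have "\<dots> = of_nat N * (\<Sum>b\<in>?R. ?w (u * b) * x (b + k) b)"
    by (rule sum_distrib_left[symmetric])
  also have "(\<Sum>b\<in>?R. ?w (u * b) * x (b + k) b) = (\<Sum>i\<in>?R. ?w (u * (i - k)) * x i (i - k))"
  proof -
    have "periodic N (\<lambda>i. ?w (u * (i - k)) * x i (i - k))"
      unfolding periodic_def
      by (intro allI impI arg_cong2[where f = "(*)"] omega_cong biperiodicD[OF x] mod_mult_cong mod_diff_cong refl; assumption)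
    from sum_residues_shift[OF this N, of k] show ?thesis by simp
  qed
  also have "\<dots> = ?w (- u * k) * (\<Sum>i\<in>?R. x i (i - k) * ?w (- (- u) * i))"
    unfolding sum_distrib_left
  proof (intro sum.cong refl)
    fix i
    have "?w (u * (i - k)) = ?w (- u * k) * ?w (- (- u) * i)"
      unfolding omega_add[symmetric] by (rule arg_cong[where f = ?w]) (simp add: algebra_simps)
    then show "?w (u * (i - k)) * x i (i - k) = ?w (- u * k) * (x i (i - k) * ?w (- (- u) * i))"
      by (simp add: mult_ac)
  qed
  finally have main: "(\<Sum>i\<in>?R. (\<Sum>a\<in>?R. \<Sum>b\<in>?R. ?w (i * a - (i - u) * b) * x a b) * ?w (- k * i))
    = of_nat N * (?w (- u * k) * (\<Sum>i\<in>?R. x i (i - k) * ?w (- (- u) * i)))" .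
  have "weyl N (fourier_conj N x) u k
    = (\<Sum>i\<in>?R. (\<Sum>a\<in>?R. \<Sum>b\<in>?R. ?w (i * a - (i - u) * b) * x a b) * ?w (- k * i)) / of_nat N / sqrt N"
    by (simp add: weyl_def fourier_conj_def flip: sum_divide_distrib)
  then show ?thesis unfolding main using N0 by (simp add: weyl_def)
qed

text \<open>Distance to 0 in the cyclic group. It is |u| on \<open>centred N\<close>, but it depends
  only on the residue class and so respects negation even at -N/2, whose negative leaves
  \<open>centred N\<close>.\<close>

definition circular_abs :: "nat \<Rightarrow> int \<Rightarrow> int" where
  "circular_abs N u = min (u mod int N) ((- u) mod int N)"

lemma circular_abs_minus [simp]: "circular_abs N (- u) = circular_abs N u"
  by (simp add: circular_abs_def min.commute)

lemma circular_abs_cong: "u mod int N = v mod int N \<Longrightarrow> circular_abs N u = circular_abs N v"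
  unfolding circular_abs_def by (metis mod_minus_cong)

lemma circular_abs_centred:
  assumes "0 < N" "u \<in> centred N"
  shows "circular_abs N u = \<bar>u\<bar>"
proof -
  have pos: "circular_abs N v = v" if "0 < v" "2 * v \<le> int N" for v
  proof -
    have "- v mod int N = (- v + int N) mod int N" by simp
    also have "\<dots> = int N - v" using that by (subst mod_pos_pos_trivial) auto
    finally show ?thesis using that by (simp add: circular_abs_def)
  qed
  consider "u = 0" | "0 < u" | "u < 0" by linarith
  then show ?thesis
  proof cases
    case 1
    then show ?thesis by (simp add: circular_abs_def)
  next
    case 2
    then show ?thesis using pos[of u] assms by (simp add: centred_def)
  next
    case 3
    then show ?thesis using pos[of "- u"] assms by (simp add: centred_def)
  qed
qed

text \<open>The turn exchanges the two cones. Negation need not preserve \<open>centred N\<close>,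
  so the sum over \<open>u\<close> is moved to \<open>residues N\<close>, where
  \<open>sum_residues_neg\<close> applies.\<close>

lemma l2_rotation:
  assumes f: "biperiodic N f" and N: "0 < N"
  shows "l2 (\<lambda>u k. f k (- u)) {(u, k) \<in> centred N \<times> centred N. circular_abs N u \<le> circular_abs N k}
    = l2 f {(u, k) \<in> centred N \<times> centred N. circular_abs N k \<le> circular_abs N u}"
proof (rule l2_eqI)
  let ?I = "centred N" and ?c = "circular_abs N"
  define F where "F u k = (if ?c u \<le> ?c k then (cmod (f k u))\<^sup>2 else 0)" for u k
  have fin: "finite (?I \<times> ?I)" using finite_centred[OF N] by simp
  have F: "F u k = F u' k" if "u mod int N = u' mod int N" for u u' k
    unfolding F_def using circular_abs_cong[OF that] biperiodicD[OF f refl that] by simp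
  have per: "periodic N (\<lambda>u. \<Sum>k\<in>?I. F u k)" "periodic N (\<lambda>u. \<Sum>k\<in>?I. F (- u) k)"
    unfolding periodic_def by (intro allI impI sum.cong refl F mod_minus_cong; assumption)+
  have "(\<Sum>(u, k)\<in>{(u, k) \<in> ?I \<times> ?I. ?c u \<le> ?c k}. (cmod (f k (- u)))\<^sup>2)
    = (\<Sum>(u, k)\<in>?I \<times> ?I. F (- u) k)"
    using fin by (intro sum.mono_neutral_cong_left) (auto simp: F_def split: if_splits)
  also have "\<dots> = (\<Sum>u\<in>?I. \<Sum>k\<in>?I. F (- u) k)" by (rule sum.cartesian_product[symmetric])
  also have "\<dots> = (\<Sum>u\<in>?I. \<Sum>k\<in>?I. F u k)"
    by (simp only: sum_centred[OF per(1) N] sum_centred[OF per(2) N] sum_residues_neg[OF per(1) N])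
  also have "\<dots> = (\<Sum>k\<in>?I. \<Sum>u\<in>?I. F u k)" by (rule sum.swap)
  also have "\<dots> = (\<Sum>(k, u)\<in>?I \<times> ?I. F u k)" by (rule sum.cartesian_product)
  also have "\<dots> = (\<Sum>(k, u)\<in>{(k, u) \<in> ?I \<times> ?I. ?c u \<le> ?c k}. (cmod (f k u))\<^sup>2)"
    using fin by (intro sum.mono_neutral_cong_right) (auto simp: F_def split: if_splits)
  finally show "(\<Sum>(u, k)\<in>{(u, k) \<in> ?I \<times> ?I. ?c u \<le> ?c k}. (cmod (f k (- u)))\<^sup>2)
    = (\<Sum>(u, k)\<in>{(u, k) \<in> ?I \<times> ?I. ?c k \<le> ?c u}. (cmod (f u k))\<^sup>2)" .
qed

text \<open>The angle 2 pi |u| / N lies between pi / 3 and pi, where the chord has length at least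
  1. This fixes the cut-off N / 6.\<close>

lemma norm_omega_minus_1:
  assumes "0 < N" "u \<in> centred N" "int N \<le> 6 * \<bar>u\<bar>"
  shows "1 \<le> cmod (omega N u - 1)"
proof -
  define t where "t = 2 * pi * of_int \<bar>u\<bar> / of_nat N"
  have u: "real N \<le> 6 * of_int \<bar>u\<bar>" "2 * of_int \<bar>u\<bar> \<le> real N"
  proof -
    have "int N \<le> 6 * \<bar>u\<bar>" "2 * \<bar>u\<bar> \<le> int N" using assms(2,3) by (auto simp: centred_def)
    then have "real_of_int (int N) \<le> real_of_int (6 * \<bar>u\<bar>)" "real_of_int (2 * \<bar>u\<bar>) \<le> real_of_int (int N)"
      by (simp_all only: of_int_le_iff)
    then show "real N \<le> 6 * of_int \<bar>u\<bar>" "2 * of_int \<bar>u\<bar> \<le> real N" by simp_all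
  qed
  have "pi / 3 \<le> t" "t \<le> pi" using u \<open>0 < N\<close> by (auto simp: t_def field_simps)
  then have "cos t \<le> cos (pi / 3)" by (intro cos_monotone_0_pi_le) auto
  then have "cos t \<le> 1 / 2" by (simp add: cos_60)
  moreover have "cos (2 * pi * of_int u / of_nat N) = cos t"
  proof -
    have "t = \<bar>2 * pi * of_int u / of_nat N\<bar>" by (simp add: t_def abs_mult)
    then show ?thesis by (simp only: cos_abs_real)
  qed
  ultimately have "1 \<le> 2 - 2 * cos (2 * pi * of_int u / of_nat N)" by simp
  also have "\<dots> = (cmod (omega N u - 1))\<^sup>2"
    using sin_cos_squared_add3[of "2 * pi * of_int u / of_nat N"]
    unfolding omega_def cmod_power2 by (simp add: power2_eq_square algebra_simps)
  finally have "1\<^sup>2 \<le> (cmod (omega N u - 1))\<^sup>2" by simp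
  then show ?thesis by (rule power2_le_imp_le) simp
qed

text \<open>Squaring costs 33 e^2 per step, and together p^2 <= 100 e^2, a^2 <= 101 e^2, b^2 <= 134
  e^2. Hence h^2 <= 235 e^2, while h = 16 e means h^2 = 256 e^2; this is the source of the 16 in the
  expander.\<close>

lemma ping_pong_estimate:
  fixes h a b p s t e :: real
  assumes nonneg: "0 \<le> h" "0 \<le> a" "0 \<le> b" "0 \<le> p" "0 \<le> s" "0 \<le> t"
    and le: "a \<le> h" "p \<le> h" "s \<le> h" "t \<le> h"
    and e: "16 * e = h"
    and "a\<^sup>2 \<le> p\<^sup>2 + e\<^sup>2" "p \<le> s + e" "p \<le> t + e" "s\<^sup>2 + t\<^sup>2 \<le> b\<^sup>2" "b \<le> a + e" "h\<^sup>2 \<le> a\<^sup>2 + b\<^sup>2"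
  shows "h = 0"
proof -
  have e0: "0 \<le> e" using e nonneg by simp
  have sq: "x\<^sup>2 \<le> y\<^sup>2 + 33 * e\<^sup>2" if "x \<le> y + e" "0 \<le> x" "y \<le> h" for x y
  proof -
    have "x\<^sup>2 \<le> (y + e)\<^sup>2" using that by (intro power_mono) auto
    also have "\<dots> = y\<^sup>2 + 2 * (y * e) + e\<^sup>2" by (simp add: power2_eq_square algebra_simps)
    also have "y * e \<le> 16 * e * e" using that e e0 by (intro mult_right_mono) auto
    finally show ?thesis by (simp add: power2_eq_square)
  qed
  have "p\<^sup>2 \<le> s\<^sup>2 + 33 * e\<^sup>2" "p\<^sup>2 \<le> t\<^sup>2 + 33 * e\<^sup>2" "b\<^sup>2 \<le> a\<^sup>2 + 33 * e\<^sup>2"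
    using assms by (intro sq; simp)+
  moreover have "h\<^sup>2 = 256 * e\<^sup>2" using e by (auto simp: power2_eq_square)
  ultimately have "e\<^sup>2 \<le> 0" using assms by linarith
  then show ?thesis using e by simp
qed

text \<open>
  Gabber-Galil type argument: the squared moduli of the Weyl coefficients of an almost central
  matrix form a measure on the discrete torus that lives near the origin and is almost invariant
  under a quarter turn and a shear by 2.  The two shears of the cone \<open>\<bar>k\<bar> \<le> \<bar>u\<bar>\<close> are disjoint and
  lie in the complementary cone, so there is no such measure off the origin.
\<close>

lemma weyl_expander:
  assumes x: "biperiodic N x" and N: "0 < N"
    and trace: "(\<Sum>i\<in>residues N. x i i) = 0"
    and h: "l2 x (residues N \<times> residues N) = h" and e: "16 * e = h"
    and clock: "l2 (\<lambda>i j. omega N (i - j) * x i j - x i j) (residues N \<times> residues N) \<le> e"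
    and quadratic: "l2 (\<lambda>i j. omega N (i * i - j * j) * x i j - x i j) (residues N \<times> residues N) \<le> e"
    and fourier: "l2 (\<lambda>i j. fourier_conj N x i j - x i j) (residues N \<times> residues N) \<le> e"
  shows "h = 0"
proof -
  let ?I = "centred N" and ?c = "circular_abs N" and ?f = "weyl N x"
  let ?z = "weyl N (\<lambda>i j. omega N (i - j) * x i j)"
  have fin: "finite (?I \<times> ?I)" using finite_centred[OF N] by simp
  define P where "P = {(u, k) \<in> ?I \<times> ?I. ?c k \<le> ?c u}"
  define Q where "Q = {(u, k) \<in> ?I \<times> ?I. ?c u \<le> ?c k}"
  \<comment> \<open>Below N / 6 the shears k - 2 u and k + 2 u stay inside \<open>centred N\<close>
    without wrapping, since |k| <= |u| bounds them by 3 |u| < N / 2. The origin, which the shears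
    fix, is left out.\<close>
  define B where "B = {(u, k) \<in> ?I \<times> ?I. \<bar>k\<bar> \<le> \<bar>u\<bar> \<and> 6 * \<bar>u\<bar> < int N \<and> u \<noteq> 0}"
  define S where "S = (\<lambda>(u, k). (u, k - 2 * u)) ` B"
  define T where "T = (\<lambda>(u, k). (u, k + 2 * u)) ` B"
  have c: "?c u = \<bar>u\<bar>" if "u \<in> ?I" for u using circular_abs_centred[OF N that] .
  have B: "u \<in> ?I" "k \<in> ?I" "\<bar>k\<bar> \<le> \<bar>u\<bar>" "6 * \<bar>u\<bar> < int N" "u \<noteq> 0" if "(u, k) \<in> B" for u k
    using that by (auto simp: B_def)
  have shear: "k - 2 * u \<in> ?I" "k + 2 * u \<in> ?I" "\<bar>u\<bar> \<le> \<bar>k - 2 * u\<bar>" "\<bar>u\<bar> \<le> \<bar>k + 2 * u\<bar>"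
    if "(u, k) \<in> B" for u k
    using B[OF that] by (auto simp: centred_def)
  have ST: "S \<subseteq> Q" "T \<subseteq> Q" using B(1) shear by (auto simp: S_def T_def Q_def c)
  \<comment> \<open>As |k| <= |u| and u \<noteq> 0, the second coordinate has the sign of -u on
    \<open>S\<close> and that of u on \<open>T\<close>.\<close>
  have disj: "S \<inter> T = {}"
  proof -
    have False if "p \<in> S" "p \<in> T" for p
    proof -
      from that obtain u k u' k' where "(u, k) \<in> B" "p = (u, k - 2 * u)" "(u', k') \<in> B" "p = (u', k' + 2 * u')"
        unfolding S_def T_def by auto
      then show False using B[of u k] B[of u' k'] by auto
    qed
    then show ?thesis by blast
  qed
  have sub: "P \<subseteq> ?I \<times> ?I" "Q \<subseteq> ?I \<times> ?I" "B \<subseteq> ?I \<times> ?I" by (auto simp: P_def Q_def B_def)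
  have total: "l2 ?f (?I \<times> ?I) = h" using plancherel[OF x N] h by simp
  have le_h: "l2 ?f A \<le> h" if "A \<subseteq> ?I \<times> ?I" for A using l2_mono[OF that fin] total by metis
  \<comment> \<open>The trace condition removes the mass at the origin, the only point that could
    carry an invariant measure.\<close>
  have f00: "?f 0 0 = 0" using trace by (simp add: weyl_def)
  have bi: "biperiodic N (\<lambda>i j. omega N (g i - g j) * x i j)"
    if "\<And>i j. i mod int N = j mod int N \<Longrightarrow> g i mod int N = g j mod int N" for g
    unfolding biperiodic_def
    by (intro allI impI arg_cong2[where f = "(*)"] omega_cong biperiodicD[OF x] mod_diff_cong that; assumption)
  note close_clock = l2_weyl_close[OF x bi[of "\<lambda>i. i"] N _ clock]
  note close_quadratic = l2_weyl_close[OF x bi[of "\<lambda>i. i * i"] N _ quadratic]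
  note close_fourier = l2_weyl_close[OF x biperiodic_fourier_conj N _ fourier]
  have sq_quadratic: "l2 (weyl N (\<lambda>i j. omega N (i * i - j * j) * x i j)) A = l2 (\<lambda>u k. ?f u (k - 2 * u)) A" for A
    by (intro l2_eqI) (simp add: weyl_quadratic norm_mult)
  \<comment> \<open>In this region the clock moves every coefficient by at least its own modulus, so
    almost-invariance bounds the norm there by e.\<close>
  have outer: "l2 ?f {(u, k) \<in> ?I \<times> ?I. int N \<le> 6 * \<bar>u\<bar>} \<le> e"
  proof -
    let ?A = "{(u, k) \<in> ?I \<times> ?I. int N \<le> 6 * \<bar>u\<bar>}"
    have "l2 ?f ?A \<le> l2 (\<lambda>u k. ?z u k - ?f u k) ?A"
    proof (rule l2_mono_fun)
      fix u k assume "(u, k) \<in> ?A"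
      then have "1 \<le> cmod (omega N u - 1)" using norm_omega_minus_1[OF N] by auto
      then have "1 * cmod (?f u k) \<le> cmod (omega N u - 1) * cmod (?f u k)" by (intro mult_right_mono) auto
      also have "\<dots> = cmod (?z u k - ?f u k)"
        unfolding weyl_clock by (simp add: norm_mult[symmetric] algebra_simps)
      finally show "cmod (?f u k) \<le> cmod (?z u k - ?f u k)" by simp
    qed
    also have "\<dots> \<le> e" by (rule close_clock(1)) auto
    finally show ?thesis .
  qed
  have finP: "finite P" "finite Q" "finite B" using sub fin finite_subset by blast+
  show ?thesis
  proof (rule ping_pong_estimate[where a = "l2 ?f P" and b = "l2 ?f Q" and p = "l2 ?f B"
        and s = "l2 ?f S" and t = "l2 ?f T" and e = e])
    show "0 \<le> h" using total l2_nonneg by metis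
    show "l2 ?f P \<le> h" "l2 ?f B \<le> h" "l2 ?f S \<le> h" "l2 ?f T \<le> h"
      using le_h[OF sub(1)] le_h[OF sub(3)] le_h[OF order_trans[OF ST(1) sub(2)]]
        le_h[OF order_trans[OF ST(2) sub(2)]] by auto
    show "(l2 ?f P)\<^sup>2 \<le> (l2 ?f B)\<^sup>2 + e\<^sup>2"
    proof -
      let ?A = "{(u, k) \<in> ?I \<times> ?I. int N \<le> 6 * \<bar>u\<bar>}"
      have "(l2 ?f P)\<^sup>2 = (\<Sum>(u, k)\<in>P - {(0, 0)}. (cmod (?f u k))\<^sup>2)"
        unfolding l2_power2 using finP f00 by (intro sum.mono_neutral_right) auto
      also have "\<dots> \<le> (\<Sum>(u, k)\<in>B \<union> ?A. (cmod (?f u k))\<^sup>2)"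
      proof (rule sum_mono2)
        show "finite (B \<union> ?A)" using fin finP by (auto intro: finite_subset[OF _ fin])
        show "P - {(0, 0)} \<subseteq> B \<union> ?A" using c by (auto simp: P_def B_def)
      qed auto
      also have "\<dots> \<le> (\<Sum>(u, k)\<in>B. (cmod (?f u k))\<^sup>2) + (\<Sum>(u, k)\<in>?A. (cmod (?f u k))\<^sup>2)"
      proof -
        have "finite ?A" by (rule finite_subset[OF _ fin]) auto
        then have "(\<Sum>(u, k)\<in>B \<union> ?A. (cmod (?f u k))\<^sup>2) + (\<Sum>(u, k)\<in>B \<inter> ?A. (cmod (?f u k))\<^sup>2)
          = (\<Sum>(u, k)\<in>B. (cmod (?f u k))\<^sup>2) + (\<Sum>(u, k)\<in>?A. (cmod (?f u k))\<^sup>2)"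
          using finP by (intro sum.union_inter) auto
        moreover have "0 \<le> (\<Sum>(u, k)\<in>B \<inter> ?A. (cmod (?f u k))\<^sup>2)" by (intro sum_nonneg) auto
        ultimately show ?thesis by linarith
      qed
      also have "\<dots> \<le> (l2 ?f B)\<^sup>2 + e\<^sup>2"
        unfolding l2_power2[symmetric] using outer by (intro add_left_mono power_mono) auto
      finally show ?thesis .
    qed
    show "l2 ?f B \<le> l2 ?f S + e"
    proof -
      have "l2 ?f B \<le> l2 (\<lambda>u k. ?f u (k - 2 * u)) B + e"
        using close_quadratic(3)[OF mod_mult_cong sub(3)] by (simp add: sq_quadratic)
      also have "l2 (\<lambda>u k. ?f u (k - 2 * u)) B = l2 ?f S"
        unfolding S_def by (rule l2_eqI, subst sum.reindex) (auto simp: inj_on_def intro!: sum.cong)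
      finally show ?thesis .
    qed
    show "l2 ?f B \<le> l2 ?f T + e"
    proof -
      \<comment> \<open>The same shear relation, now read from \<open>T\<close> back to
        \<open>B\<close>, supplies the shear in the other direction.\<close>
      have "l2 ?f B = l2 (\<lambda>u k. ?f u (k - 2 * u)) T"
        unfolding T_def by (rule l2_eqI, subst sum.reindex) (auto simp: inj_on_def intro!: sum.cong)
      also have "\<dots> \<le> l2 ?f T + e"
        using close_quadratic(2)[OF mod_mult_cong order_trans[OF ST(2) sub(2)]] by (simp add: sq_quadratic)
      finally show ?thesis .
    qed
    show "(l2 ?f S)\<^sup>2 + (l2 ?f T)\<^sup>2 \<le> (l2 ?f Q)\<^sup>2"
    proof -
      have "finite S" "finite T" using ST finP finite_subset by blast+
      then have "(l2 ?f S)\<^sup>2 + (l2 ?f T)\<^sup>2 = (\<Sum>(u, k)\<in>S \<union> T. (cmod (?f u k))\<^sup>2)"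
        unfolding l2_power2 using disj by (intro sum.union_disjoint[symmetric])
      also have "\<dots> \<le> (l2 ?f Q)\<^sup>2"
        unfolding l2_power2 using ST finP by (intro sum_mono2) auto
      finally show ?thesis .
    qed
    show "l2 ?f Q \<le> l2 ?f P + e"
    proof -
      have "l2 (weyl N (fourier_conj N x)) Q = l2 (\<lambda>u k. ?f k (- u)) Q"
        by (intro l2_eqI) (simp add: weyl_fourier[OF x N] norm_mult)
      also have "\<dots> = l2 ?f P"
        unfolding P_def Q_def by (rule l2_rotation[OF biperiodic_weyl[OF x] N])
      finally show ?thesis using close_fourier(3)[OF sub(2)] by simp
    qed
    show "h\<^sup>2 \<le> (l2 ?f P)\<^sup>2 + (l2 ?f Q)\<^sup>2"
    proof -
      have "h\<^sup>2 = (\<Sum>(u, k)\<in>P \<union> Q. (cmod (?f u k))\<^sup>2)"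
        unfolding total[symmetric] l2_power2 by (intro sum.cong) (auto simp: P_def Q_def)
      also have "\<dots> \<le> \<dots> + (\<Sum>(u, k)\<in>P \<inter> Q. (cmod (?f u k))\<^sup>2)"
        by (simp add: sum_nonneg case_prod_unfold)
      also have "\<dots> = (l2 ?f P)\<^sup>2 + (l2 ?f Q)\<^sup>2"
        unfolding l2_power2 using finP by (intro sum.union_inter)
      finally show ?thesis .
    qed
  qed (use e in auto)
qed

section \<open>Hilbert-Schmidt norm and unitary matrices\<close>

lemma sum_div_mod:
  fixes g :: "nat \<Rightarrow> nat \<Rightarrow> 'a::comm_monoid_add"
  shows "(\<Sum>i<m * n. g (i div n) (i mod n)) = (\<Sum>a<m. \<Sum>b<n. g a b)"
proof -
  have less: "a * n + b < m * n" if "a < m" "b < n" for a b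
  proof -
    have "a * n + b < Suc a * n" using that by simp
    also have "\<dots> \<le> m * n" using that by (intro mult_right_mono) auto
    finally show ?thesis .
  qed
  have mod: "i mod n < n" if "i < m * n" for i using that by (cases "n = 0") auto
  have "(\<Sum>i<m * n. g (i div n) (i mod n)) = (\<Sum>(a, b)\<in>{..<m} \<times> {..<n}. g a b)"
    by (rule sum.reindex_bij_witness[where i = "\<lambda>(a, b). a * n + b" and j = "\<lambda>i. (i div n, i mod n)"])
      (auto simp: less less_mult_imp_div_less mod)
  then show ?thesis by (simp add: sum.cartesian_product)
qed

lemma mult_carrier_square [simp]:
  "A \<in> carrier_mat n n \<Longrightarrow> B \<in> carrier_mat n n \<Longrightarrow> A * B \<in> carrier_mat n n"
  by (rule mult_carrier_mat)

lemma mult_one_square [simp]: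
  fixes A :: "'a::semiring_1 mat"
  shows "A \<in> carrier_mat n n \<Longrightarrow> 1\<^sub>m n * A = A" "A \<in> carrier_mat n n \<Longrightarrow> A * 1\<^sub>m n = A"
  by (auto intro: left_mult_one_mat right_mult_one_mat)

lemma mat_adjoint_carrier [simp]: "A \<in> carrier_mat n m \<Longrightarrow> mat_adjoint A \<in> carrier_mat m n"
  by (auto simp: mat_adjoint_def mat_of_rows_def)

lemma mat_adjoint_index [simp]:
  "i < dim_col A \<Longrightarrow> j < dim_row A \<Longrightarrow> mat_adjoint A $$ (i, j) = cnj (A $$ (j, i))" for A :: "complex mat"
  by (simp add: mat_adjoint_def mat_of_rows_index)

lemma mat_adjoint_dim [simp]: "dim_row (mat_adjoint A) = dim_col A" "dim_col (mat_adjoint A) = dim_row A"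
  by (auto simp: mat_adjoint_def mat_of_rows_def)

lemma index_mult_sum:
  "A \<in> carrier_mat n m \<Longrightarrow> B \<in> carrier_mat m p \<Longrightarrow> i < n \<Longrightarrow> j < p \<Longrightarrow>
    (A * B) $$ (i, j) = (\<Sum>k<m. A $$ (i, k) * B $$ (k, j))" for A :: "'a::semiring_0 mat"
  by (auto simp: scalar_prod_def atLeast0LessThan intro!: sum.cong)

lemma mat_adjoint_mult:
  fixes A B :: "complex mat"
  assumes A: "A \<in> carrier_mat n m" and B: "B \<in> carrier_mat m p"
  shows "mat_adjoint (A * B) = mat_adjoint B * mat_adjoint A"
proof (rule eq_matI)
  fix i j assume "i < dim_row (mat_adjoint B * mat_adjoint A)" "j < dim_col (mat_adjoint B * mat_adjoint A)"
  then have ij: "i < p" "j < n" using A B by auto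
  have "mat_adjoint (A * B) $$ (i, j) = (\<Sum>k<m. cnj (A $$ (j, k) * B $$ (k, i)))"
    using A B ij by (simp add: index_mult_sum[OF A B] del: index_mult_mat(1))
  also have "\<dots> = (mat_adjoint B * mat_adjoint A) $$ (i, j)"
    using A B ij by (subst index_mult_sum[of _ p m _ n]) (auto intro!: sum.cong)
  finally show "mat_adjoint (A * B) $$ (i, j) = (mat_adjoint B * mat_adjoint A) $$ (i, j)" .
qed (use A B in auto)

lemma mat_adjoint_adjoint [simp]: "mat_adjoint (mat_adjoint A) = A" for A :: "complex mat"
  by (rule eq_matI) auto

lemma mat_adjoint_one [simp]: "mat_adjoint (1\<^sub>m n) = (1\<^sub>m n :: complex mat)"
  by (rule eq_matI) auto

abbreviation unitary :: "nat \<Rightarrow> complex mat \<Rightarrow> bool" where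
  "unitary n U \<equiv> U \<in> carrier (unitary_group n)"

lemma unitary_iff:
  "unitary n U \<longleftrightarrow> U \<in> carrier_mat n n \<and> mat_adjoint U * U = 1\<^sub>m n \<and> U * mat_adjoint U = 1\<^sub>m n"
  by (simp add: unitary_group_def)

lemma unitaryD:
  assumes "unitary n U"
  shows "U \<in> carrier_mat n n" "mat_adjoint U * U = 1\<^sub>m n" "U * mat_adjoint U = 1\<^sub>m n"
  using assms by (auto simp: unitary_iff)

lemma unitaryI:
  assumes "U \<in> carrier_mat n n" "U * mat_adjoint U = 1\<^sub>m n"
  shows "unitary n U"
  using assms mat_mult_left_right_inverse[of U n "mat_adjoint U"] by (simp add: unitary_iff)

lemma unitary_one [simp]: "unitary n (1\<^sub>m n)"
  by (simp add: unitary_iff)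

lemma unitary_adjoint: "unitary n U \<Longrightarrow> unitary n (mat_adjoint U)"
  by (simp add: unitary_iff)

lemma unitary_mult:
  assumes U: "unitary n U" and V: "unitary n V"
  shows "unitary n (U * V)"
proof (rule unitaryI)
  note [simp] = unitaryD[OF U] unitaryD[OF V]
  show "U * V \<in> carrier_mat n n" by simp
  have "U * V * mat_adjoint (U * V) = U * V * (mat_adjoint V * mat_adjoint U)"
    by (subst mat_adjoint_mult[of _ n n _ n]) simp_all
  also have "\<dots> = U * (V * (mat_adjoint V * mat_adjoint U))"
    by (rule assoc_mult_mat[of _ n n _ n _ n]) simp_all
  also have "V * (mat_adjoint V * mat_adjoint U) = V * mat_adjoint V * mat_adjoint U"
    by (rule assoc_mult_mat[of _ n n _ n _ n, symmetric]) simp_all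
  also have "\<dots> = mat_adjoint U" by simp
  finally show "U * V * mat_adjoint (U * V) = 1\<^sub>m n" by simp
qed

section \<open>The Hilbert-Schmidt norm\<close>

definition hs :: "nat \<Rightarrow> complex mat \<Rightarrow> real" where
  "hs n X = L2_set (\<lambda>(i, j). cmod (X $$ (i, j))) ({..<n} \<times> {..<n})"

lemma hs_nonneg [simp]: "0 \<le> hs n X"
  by (simp add: hs_def)

lemma hs_power2: "(hs n X)\<^sup>2 = (\<Sum>i<n. \<Sum>j<n. (cmod (X $$ (i, j)))\<^sup>2)"
  by (simp add: hs_def L2_set_def sum_nonneg case_prod_unfold sum.cartesian_product)

lemma hs_eqI: "(hs n X)\<^sup>2 = (hs n Y)\<^sup>2 \<Longrightarrow> hs n X = hs n Y"
  by (rule power2_eq_imp_eq) simp_all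

lemma hs_eq_0:
  assumes "X \<in> carrier_mat n n" "hs n X = 0"
  shows "X = 0\<^sub>m n n"
proof (rule eq_matI)
  fix i j assume ij: "i < dim_row (0\<^sub>m n n)" "j < dim_col (0\<^sub>m n n)"
  have "\<forall>x\<in>{..<n} \<times> {..<n}. (\<lambda>(i, j). cmod (X $$ (i, j))) x = 0"
    using assms(2) unfolding hs_def by (subst (asm) L2_set_eq_0_iff) auto
  then show "X $$ (i, j) = 0\<^sub>m n n $$ (i, j)" using ij by auto
qed (use assms in auto)

lemma hs_zero [simp]: "hs n (0\<^sub>m n n) = 0"
  unfolding hs_def by (rule L2_set_0') auto

lemma hs_add:
  assumes "X \<in> carrier_mat n n" "Y \<in> carrier_mat n n"
  shows "hs n (X + Y) \<le> hs n X + hs n Y"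
proof -
  have "hs n (X + Y) \<le> L2_set (\<lambda>p. (case p of (i, j) \<Rightarrow> cmod (X $$ (i, j))) + (case p of (i, j) \<Rightarrow> cmod (Y $$ (i, j)))) ({..<n} \<times> {..<n})"
    unfolding hs_def using assms by (intro L2_set_mono) (auto simp: norm_triangle_ineq)
  also have "\<dots> \<le> hs n X + hs n Y" unfolding hs_def by (rule L2_set_triangle_ineq)
  finally show ?thesis .
qed

lemma hs_smult: "X \<in> carrier_mat n n \<Longrightarrow> hs n (c \<cdot>\<^sub>m X) = cmod c * hs n X"
  by (rule power2_eq_imp_eq) (auto simp: hs_power2 power_mult_distrib norm_mult sum_distrib_left)

lemma hs_diff_commute:
  "X \<in> carrier_mat n n \<Longrightarrow> Y \<in> carrier_mat n n \<Longrightarrow> hs n (X - Y) = hs n (Y - X)"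
  by (rule hs_eqI) (auto simp: hs_power2 norm_minus_commute)

lemma hs_diff_triangle:
  assumes "X \<in> carrier_mat n n" "Y \<in> carrier_mat n n"
  shows "hs n X \<le> hs n Y + hs n (X - Y)"
proof -
  have "X = Y + (X - Y)" using assms by (intro eq_matI) auto
  then show ?thesis using hs_add[of Y n "X - Y"] assms by (metis minus_carrier_mat)
qed

lemma hs_parallelogram:
  assumes "X \<in> carrier_mat n n" "Y \<in> carrier_mat n n"
  shows "(hs n (X + Y))\<^sup>2 + (hs n (X - Y))\<^sup>2 = 2 * (hs n X)\<^sup>2 + 2 * (hs n Y)\<^sup>2"
proof -
  have "(cmod (a + b))\<^sup>2 + (cmod (a - b))\<^sup>2 = 2 * (cmod a)\<^sup>2 + 2 * (cmod b)\<^sup>2" for a b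
    unfolding cmod_power2 by (simp add: power2_eq_square algebra_simps)
  then have "(\<Sum>i<n. \<Sum>j<n. (cmod (X $$ (i, j) + Y $$ (i, j)))\<^sup>2 + (cmod (X $$ (i, j) - Y $$ (i, j)))\<^sup>2)
    = (\<Sum>i<n. \<Sum>j<n. 2 * (cmod (X $$ (i, j)))\<^sup>2 + 2 * (cmod (Y $$ (i, j)))\<^sup>2)"
    by (simp only:)
  then show ?thesis using assms
    by (simp add: hs_power2 sum_distrib_left sum.distrib)
qed

lemma hs_power2_columns:
  assumes X: "X \<in> carrier_mat n n"
  shows "complex_of_real ((hs n X)\<^sup>2) = (\<Sum>j<n. (mat_adjoint X * X) $$ (j, j))"
proof -
  have "(mat_adjoint X * X) $$ (j, j) = (\<Sum>i<n. complex_of_real ((cmod (X $$ (i, j)))\<^sup>2))" if "j < n" for j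
    using X that unfolding complex_norm_square by (subst index_mult_sum[of _ n n _ n]) (auto simp: mult.commute)
  then show ?thesis unfolding hs_power2 by (subst sum.swap) simp
qed

lemma hs_adjoint: "X \<in> carrier_mat n n \<Longrightarrow> hs n (mat_adjoint X) = hs n X"
  by (rule hs_eqI, unfold hs_power2, subst sum.swap) auto

lemma hs_unitary_left:
  assumes U: "unitary n U" and X: "X \<in> carrier_mat n n"
  shows "hs n (U * X) = hs n X"
proof (rule hs_eqI)
  note [simp] = unitaryD[OF U] X
  have UX: "U * X \<in> carrier_mat n n" by simp
  have "mat_adjoint (U * X) * (U * X) = mat_adjoint X * mat_adjoint U * (U * X)"
    by (subst mat_adjoint_mult[of _ n n _ n]) simp_all
  also have "\<dots> = mat_adjoint X * (mat_adjoint U * (U * X))"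
    by (rule assoc_mult_mat[of _ n n _ n _ n]) simp_all
  also have "mat_adjoint U * (U * X) = mat_adjoint U * U * X"
    by (rule assoc_mult_mat[of _ n n _ n _ n, symmetric]) simp_all
  finally have "mat_adjoint (U * X) * (U * X) = mat_adjoint X * X" by simp
  then have "complex_of_real ((hs n (U * X))\<^sup>2) = complex_of_real ((hs n X)\<^sup>2)"
    by (simp only: hs_power2_columns X UX)
  then show "(hs n (U * X))\<^sup>2 = (hs n X)\<^sup>2" by (simp only: of_real_eq_iff)
qed

lemma hs_unitary_right:
  assumes U: "unitary n U" and X: "X \<in> carrier_mat n n"
  shows "hs n (X * U) = hs n X"
proof -
  have "hs n (X * U) = hs n (mat_adjoint (X * U))"
    using unitaryD(1)[OF U] X by (intro hs_adjoint[symmetric] mult_carrier_mat)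
  also have "\<dots> = hs n (mat_adjoint U * mat_adjoint X)"
    using unitaryD(1)[OF U] X by (subst mat_adjoint_mult) auto
  also have "\<dots> = hs n (mat_adjoint X)"
    using U X by (intro hs_unitary_left unitary_adjoint) auto
  finally show ?thesis using X by (simp add: hs_adjoint)
qed

lemma hs_one: "hs n (1\<^sub>m n) = sqrt n"
proof (rule power2_eq_imp_eq)
  have "(\<Sum>j<n. (cmod ((1\<^sub>m n :: complex mat) $$ (i, j)))\<^sup>2) = 1" if "i < n" for i
  proof -
    have "(\<Sum>j<n. (cmod ((1\<^sub>m n :: complex mat) $$ (i, j)))\<^sup>2) = (\<Sum>j<n. if j = i then 1 else 0)"
      using that by (intro sum.cong) auto
    then show ?thesis using that by simp
  qed
  then show "(hs n (1\<^sub>m n))\<^sup>2 = (sqrt n)\<^sup>2" by (simp add: hs_power2)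
qed simp_all

text \<open>The tensor action of U and the conjugate of V, with vectors written as matrices. For
  unitary \<open>U\<close> and \<open>V\<close>, \<open>X\<close> is fixed exactly if it
  intertwines, U X = X V.\<close>

definition conj_by :: "complex mat \<Rightarrow> complex mat \<Rightarrow> complex mat \<Rightarrow> complex mat" where
  "conj_by U V X = U * X * mat_adjoint V"

lemma conj_by_carrier [simp]:
  "U \<in> carrier_mat n n \<Longrightarrow> V \<in> carrier_mat n n \<Longrightarrow> X \<in> carrier_mat n n \<Longrightarrow> conj_by U V X \<in> carrier_mat n n"
  by (auto simp: conj_by_def)

lemma hs_conj_by:
  "unitary n U \<Longrightarrow> unitary n V \<Longrightarrow> X \<in> carrier_mat n n \<Longrightarrow> hs n (conj_by U V X) = hs n X"
  unfolding conj_by_def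
  by (subst hs_unitary_right) (auto simp: hs_unitary_left unitary_adjoint unitaryD(1))

lemma conj_by_mult:
  assumes "U \<in> carrier_mat n n" "U' \<in> carrier_mat n n" "V \<in> carrier_mat n n" "V' \<in> carrier_mat n n" "X \<in> carrier_mat n n"
  shows "conj_by (U * U') (V * V') X = conj_by U V (conj_by U' V' X)"
proof -
  note [simp] = assms
  note assoc = assoc_mult_mat[of _ n n _ n _ n]
  have "conj_by (U * U') (V * V') X = U * U' * X * (mat_adjoint V' * mat_adjoint V)"
    unfolding conj_by_def by (subst mat_adjoint_mult[of _ n n _ n]) simp_all
  also have "\<dots> = U * (U' * X * mat_adjoint V') * mat_adjoint V"
    by (simp add: assoc)
  finally show ?thesis by (simp add: conj_by_def)
qed

lemma conj_by_one [simp]: "X \<in> carrier_mat n n \<Longrightarrow> conj_by (1\<^sub>m n) (1\<^sub>m n) X = X"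
  by (simp add: conj_by_def)

lemma conj_by_index:
  assumes "U \<in> carrier_mat n n" "V \<in> carrier_mat n n" "X \<in> carrier_mat n n" "i < n" "j < n"
  shows "conj_by U V X $$ (i, j) = (\<Sum>a<n. \<Sum>b<n. U $$ (i, a) * X $$ (a, b) * cnj (V $$ (j, b)))"
proof -
  have "conj_by U V X $$ (i, j) = (\<Sum>b<n. (\<Sum>a<n. U $$ (i, a) * X $$ (a, b)) * cnj (V $$ (j, b)))"
    unfolding conj_by_def using assms
    by (subst index_mult_sum[of _ n n _ n]) (auto simp: index_mult_sum[of _ n n _ n] intro!: sum.cong simp del: index_mult_mat(1))
  then show ?thesis by (subst sum.swap) (simp add: sum_distrib_right)
qed

definition tr :: "nat \<Rightarrow> complex mat \<Rightarrow> complex" where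
  "tr n X = (\<Sum>i<n. X $$ (i, i))"

lemma tr_mult_commute:
  assumes "A \<in> carrier_mat n n" "B \<in> carrier_mat n n"
  shows "tr n (A * B) = tr n (B * A)"
proof -
  have "tr n (A * B) = (\<Sum>i<n. \<Sum>k<n. A $$ (i, k) * B $$ (k, i))"
    unfolding tr_def using assms by (intro sum.cong refl index_mult_sum) auto
  also have "\<dots> = (\<Sum>k<n. \<Sum>i<n. B $$ (k, i) * A $$ (i, k))"
    by (subst sum.swap) (simp add: mult.commute)
  also have "\<dots> = tr n (B * A)"
    unfolding tr_def using assms by (intro sum.cong refl index_mult_sum[symmetric]) auto
  finally show ?thesis .
qed

lemma tr_conj_by:
  assumes U: "unitary n U" and X: "X \<in> carrier_mat n n"
  shows "tr n (conj_by U U X) = tr n X"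
proof -
  note [simp] = unitaryD[OF U] X
  have "tr n (conj_by U U X) = tr n (mat_adjoint U * (U * X))"
    unfolding conj_by_def by (rule tr_mult_commute) simp_all
  also have "mat_adjoint U * (U * X) = mat_adjoint U * U * X"
    by (rule assoc_mult_mat[of _ n n _ n _ n, symmetric]) simp_all
  finally show ?thesis by simp
qed

text \<open>Defined entrywise, so that splitting and exchanging sums needs no carrier
  conditions.\<close>

definition msum :: "nat \<Rightarrow> ('a \<Rightarrow> complex mat) \<Rightarrow> 'a set \<Rightarrow> complex mat" where
  "msum n f A = mat n n (\<lambda>(i, j). \<Sum>a\<in>A. f a $$ (i, j))"

lemma msum_carrier [simp]: "msum n f A \<in> carrier_mat n n"
  by (simp add: msum_def)

lemma msum_index: "i < n \<Longrightarrow> j < n \<Longrightarrow> msum n f A $$ (i, j) = (\<Sum>a\<in>A. f a $$ (i, j))"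
  by (simp add: msum_def)

lemma msum_cong: "A = B \<Longrightarrow> (\<And>a. a \<in> B \<Longrightarrow> f a = g a) \<Longrightarrow> msum n f A = msum n g B"
  by (simp add: msum_def)

lemma hs_msum:
  assumes "finite A" "\<And>a. a \<in> A \<Longrightarrow> f a \<in> carrier_mat n n"
  shows "hs n (msum n f A) \<le> (\<Sum>a\<in>A. hs n (f a))"
  using assms
proof (induction A)
  case empty
  have "hs n (msum n f {}) = 0" unfolding hs_def msum_def by (rule L2_set_0') auto
  then show ?case by simp
next
  case (insert a A)
  have "msum n f (insert a A) = f a + msum n f A"
    using insert by (intro eq_matI) (auto simp: msum_def)
  then have "hs n (msum n f (insert a A)) \<le> hs n (f a) + hs n (msum n f A)"
    using insert hs_add[of "f a" n "msum n f A"] by simp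
  then show ?case using insert by simp
qed

lemma msum_union:
  "finite A \<Longrightarrow> finite B \<Longrightarrow> A \<inter> B = {} \<Longrightarrow> msum n f (A \<union> B) = msum n f A + msum n f B"
  by (intro eq_matI) (auto simp: msum_def sum.union_disjoint)

lemma conj_by_msum:
  assumes "U \<in> carrier_mat n n" "V \<in> carrier_mat n n" "\<And>a. a \<in> A \<Longrightarrow> f a \<in> carrier_mat n n"
  shows "conj_by U V (msum n f A) = msum n (\<lambda>a. conj_by U V (f a)) A"
proof (rule eq_matI)
  fix i j assume "i < dim_row (msum n (\<lambda>a. conj_by U V (f a)) A)" "j < dim_col (msum n (\<lambda>a. conj_by U V (f a)) A)"
  then have ij: "i < n" "j < n" by (auto simp: msum_def)
  have "conj_by U V (msum n f A) $$ (i, j) = (\<Sum>b<n. \<Sum>c<n. \<Sum>a\<in>A. U $$ (i, b) * f a $$ (b, c) * cnj (V $$ (j, c)))"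
    using assms ij by (subst conj_by_index[of _ n]) (auto simp: msum_index sum_distrib_left sum_distrib_right)
  also have "\<dots> = (\<Sum>b<n. \<Sum>a\<in>A. \<Sum>c<n. U $$ (i, b) * f a $$ (b, c) * cnj (V $$ (j, c)))"
    by (rule sum.cong[OF refl], rule sum.swap)
  also have "\<dots> = (\<Sum>a\<in>A. \<Sum>b<n. \<Sum>c<n. U $$ (i, b) * f a $$ (b, c) * cnj (V $$ (j, c)))"
    by (rule sum.swap)
  also have "\<dots> = msum n (\<lambda>a. conj_by U V (f a)) A $$ (i, j)"
    using assms ij by (simp add: msum_index conj_by_index)
  finally show "conj_by U V (msum n f A) $$ (i, j) = msum n (\<lambda>a. conj_by U V (f a)) A $$ (i, j)" .
qed (use assms in \<open>auto simp: msum_def conj_by_def\<close>)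

lemma tr_msum: "tr n (msum n f A) = (\<Sum>a\<in>A. tr n (f a))"
  unfolding tr_def by (subst sum.swap) (simp add: msum_index)

lemma msum_div_mod:
  fixes f :: "nat \<Rightarrow> nat \<Rightarrow> complex mat"
  shows "msum n (\<lambda>i. f (i div q) (i mod q)) {..<p * q} = msum n (\<lambda>a. msum n (f a) {..<q}) {..<p}"
proof (rule eq_matI)
  fix i j assume "i < dim_row (msum n (\<lambda>a. msum n (f a) {..<q}) {..<p})"
    "j < dim_col (msum n (\<lambda>a. msum n (f a) {..<q}) {..<p})"
  then show "msum n (\<lambda>i. f (i div q) (i mod q)) {..<p * q} $$ (i, j)
    = msum n (\<lambda>a. msum n (f a) {..<q}) {..<p} $$ (i, j)"
    using sum_div_mod[of "\<lambda>a b. f a b $$ (i, j)"] by (simp add: msum_def)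
qed (auto simp: msum_def)

lemma msum_swap: "msum n (\<lambda>a. msum n (f a) B) A = msum n (\<lambda>b. msum n (\<lambda>a. f a b) A) B"
  by (rule eq_matI) (auto simp: msum_def intro: sum.swap)

text \<open>Multiply by the unitary \<open>V\<close> on the right. Almost-invariance becomes a
  commutator estimate, which is linear in \<open>U\<close> and \<open>V\<close>.\<close>

lemma hs_conj_diff:
  assumes U: "unitary n U" and V: "unitary n V" and X: "X \<in> carrier_mat n n"
  shows "hs n (conj_by U V X - X) = hs n (U * X - X * V)"
proof -
  note [simp] = unitaryD[OF U] unitaryD[OF V] X
  have "(conj_by U V X - X) * V = conj_by U V X * V - X * V"
    by (rule minus_mult_distrib_mat[of _ n n _ _ n]) simp_all
  also have "conj_by U V X * V = U * X * (mat_adjoint V * V)"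
    unfolding conj_by_def by (rule assoc_mult_mat[of _ n n _ n _ n]) simp_all
  also have "\<dots> = U * X" unfolding unitaryD(2)[OF V] by (rule right_mult_one_mat[of _ n]) simp
  finally have "hs n (U * X - X * V) = hs n ((conj_by U V X - X) * V)" by simp
  also have "\<dots> = hs n (conj_by U V X - X)" using V by (rule hs_unitary_right) (simp add: minus_carrier_mat)
  finally show ?thesis ..
qed

section \<open>A quantum expander in every dimension\<close>

text \<open>The identity at index 0 contributes \<open>X\<close> itself, and by the parallelogram
  law the sum of \<open>X\<close> and term \<open>j\<close> is short when the two are far apart. The
  remaining terms are bounded by the triangle inequality.\<close>

lemma average_contraction:
  fixes u v :: "nat \<Rightarrow> complex mat"
  assumes u: "\<And>i. i < k \<Longrightarrow> unitary n (u i)" and v: "\<And>i. i < k \<Longrightarrow> unitary n (v i)"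
    and uv0: "u 0 = 1\<^sub>m n" "v 0 = 1\<^sub>m n" and X: "X \<in> carrier_mat n n"
    and j: "j < k" and far: "\<eta> * hs n X \<le> hs n (u j * X - X * v j)" and \<eta>: "0 < \<eta>" "\<eta> \<le> 1"
  shows "hs n (msum n (\<lambda>i. conj_by (u i) (v i) X) {..<k}) \<le> (k - \<eta>\<^sup>2 / 4) * hs n X"
proof -
  let ?y = "\<lambda>i. conj_by (u i) (v i) X" and ?h = "hs n X"
  have y: "?y i \<in> carrier_mat n n" "hs n (?y i) = ?h" if "i < k" for i
    using u[OF that] v[OF that] X by (auto simp: unitaryD(1) hs_conj_by)
  have y0: "?y 0 = X" using uv0 X by simp
  show ?thesis
  proof (cases "j = 0")
    case True
    have "u j * X - X * v j = 0\<^sub>m n n"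
      using True uv0 X by (intro eq_matI) auto
    then have "?h = 0" using far \<eta> hs_nonneg[of n X] by (simp add: mult_le_0_iff)
    moreover have "hs n (msum n ?y {..<k}) \<le> (\<Sum>i<k. hs n (?y i))" using y by (intro hs_msum) auto
    ultimately show ?thesis using y hs_nonneg[of n "msum n ?y {..<k}"] by simp
  next
    case False
    let ?R = "{..<k} - {0, j}"
    have k: "{..<k} = {0, j} \<union> ?R" using j by auto
    have yj: "?y j \<in> carrier_mat n n" using y j by simp
    have "msum n ?y {0, j} = X + ?y j"
      using False X yj y0 by (intro eq_matI) (auto simp: msum_def)
    then have eq: "msum n ?y {..<k} = (X + ?y j) + msum n ?y ?R"
      by (subst k, subst msum_union) auto
    have "hs n (msum n ?y {..<k}) \<le> hs n (X + ?y j) + hs n (msum n ?y ?R)"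
      unfolding eq using X yj by (intro hs_add) simp_all
    also have "hs n (msum n ?y ?R) \<le> (\<Sum>i\<in>?R. hs n (?y i))"
      using y by (intro hs_msum) auto
    also have "(\<Sum>i\<in>?R. hs n (?y i)) = (\<Sum>i\<in>?R. ?h)" using y by (intro sum.cong) auto
    also have "\<dots> = (real k - 2) * ?h"
      using False j by (simp add: card_Diff_subset of_nat_diff)
    also have "hs n (X + ?y j) \<le> (2 - \<eta>\<^sup>2 / 4) * ?h"
    proof (rule power2_le_imp_le)
      have "\<eta> * ?h \<le> hs n (X - ?y j)"
        using far hs_conj_diff[OF u[OF j] v[OF j] X] hs_diff_commute[OF X yj] by simp
      then have "(\<eta> * ?h)\<^sup>2 \<le> (hs n (X - ?y j))\<^sup>2" using \<eta> by (intro power_mono) auto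
      then have "(hs n (X + ?y j))\<^sup>2 \<le> 4 * ?h\<^sup>2 - (\<eta> * ?h)\<^sup>2"
        using hs_parallelogram[OF X yj] y(2)[OF j] by simp
      also have "\<dots> = (4 - \<eta>\<^sup>2) * ?h\<^sup>2" by (simp add: power_mult_distrib algebra_simps)
      \<comment> \<open>(2 - \<eta>^2 / 4)^2 = 4 - \<eta>^2 + \<eta>^4 / 16.\<close>
      also have "\<dots> \<le> (2 - \<eta>\<^sup>2 / 4)\<^sup>2 * ?h\<^sup>2"
        by (intro mult_right_mono) (auto simp: power2_diff)
      finally show "(hs n (X + ?y j))\<^sup>2 \<le> ((2 - \<eta>\<^sup>2 / 4) * ?h)\<^sup>2" by (simp add: power_mult_distrib)
      have "\<eta>\<^sup>2 \<le> 1" using \<eta> by (simp add: power_le_one)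
      then show "0 \<le> (2 - \<eta>\<^sup>2 / 4) * ?h" by (intro mult_nonneg_nonneg) auto
    qed
    finally show ?thesis by (simp add: algebra_simps)
  qed
qed

text \<open>The base k digits of \<open>i\<close>, least significant first, spell the word; as
  \<open>i\<close> runs below k^l, each digit string of length l occurs once.\<close>

primrec word :: "nat \<Rightarrow> nat \<Rightarrow> (nat \<Rightarrow> complex mat) \<Rightarrow> nat \<Rightarrow> nat \<Rightarrow> complex mat" where
  "word n k u 0 i = 1\<^sub>m n"
| "word n k u (Suc l) i = u (i mod k) * word n k u l (i div k)"

lemma unitary_word:
  assumes "\<And>i. i < k \<Longrightarrow> unitary n (u i)" "0 < k"
  shows "unitary n (word n k u l i)"
  using assms by (induction l arbitrary: i) (auto intro: unitary_mult)

text \<open>The sum over all words of length l is the l-fold iterate of the sum over the generators.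
  \<open>P\<close> is a class preserved by one step on which the one-step bound holds: trace zero
  matrices for a single tuple, all matrices for two separated tuples.\<close>

lemma word_contraction:
  assumes u: "\<And>i. i < k \<Longrightarrow> unitary n (u i)" and v: "\<And>i. i < k \<Longrightarrow> unitary n (v i)" and "0 < k"
    and P: "\<And>X. P X \<Longrightarrow> X \<in> carrier_mat n n"
    and step: "\<And>X. P X \<Longrightarrow> P (msum n (\<lambda>i. conj_by (u i) (v i) X) {..<k})"
    and le: "\<And>X. P X \<Longrightarrow> hs n (msum n (\<lambda>i. conj_by (u i) (v i) X) {..<k}) \<le> g * hs n X"
    and "0 \<le> g" and "P X"
  defines "W \<equiv> \<lambda>l. msum n (\<lambda>i. conj_by (word n k u l i) (word n k v l i) X) {..<k ^ l}"
  shows "P (W l) \<and> hs n (W l) \<le> g ^ l * hs n X"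
proof (induction l)
  case 0
  have "W 0 = X" using P[OF \<open>P X\<close>] by (intro eq_matI) (auto simp: W_def msum_def)
  then show ?case using \<open>P X\<close> by simp
next
  case (Suc l)
  let ?w = "\<lambda>u. word n k u l"
  have X: "X \<in> carrier_mat n n" using P[OF \<open>P X\<close>] .
  note uw = unitary_word[OF u \<open>0 < k\<close>] and vw = unitary_word[OF v \<open>0 < k\<close>]
  have "W (Suc l) = msum n (\<lambda>i. conj_by (u (i mod k) * ?w u (i div k)) (v (i mod k) * ?w v (i div k)) X) {..<k ^ l * k}"
    by (simp add: W_def mult.commute)
  also have "\<dots> = msum n (\<lambda>a. msum n (\<lambda>b. conj_by (u b * ?w u a) (v b * ?w v a) X) {..<k}) {..<k ^ l}"
    by (rule msum_div_mod[of n "\<lambda>a b. conj_by (u b * ?w u a) (v b * ?w v a) X"])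
  also have "\<dots> = msum n (\<lambda>b. msum n (\<lambda>a. conj_by (u b * ?w u a) (v b * ?w v a) X) {..<k ^ l}) {..<k}"
    by (rule msum_swap)
  also have "\<dots> = msum n (\<lambda>b. conj_by (u b) (v b) (W l)) {..<k}"
  proof (rule msum_cong[OF refl])
    fix b assume "b \<in> {..<k}"
    then have ub: "u b \<in> carrier_mat n n" "v b \<in> carrier_mat n n" using u v unitaryD(1) by auto
    have w: "?w u a \<in> carrier_mat n n" "?w v a \<in> carrier_mat n n" for a
      using unitaryD(1)[OF uw] unitaryD(1)[OF vw] by auto
    have "msum n (\<lambda>a. conj_by (u b * ?w u a) (v b * ?w v a) X) {..<k ^ l}
      = msum n (\<lambda>a. conj_by (u b) (v b) (conj_by (?w u a) (?w v a) X)) {..<k ^ l}"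
      by (rule msum_cong[OF refl]) (rule conj_by_mult[OF ub(1) w(1) ub(2) w(2) X])
    also have "\<dots> = conj_by (u b) (v b) (W l)"
      unfolding W_def by (rule conj_by_msum[symmetric]) (use ub w X in auto)
    finally show "msum n (\<lambda>a. conj_by (u b * ?w u a) (v b * ?w v a) X) {..<k ^ l} = conj_by (u b) (v b) (W l)" .
  qed
  finally have W: "W (Suc l) = msum n (\<lambda>b. conj_by (u b) (v b) (W l)) {..<k}" .
  have "hs n (W (Suc l)) \<le> g * hs n (W l)" unfolding W using Suc le by blast
  also have "\<dots> \<le> g * (g ^ l * hs n X)" using Suc \<open>0 \<le> g\<close> by (intro mult_left_mono) auto
  finally show ?case using Suc step unfolding W by (auto simp: mult.assoc)
qed

section \<open>Clock, quadratic phase and Fourier matrices\<close>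

definition diagonal :: "nat \<Rightarrow> (nat \<Rightarrow> complex) \<Rightarrow> complex mat" where
  "diagonal n d = mat n n (\<lambda>(i, j). if i = j then d i else 0)"

lemma diagonal_carrier [simp]: "diagonal n d \<in> carrier_mat n n"
  by (simp add: diagonal_def)

lemma diagonal_dim [simp]: "dim_row (diagonal n d) = n" "dim_col (diagonal n d) = n"
  by (simp_all add: diagonal_def)

lemma diagonal_mult_index:
  assumes X: "X \<in> carrier_mat n n" and ij: "i < n" "j < n"
  shows "(diagonal n d * X) $$ (i, j) = d i * X $$ (i, j)"
    and "(X * diagonal n d) $$ (i, j) = X $$ (i, j) * d j"
proof -
  have "(\<Sum>k<n. diagonal n d $$ (i, k) * X $$ (k, j)) = (\<Sum>k<n. if k = i then d i * X $$ (i, j) else 0)"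
    using ij by (intro sum.cong) (auto simp: diagonal_def)
  then show "(diagonal n d * X) $$ (i, j) = d i * X $$ (i, j)"
    using ij by (simp add: index_mult_sum[OF diagonal_carrier X] del: index_mult_mat(1))
  have "(\<Sum>k<n. X $$ (i, k) * diagonal n d $$ (k, j)) = (\<Sum>k<n. if k = j then X $$ (i, j) * d j else 0)"
    using ij by (intro sum.cong) (auto simp: diagonal_def)
  then show "(X * diagonal n d) $$ (i, j) = X $$ (i, j) * d j"
    using ij by (simp add: index_mult_sum[OF X diagonal_carrier] del: index_mult_mat(1))
qed

lemma unitary_diagonal:
  assumes "\<And>i. cmod (d i) = 1"
  shows "unitary n (diagonal n d)"
proof (rule unitaryI)
  show "diagonal n d * mat_adjoint (diagonal n d) = 1\<^sub>m n"
  proof (rule eq_matI)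
    fix i j assume "i < dim_row (1\<^sub>m n)" "j < dim_col (1\<^sub>m n)"
    then have ij: "i < n" "j < n" by auto
    have "d i * cnj (d i) = 1" using assms[of i] complex_norm_square[of "d i"] by simp
    then show "(diagonal n d * mat_adjoint (diagonal n d)) $$ (i, j) = 1\<^sub>m n $$ (i, j)"
      using ij by (subst diagonal_mult_index) (auto simp: diagonal_def)
  qed (auto simp: diagonal_def)
qed simp

definition clock_mat :: "nat \<Rightarrow> complex mat" where
  "clock_mat n = diagonal n (\<lambda>i. omega n (int i))"

definition quadratic_mat :: "nat \<Rightarrow> complex mat" where
  "quadratic_mat n = diagonal n (\<lambda>i. omega n (int i * int i))"

definition fourier_mat :: "nat \<Rightarrow> complex mat" where
  "fourier_mat n = mat n n (\<lambda>(i, j). omega n (int i * int j) / sqrt n)"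

lemma unitary_clock [simp]: "unitary n (clock_mat n)"
  unfolding clock_mat_def by (rule unitary_diagonal) simp

lemma unitary_quadratic [simp]: "unitary n (quadratic_mat n)"
  unfolding quadratic_mat_def by (rule unitary_diagonal) simp

lemma sum_residues_int: "(\<Sum>i\<in>residues n. f i) = (\<Sum>i<n. f (int i))"
  by (rule sum.reindex_bij_witness[where i = int and j = nat]) auto

lemma unitary_fourier [simp]:
  assumes "0 < n"
  shows "unitary n (fourier_mat n)"
proof (rule unitaryI)
  show "fourier_mat n * mat_adjoint (fourier_mat n) = 1\<^sub>m n"
  proof (rule eq_matI)
    fix i j assume "i < dim_row (1\<^sub>m n)" "j < dim_col (1\<^sub>m n)"
    then have ij: "i < n" "j < n" by auto
    have sq: "complex_of_real (sqrt n) * complex_of_real (sqrt n) = of_nat n"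
      by (simp flip: of_real_mult)
    have "(fourier_mat n * mat_adjoint (fourier_mat n)) $$ (i, j)
      = (\<Sum>k<n. omega n (int k * (int i - int j)) / of_nat n)"
    proof (subst index_mult_sum[of _ n n _ n])
      show "(\<Sum>k<n. fourier_mat n $$ (i, k) * mat_adjoint (fourier_mat n) $$ (k, j))
        = (\<Sum>k<n. omega n (int k * (int i - int j)) / of_nat n)"
      proof (intro sum.cong refl)
        fix k assume k: "k \<in> {..<n}"
        have "omega n (int i * int k) * omega n (- (int j * int k)) = omega n (int k * (int i - int j))"
          unfolding omega_add[symmetric] by (rule arg_cong[where f = "omega n"]) (simp add: algebra_simps)
        then show "fourier_mat n $$ (i, k) * mat_adjoint (fourier_mat n) $$ (k, j)
          = omega n (int k * (int i - int j)) / of_nat n"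
          using ij k sq by (simp add: fourier_mat_def cnj_omega)
      qed
    qed (use ij in \<open>auto simp: fourier_mat_def\<close>)
    also have "\<dots> = (\<Sum>k\<in>residues n. omega n (k * (int i - int j))) / of_nat n"
      by (simp add: sum_residues_int sum_divide_distrib)
    also have "\<dots> = (if i = j then 1 else 0)"
    proof -
      have "int n dvd int i - int j \<longleftrightarrow> i = j"
        using ij residues_eq_iff[of "int i" n "int j", unfolded mod_eq_dvd_iff] by simp
      then show ?thesis using assms by (simp add: sum_omega)
    qed
    finally show "(fourier_mat n * mat_adjoint (fourier_mat n)) $$ (i, j) = 1\<^sub>m n $$ (i, j)"
      using ij by simp
  qed (auto simp: fourier_mat_def)
qed (simp add: fourier_mat_def)

definition periodize :: "nat \<Rightarrow> complex mat \<Rightarrow> int \<Rightarrow> int \<Rightarrow> complex" where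
  "periodize n X i j = X $$ (nat (i mod int n), nat (j mod int n))"

lemma periodize_int: "i < n \<Longrightarrow> j < n \<Longrightarrow> periodize n X (int i) (int j) = X $$ (i, j)"
  by (simp add: periodize_def)

lemma biperiodic_periodize: "biperiodic n (periodize n X)"
  unfolding biperiodic_def periodize_def by (intro allI impI) (simp only:)

lemma l2_eq_hs:
  assumes "\<And>i j. i < n \<Longrightarrow> j < n \<Longrightarrow> cmod (f (int i) (int j)) = cmod (X $$ (i, j))"
  shows "l2 f (residues n \<times> residues n) = hs n X"
proof (rule power2_eq_imp_eq)
  have "(l2 f (residues n \<times> residues n))\<^sup>2 = (\<Sum>i\<in>residues n. \<Sum>j\<in>residues n. (cmod (f i j))\<^sup>2)"
    by (simp add: l2_power2 sum.cartesian_product)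
  also have "\<dots> = (hs n X)\<^sup>2"
    unfolding sum_residues_int hs_power2 using assms by (intro sum.cong refl) simp
  finally show "(l2 f (residues n \<times> residues n))\<^sup>2 = (hs n X)\<^sup>2" .
qed simp_all

text \<open>\<open>w\<close> is the quotient d i / d j; factoring out the unimodular
  \<open>d j\<close> does not change the modulus of an entry.\<close>

lemma hs_diagonal_commutator:
  assumes X: "X \<in> carrier_mat n n"
    and d: "\<And>i j. i < n \<Longrightarrow> j < n \<Longrightarrow> w (int i) (int j) * d j = d i" and n: "\<And>j. cmod (d j) = 1"
  shows "l2 (\<lambda>i j. w i j * periodize n X i j - periodize n X i j) (residues n \<times> residues n)
    = hs n (diagonal n d * X - X * diagonal n d)"
proof (rule l2_eq_hs)
  fix i j assume ij: "i < n" "j < n"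
  have "(diagonal n d * X - X * diagonal n d) $$ (i, j) = d i * X $$ (i, j) - X $$ (i, j) * d j"
    using ij by (simp add: diagonal_mult_index[OF X] carrier_matD[OF X] del: index_mult_mat(1))
  also have "\<dots> = (w (int i) (int j) * X $$ (i, j) - X $$ (i, j)) * d j"
    using d[OF ij] by (simp add: algebra_simps)
  finally show "cmod (w (int i) (int j) * periodize n X (int i) (int j) - periodize n X (int i) (int j))
    = cmod ((diagonal n d * X - X * diagonal n d) $$ (i, j))"
    using ij n by (simp add: norm_mult periodize_int)
qed

lemma conj_by_fourier_index:
  assumes X: "X \<in> carrier_mat n n" and ij: "i < n" "j < n"
  shows "conj_by (fourier_mat n) (fourier_mat n) X $$ (i, j) = fourier_conj n (periodize n X) (int i) (int j)"
proof -
  have sq: "complex_of_real (sqrt n) * complex_of_real (sqrt n) = of_nat n"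
    by (simp flip: of_real_mult)
  have F: "fourier_mat n \<in> carrier_mat n n" by (simp add: fourier_mat_def)
  have "conj_by (fourier_mat n) (fourier_mat n) X $$ (i, j)
    = (\<Sum>a<n. \<Sum>b<n. omega n (int i * int a - int j * int b) * X $$ (a, b) / of_nat n)"
    unfolding conj_by_index[OF F F X ij]
  proof (intro sum.cong refl)
    fix a b assume ab: "a \<in> {..<n}" "b \<in> {..<n}"
    have "omega n (int i * int a) * omega n (- (int j * int b)) = omega n (int i * int a - int j * int b)"
      unfolding omega_add[symmetric] by simp
    then show "fourier_mat n $$ (i, a) * X $$ (a, b) * cnj (fourier_mat n $$ (j, b))
      = omega n (int i * int a - int j * int b) * X $$ (a, b) / of_nat n"
      using ij ab sq by (simp add: fourier_mat_def cnj_omega mult_ac)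
  qed
  also have "\<dots> = fourier_conj n (periodize n X) (int i) (int j)"
    by (simp add: fourier_conj_def sum_residues_int periodize_int sum_divide_distrib)
  finally show ?thesis .
qed

text \<open>On Weyl coefficients the three matrices act as phase, shear and quarter turn, so
  \<open>weyl_expander\<close> applies to the periodic extension of \<open>X\<close> with e = hs n X
  / 16.\<close>

lemma quantum_expander:
  assumes X: "X \<in> carrier_mat n n" and "0 < n" and tr: "tr n X = 0"
    and "16 * hs n (clock_mat n * X - X * clock_mat n) \<le> hs n X"
    and "16 * hs n (quadratic_mat n * X - X * quadratic_mat n) \<le> hs n X"
    and "16 * hs n (fourier_mat n * X - X * fourier_mat n) \<le> hs n X"
  shows "hs n X = 0"
proof (rule weyl_expander[where e = "hs n X / 16", OF biperiodic_periodize \<open>0 < n\<close>])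
  let ?x = "periodize n X"
  show "(\<Sum>i\<in>residues n. ?x i i) = 0"
    using tr by (simp add: sum_residues_int periodize_int tr_def)
  show "l2 ?x (residues n \<times> residues n) = hs n X"
    by (rule l2_eq_hs) (simp add: periodize_int)
  show "l2 (\<lambda>i j. omega n (i - j) * ?x i j - ?x i j) (residues n \<times> residues n) \<le> hs n X / 16"
    using assms(4) unfolding clock_mat_def
    by (subst hs_diagonal_commutator[OF X, where d = "\<lambda>i. omega n (int i)"]) (simp_all flip: omega_add)
  show "l2 (\<lambda>i j. omega n (i * i - j * j) * ?x i j - ?x i j) (residues n \<times> residues n) \<le> hs n X / 16"
    using assms(5) unfolding quadratic_mat_def
    by (subst hs_diagonal_commutator[OF X, where d = "\<lambda>i. omega n (int i * int i)"]) (simp_all flip: omega_add)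
  have "l2 (\<lambda>i j. fourier_conj n ?x i j - ?x i j) (residues n \<times> residues n)
    = hs n (conj_by (fourier_mat n) (fourier_mat n) X - X)"
    by (intro l2_eq_hs) (simp add: conj_by_fourier_index[OF X] periodize_int carrier_matD[OF X])
  also have "\<dots> = hs n (fourier_mat n * X - X * fourier_mat n)"
    by (rule hs_conj_diff[OF unitary_fourier unitary_fourier X]) fact+
  finally show "l2 (\<lambda>i j. fourier_conj n ?x i j - ?x i j) (residues n \<times> residues n) \<le> hs n X / 16"
    using assms(6) by simp
qed simp

section \<open>Generators of a letter: expander and packed matrices\<close>

definition real_mat :: "nat \<Rightarrow> (nat \<Rightarrow> nat \<Rightarrow> real) \<Rightarrow> complex mat" where
  "real_mat n v = mat n n (\<lambda>(i, j). complex_of_real (v i j))"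

lemma unitary_real_mat:
  assumes "orthonormal n n v"
  shows "unitary n (real_mat n v)"
proof (rule unitaryI)
  show "real_mat n v * mat_adjoint (real_mat n v) = 1\<^sub>m n"
  proof (rule eq_matI)
    fix i j assume "i < dim_row (1\<^sub>m n)" "j < dim_col (1\<^sub>m n)"
    then have ij: "i < n" "j < n" by auto
    have "(\<Sum>k<n. real_mat n v $$ (i, k) * mat_adjoint (real_mat n v) $$ (k, j)) = complex_of_real (dot n (v i) (v j))"
      using ij by (simp add: real_mat_def dot_def)
    then have "(real_mat n v * mat_adjoint (real_mat n v)) $$ (i, j) = complex_of_real (dot n (v i) (v j))"
      using ij by (subst index_mult_sum[of _ n n _ n]) (auto simp: real_mat_def)
    then show "(real_mat n v * mat_adjoint (real_mat n v)) $$ (i, j) = 1\<^sub>m n $$ (i, j)"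
      using ij assms by (simp add: orthonormal_def)
  qed (auto simp: real_mat_def)
qed (simp add: real_mat_def)

lemma hs_real_mat_diff: "(hs n (real_mat n v - real_mat n w))\<^sup>2 = sqdist n v w"
  unfolding hs_power2 sqdist_def by (intro sum.cong refl) (simp add: real_mat_def flip: of_real_diff)

text \<open>Indices 0 to 3 are the same for all letters: the identity, which
  \<open>average_contraction\<close> relies on, and the expander. Only the matrices from index 4 on
  tell letters apart.\<close>

definition generator :: "nat \<Rightarrow> (nat \<Rightarrow> nat \<Rightarrow> nat \<Rightarrow> real) \<Rightarrow> nat \<Rightarrow> complex mat" where
  "generator n a j =
    (if j < 4 then [1\<^sub>m n, clock_mat n, quadratic_mat n, fourier_mat n] ! j else real_mat n (a (j - 4)))"

lemma unitary_generator:
  assumes "0 < n" "\<And>j. j < m \<Longrightarrow> orthonormal n n (a j)" "j < 4 + m"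
  shows "unitary n (generator n a j)"
proof -
  consider "j = 0" | "j = 1" | "j = 2" | "j = 3" | "4 \<le> j" by linarith
  then show ?thesis using assms by cases (auto simp: generator_def intro!: unitary_real_mat)
qed

text \<open>At the indices 1 to 3 the generators do not depend on \<open>a\<close> and
  \<open>b\<close>, so the expander controls trace zero matrices even between two different
  letters.\<close>

lemma commutator_expansion:
  assumes "X \<in> carrier_mat n n" "0 < n" "tr n X = 0"
  shows "\<exists>j\<in>{1, 2, 3}. hs n X \<le> 16 * hs n (generator n a j * X - X * generator n b j)"
proof (rule ccontr)
  assume "\<not> ?thesis"
  then have less: "16 * hs n (generator n a j * X - X * generator n b j) < hs n X" if "j \<in> {1, 2, 3}" for j
    using that by (meson not_le)
  have "hs n X = 0"
    using less[of 1] less[of 2] less[of 3]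
    by (intro quantum_expander[OF assms]) (simp_all add: generator_def)
  moreover have "\<not> hs n A < 0" for A by (simp add: not_less)
  ultimately show False using less[of 1] by simp
qed

lemma commutator_shift:
  fixes U V Y :: "complex mat"
  assumes "U \<in> carrier_mat n n" "V \<in> carrier_mat n n" "Y \<in> carrier_mat n n"
  shows "U * (c \<cdot>\<^sub>m 1\<^sub>m n + Y) - (c \<cdot>\<^sub>m 1\<^sub>m n + Y) * V = c \<cdot>\<^sub>m (U - V) + (U * Y - Y * V)"
proof -
  note d = carrier_matD[OF assms(1)] carrier_matD[OF assms(2)] carrier_matD[OF assms(3)]
  have I: "c \<cdot>\<^sub>m 1\<^sub>m n \<in> carrier_mat n n" by simp
  have "U * (c \<cdot>\<^sub>m 1\<^sub>m n) = c \<cdot>\<^sub>m U"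
    using mult_smult_distrib[OF assms(1), of "1\<^sub>m n" n c] assms by simp
  then have "U * (c \<cdot>\<^sub>m 1\<^sub>m n + Y) = c \<cdot>\<^sub>m U + U * Y"
    using mult_add_distrib_mat[OF assms(1) I assms(3)] by simp
  moreover have "(c \<cdot>\<^sub>m 1\<^sub>m n) * V = c \<cdot>\<^sub>m V"
    using mult_smult_assoc_mat[of "1\<^sub>m n" n n V n c] assms by simp
  then have "(c \<cdot>\<^sub>m 1\<^sub>m n + Y) * V = c \<cdot>\<^sub>m V + Y * V"
    using add_mult_distrib_mat[OF I assms(3,2)] by simp
  ultimately show ?thesis using assms d
    by (intro eq_matI) (auto simp: algebra_simps simp del: index_mult_mat(1))
qed

text \<open>Write X = c 1 + Y with \<open>Y\<close> of trace zero. If all commutators are small, the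
  common expander makes \<open>Y\<close> small, and the commutator at index 4 + i is then close to c
  (V - W), where V - W has norm at least sqrt n / 4. So scalars are moved as well, and the bound
  holds for every matrix.\<close>

lemma generator_expansion:
  assumes X: "X \<in> carrier_mat n n" and "0 < n"
    and a: "\<And>j. j < m \<Longrightarrow> orthonormal n n (a j)" and b: "\<And>j. j < m \<Longrightarrow> orthonormal n n (b j)"
    and sep: "i < m" "n / 16 \<le> sqdist n (a i) (b i)"
  shows "\<exists>j<4 + m. hs n X \<le> 160 * hs n (generator n a j * X - X * generator n b j)"
proof (rule ccontr)
  assume "\<not> ?thesis"
  then have less: "160 * hs n (generator n a j * X - X * generator n b j) < hs n X" if "j < 4 + m" for j
    using that by (meson not_le)
  define c where "c = tr n X / of_nat n"
  define Y where "Y = X - c \<cdot>\<^sub>m 1\<^sub>m n"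
  have Y: "Y \<in> carrier_mat n n" using X by (simp add: Y_def minus_carrier_mat)
  have XY: "X = c \<cdot>\<^sub>m 1\<^sub>m n + Y" using X by (intro eq_matI) (auto simp: Y_def)
  have "tr n Y = tr n X - (\<Sum>i<n. c)"
    unfolding tr_def sum_subtractf[symmetric] by (intro sum.cong) (auto simp: Y_def)
  then have "tr n Y = 0" using \<open>0 < n\<close> by (simp add: c_def)
  then obtain j where j: "j \<in> {1, 2, 3}" "hs n Y \<le> 16 * hs n (generator n a j * Y - Y * generator n b j)"
    using commutator_expansion[OF Y \<open>0 < n\<close>] by blast
  define M where "M = generator n a j"
  have gb: "generator n b j = M" using j(1) by (auto simp: M_def generator_def)
  have M: "M \<in> carrier_mat n n"
    unfolding M_def using j(1) by (intro unitaryD(1) unitary_generator[where a = a and m = m, OF \<open>0 < n\<close> a]) auto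
  have "M * X - X * M = c \<cdot>\<^sub>m (M - M) + (M * Y - Y * M)"
    unfolding XY by (rule commutator_shift[OF M M Y])
  also have "\<dots> = M * Y - Y * M"
    using M Y by (intro eq_matI) (auto simp del: index_mult_mat(1))
  finally have "hs n Y \<le> 16 * hs n (M * X - X * M)" using j(2) unfolding gb M_def[symmetric] by simp
  moreover have "160 * hs n (M * X - X * M) < hs n X"
    using less[of j] j(1) unfolding gb M_def[symmetric] by auto
  ultimately have hY: "10 * hs n Y < hs n X" by linarith
  define V where "V = real_mat n (a i)"
  define W where "W = real_mat n (b i)"
  have V: "unitary n V" and W: "unitary n W" unfolding V_def W_def using a b sep by (auto intro: unitary_real_mat)
  note VW = unitaryD(1)[OF V] unitaryD(1)[OF W]
  have gVW: "160 * hs n (V * X - X * W) < hs n X"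
    using less[of "4 + i"] sep by (simp add: generator_def V_def W_def)
  have "c \<cdot>\<^sub>m (V - W) = (V * X - X * W) + (Y * W - V * Y)"
    using VW X Y commutator_shift[OF VW Y, of c, folded XY]
    by (intro eq_matI) (auto simp del: index_mult_mat(1))
  then have "cmod c * hs n (V - W) \<le> hs n (V * X - X * W) + hs n (Y * W - V * Y)"
    using VW X Y by (subst hs_smult[symmetric]) (auto simp: minus_carrier_mat intro!: hs_add)
  moreover have "hs n (Y * W - V * Y) \<le> 2 * hs n Y"
  proof -
    have "hs n (Y * W - V * Y) \<le> hs n (Y * W) + hs n ((Y * W - V * Y) - Y * W)"
      using VW Y by (intro hs_diff_triangle) (auto simp: minus_carrier_mat)
    also have "(Y * W - V * Y) - Y * W = (- 1) \<cdot>\<^sub>m (V * Y)"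
      using VW Y by (intro eq_matI) (auto simp del: index_mult_mat(1))
    finally show ?thesis using V W VW Y by (simp add: hs_smult hs_unitary_left hs_unitary_right)
  qed
  moreover have "sqrt n / 4 \<le> hs n (V - W)"
  proof (rule power2_le_imp_le)
    show "(sqrt n / 4)\<^sup>2 \<le> (hs n (V - W))\<^sup>2"
      using sep by (simp add: V_def W_def hs_real_mat_diff power_divide)
  qed simp
  then have "cmod c * (sqrt n / 4) \<le> cmod c * hs n (V - W)" by (intro mult_left_mono) auto
  then have "cmod c * sqrt n \<le> 4 * (cmod c * hs n (V - W))" by simp
  moreover have "hs n X \<le> cmod c * sqrt n + hs n Y"
    using hs_add[of "c \<cdot>\<^sub>m 1\<^sub>m n" n Y] Y XY by (simp add: hs_smult hs_one)
  \<comment> \<open>With x, y, q the norms of \<open>X\<close>, \<open>Y\<close> and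
    \<open>V * X - X * W\<close>: x <= 4 (q + 2 y) + y = 4 q + 9 y < (4 / 160 + 9 / 10) x, which is
    absurd. The 10 is 160 / 16.\<close>
  moreover have False if "p \<le> q + z" "z \<le> 2 * y" "r \<le> 4 * p" "x \<le> r + y" "160 * q < x" "10 * y < x" "0 \<le> y"
    for p q r x y z :: real using that by linarith
  ultimately show False using gVW hY hs_nonneg by blast
qed

text \<open>\<open>average_contraction\<close> with \<eta> = 1 / 160 gives the loss (1 / 160)^2 / 4
  in one step, and \<open>word_contraction\<close> iterates it.\<close>

lemma letter_contraction:
  assumes "0 < n" and a: "\<And>j. j < m \<Longrightarrow> orthonormal n n (a j)" and b: "\<And>j. j < m \<Longrightarrow> orthonormal n n (b j)"
    and X: "X \<in> carrier_mat n n"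
    and ab: "a = b \<and> tr n X = 0 \<or> (\<exists>j<m. n / 16 \<le> sqdist n (a j) (b j))"
  shows "hs n (msum n (\<lambda>i. conj_by (word n (4 + m) (generator n a) l i) (word n (4 + m) (generator n b) l i) X) {..<(4 + m) ^ l})
    \<le> (real (4 + m) - (1 / 160)\<^sup>2 / 4) ^ l * hs n X"
proof -
  have ua: "unitary n (generator n a j)" if "j < 4 + m" for j
    using unitary_generator[OF \<open>0 < n\<close> a that] .
  have ub: "unitary n (generator n b j)" if "j < 4 + m" for j
    using unitary_generator[OF \<open>0 < n\<close> b that] .
  \<comment> \<open>For equal letters the action fixes the scalars, so the iteration lives on trace
    zero matrices; for different letters it lives on all matrices. Separation rules out a = b
    because \<open>sqdist n u u\<close> is 0.\<close>
  define P where "P X \<longleftrightarrow> X \<in> carrier_mat n n \<and> (a = b \<longrightarrow> tr n X = 0)" for X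
  have PX: "P X"
    using X ab \<open>0 < n\<close> by (auto simp: P_def sqdist_def)
  have far: "\<exists>j<4 + m. hs n X \<le> 160 * hs n (generator n a j * X - X * generator n b j)" if "P X" for X
  proof (cases "a = b")
    case True
    with commutator_expansion[of X n a b] that \<open>0 < n\<close> obtain j
      where "j \<in> {1, 2, 3}" "hs n X \<le> 16 * hs n (generator n a j * X - X * generator n b j)"
      by (auto simp: P_def)
    moreover from this(2) have "hs n X \<le> 160 * hs n (generator n a j * X - X * generator n b j)"
      using hs_nonneg[of n "generator n a j * X - X * generator n b j"] by linarith
    ultimately show ?thesis by (intro exI[of _ j]) auto
  next
    case False
    with ab obtain i where "i < m" "n / 16 \<le> sqdist n (a i) (b i)" by auto
    with generator_expansion[where a = a and b = b and m = m, OF _ \<open>0 < n\<close> a b] that show ?thesis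
      by (auto simp: P_def)
  qed
  have "0 \<le> real (4 + m) - (1 / 160)\<^sup>2 / 4" by (simp add: power2_eq_square)
  from word_contraction[where P = P and u = "generator n a" and v = "generator n b" and k = "4 + m" and l = l,
      OF ua ub _ _ _ _ this PX]
  show ?thesis
  proof (rule conjunct2)
    show "P (msum n (\<lambda>i. conj_by (generator n a i) (generator n b i) X) {..<4 + m})" if "P X" for X
    proof -
      have "tr n (conj_by (generator n a i) (generator n a i) X) = 0" if "a = b" "i < 4 + m" for i
        using tr_conj_by[OF ua[OF that(2)], of X] that \<open>P X\<close> by (simp add: P_def)
      then show ?thesis by (auto simp: P_def tr_msum)
    qed
    show "hs n (msum n (\<lambda>i. conj_by (generator n a i) (generator n b i) X) {..<4 + m})
      \<le> (real (4 + m) - (1 / 160)\<^sup>2 / 4) * hs n X" if PX: "P X" for X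
    proof -
      obtain j where "j < 4 + m" "(1 / 160) * hs n X \<le> hs n (generator n a j * X - X * generator n b j)"
        using far[OF PX] by auto
      then show ?thesis using PX
        by (intro average_contraction[OF ua ub]) (auto simp: P_def generator_def)
    qed
  qed (auto simp: P_def)
qed

section \<open>Separated tuples of unitaries\<close>

text \<open>The hypotheses make exp (\<theta> m x / 64) at least 2, so going from 32 to 64 in the
  exponent pays for the division by 2.\<close>

lemma powr_half_power_ge_exp:
  fixes \<theta> q x m :: real
  assumes "0 < \<theta>" "64 \<le> \<theta> * m" "1 \<le> x" "exp (m * x / 32) \<le> q"
  shows "exp (\<theta> * m * x / 64) \<le> q powr \<theta> / 2"
proof -
  have "exp 1 \<le> exp (\<theta> * m * x / 64)"
  proof (subst exp_le_cancel_iff)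
    have "64 * 1 \<le> \<theta> * m * x" using assms by (intro mult_mono) auto
    then show "1 \<le> \<theta> * m * x / 64" by simp
  qed
  moreover have "2 \<le> exp (1 :: real)" using exp_ge_add_one_self[of 1] by simp
  ultimately have "2 \<le> exp (\<theta> * m * x / 64)" by linarith
  then have "2 * exp (\<theta> * m * x / 64) \<le> exp (\<theta> * m * x / 64) * exp (\<theta> * m * x / 64)"
    by (intro mult_right_mono) auto
  also have "\<dots> = exp (m * x / 32) powr \<theta>"
    by (simp add: powr_def mult_ac flip: exp_add)
  also have "\<dots> \<le> q powr \<theta>" using assms by (intro powr_mono2) auto
  finally show ?thesis by simp
qed

lemma sum_blocks_le:
  fixes f :: "nat \<Rightarrow> real" and g c :: real
  assumes good: "\<And>b. b < B \<Longrightarrow> \<not> bad b \<Longrightarrow> f b \<le> g" and bad: "\<And>b. b < B \<Longrightarrow> f b \<le> c"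
    and "0 \<le> g" "0 \<le> c"
  shows "(\<Sum>b<B. f b) \<le> B * g + card {b \<in> {..<B}. bad b} * c"
proof -
  have "(\<Sum>b<B. f b) \<le> (\<Sum>b<B. g + (if bad b then c else 0))"
    using assms by (intro sum_mono) (auto simp: add_increasing)
  also have "\<dots> = B * g + card {b \<in> {..<B}. bad b} * c"
    by (simp add: sum.distrib sum.If_cases Int_def)
  finally show ?thesis .
qed

text \<open>The gap of the tensor square, block by block, with \<open>X\<close> in the role of the
  block (s, t). For s = t the scalars are invariant and are excluded by the trace; for s \<noteq> t
  there must be no invariant vectors at all.\<close>

definition separated_tuples :: "nat \<Rightarrow> nat \<Rightarrow> real \<Rightarrow> nat \<Rightarrow> (nat \<Rightarrow> nat \<Rightarrow> complex mat) \<Rightarrow> bool" where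
  "separated_tuples n N \<delta> M U \<longleftrightarrow> (\<forall>t<M. \<forall>i. unitary N (U t i)) \<and>
    (\<forall>s<M. \<forall>t<M. \<forall>X\<in>carrier_mat N N. (s = t \<longrightarrow> tr N X = 0) \<longrightarrow>
      hs N (msum N (\<lambda>i. conj_by (U s i) (U t i) X) {..<n}) \<le> n * \<delta> * hs N X)"

text \<open>All parameters, the block length \<open>K\<close> among them, depend on \<delta> alone,
  which makes the result uniform in \<open>N\<close>. A code word over \<open>Q\<close> becomes a
  tuple by replacing each letter with all words of length \<open>l\<close> in its k
  generators.\<close>

lemma many_separated_tuples:
  fixes \<delta> :: real
  assumes "0 < \<delta>" "\<delta> < 1"
  shows "\<exists>\<beta>>0. \<exists>n0. \<forall>n\<ge>n0. \<forall>N\<ge>1. \<exists>M U.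
    separated_tuples n N \<delta> M U \<and> exp (\<beta> * real n * (real N)\<^sup>2) \<le> real M"
proof -
  \<comment> \<open>The budget is \<delta> = \<theta> + \<theta> + \<delta> / 2: the contraction in
    blocks with different letters, the fraction of blocks with equal letters, and the incomplete
    last block.\<close>
  define \<theta> where "\<theta> = \<delta> / 4"
  \<comment> \<open>So many matrices per letter that q powr \<theta> / 2 is exponentially large even
    for N = 1.\<close>
  define m where "m = nat \<lceil>64 / \<theta>\<rceil>"
  define k where "k = 4 + m"
  \<comment> \<open>The factor k - (1 / 160)^2 / 4 of \<open>letter_contraction\<close>, divided by
    k.\<close>
  define g where "g = 1 - (1 / 160)\<^sup>2 / (4 * real k)"
  have \<theta>: "0 < \<theta>" "\<theta> < 1" using assms by (auto simp: \<theta>_def)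
  have "64 / \<theta> \<le> m" by (simp add: m_def real_nat_ceiling_ge)
  then have m: "64 \<le> \<theta> * m" "0 < m" using \<theta> by (auto simp: field_simps intro: gr0I)
  have k: "0 < k" by (simp add: k_def)
  have g: "0 \<le> g" "g < 1" by (auto simp: g_def k_def power2_eq_square field_simps)
  obtain l where l: "g ^ l < \<theta>" using real_arch_pow_inv[OF \<theta>(1) g(2)] by blast
  define K where "K = k ^ l"
  have K: "0 < K" using k by (simp add: K_def)
  \<comment> \<open>From here on there is at least one full block, and the fewer than
    \<open>K\<close> left-over positions cost at most \<delta> n / 2.\<close>
  define n0 where "n0 = nat \<lceil>2 * K / \<delta>\<rceil> + K"
  \<comment> \<open>The 64 of \<open>powr_half_power_ge_exp\<close>, doubled because n <= 2 B
    K.\<close>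
  define \<beta> where "\<beta> = \<theta> * m / (128 * K)"
  have \<beta>: "0 < \<beta>" using \<theta> m K by (simp add: \<beta>_def)
  have "\<exists>M U. separated_tuples n N \<delta> M U \<and> exp (\<beta> * real n * (real N)\<^sup>2) \<le> real M"
    if n: "n0 \<le> n" and N: "1 \<le> N" for n N
  proof -
    define B where "B = n div K"
    have "2 * K / \<delta> \<le> n0" unfolding n0_def by (simp add: real_nat_ceiling_ge add_increasing2)
    then have nK: "2 * K \<le> \<delta> * n" using n assms(1) by (simp add: field_simps order_trans)
    have "K \<le> n" using n by (simp add: n0_def)
    then have B: "0 < B" "B * K \<le> n" using K by (auto simp: B_def div_greater_zero_iff)
    have nB: "n < (B + 1) * K" using K by (simp add: B_def dividend_less_div_times)
    obtain P where P: "finite P" "exp ((real N)\<^sup>2 / 32) \<le> card P" "\<And>v. v \<in> P \<Longrightarrow> orthonormal N N v"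
      "\<And>u v. u \<in> P \<Longrightarrow> v \<in> P \<Longrightarrow> u \<noteq> v \<Longrightarrow> N / 16 \<le> sqdist N u v"
      using orthogonal_packing[of N] N by auto
    define Q where "Q = ({..<m} \<rightarrow>\<^sub>E P)"
    have Q: "finite Q" using P by (auto simp: Q_def intro: finite_PiE)
    have "exp (m * (real N)\<^sup>2 / 32) = exp ((real N)\<^sup>2 / 32) ^ m" by (simp flip: exp_of_nat_mult)
    also have "\<dots> \<le> real (card P) ^ m" using P by (intro power_mono) auto
    finally have q: "exp (m * (real N)\<^sup>2 / 32) \<le> card Q" by (simp add: Q_def card_funcsetE)
    then have "Q \<noteq> {}" by (auto simp: not_le)
    from gilbert_varshamov[OF Q this \<theta>(2) B(1)] obtain C where C: "C \<subseteq> {..<B} \<rightarrow>\<^sub>E Q"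
      "\<And>x y. x \<in> C \<Longrightarrow> y \<in> C \<Longrightarrow> x \<noteq> y \<Longrightarrow> card {b \<in> {..<B}. x b = y b} \<le> \<theta> * B"
      "(card Q powr \<theta> / 2) ^ B \<le> card C" by blast
    have "finite C" using C(1) Q by (auto intro: finite_subset finite_PiE)
    then obtain e where e: "bij_betw e {..<card C} C" using ex_bij_betw_nat_finite[of C] by (auto simp: atLeast0LessThan)
    have eC: "e t \<in> C" if "t < card C" for t using e that by (auto simp: bij_betw_def)
    have letter: "e t b \<in> Q" if "t < card C" "b < B" for t b using eC[OF that(1)] that(2) C(1) by blast
    have orth: "orthonormal N N (e t b j)" if "t < card C" "b < B" "j < m" for t b j
      using letter[OF that(1,2)] that(3) P(3) by (auto simp: Q_def)
    define w where "w t b i = word N k (generator N (e t b)) l i" for t b i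
    \<comment> \<open>Positions from B * K on are padded with the identity and estimated
      trivially.\<close>
    define U where "U t i = (if i < B * K \<and> t < card C then w t (i div K) (i mod K) else 1\<^sub>m N)" for t i
    have uw: "unitary N (w t b i)" if "t < card C" "b < B" for t b i
      unfolding w_def using N orth[OF that] k
      by (intro unitary_word unitary_generator[where m = m]) (auto simp: k_def)
    have uU: "unitary N (U t i)" for t i
      using uw[of t "i div K"] by (auto simp: U_def less_mult_imp_div_less)
    show ?thesis
      unfolding separated_tuples_def
    proof (intro exI conjI allI impI ballI)
      show "unitary N (U t i)" for t i by (rule uU)
    next
      fix s t X
      assume st: "s < card C" "t < card C" and X: "X \<in> carrier_mat N N" and tr: "s = t \<longrightarrow> tr N X = 0"
      define blk where "blk b = msum N (\<lambda>i. conj_by (w s b i) (w t b i) X) {..<K}" for b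
      let ?h = "hs N X"
      have blk_le: "hs N (blk b) \<le> K * ?h" if "b < B" for b
      proof -
        have "hs N (blk b) \<le> (\<Sum>i<K. hs N (conj_by (w s b i) (w t b i) X))"
          unfolding blk_def using uw st that X by (intro hs_msum) (auto simp: unitaryD(1))
        also have "\<dots> = K * ?h" using uw st that X by (simp add: hs_conj_by)
        finally show ?thesis .
      qed
      have blk_good: "hs N (blk b) \<le> K * \<theta> * ?h" if b: "b < B" and st_b: "s = t \<or> e s b \<noteq> e t b" for b
      proof -
        have sep: "e s b = e t b \<and> tr N X = 0 \<or> (\<exists>j<m. N / 16 \<le> sqdist N (e s b j) (e t b j))"
        proof (cases "s = t")
          case False
          with st_b have "e s b \<noteq> e t b" by simp
          moreover have "e s b \<in> {..<m} \<rightarrow>\<^sub>E P" "e t b \<in> {..<m} \<rightarrow>\<^sub>E P" using letter st b by (auto simp: Q_def)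
          ultimately obtain j where "j < m" "e s b j \<noteq> e t b j" "e s b j \<in> P" "e t b j \<in> P"
            by (metis PiE_ext PiE_mem lessThan_iff)
          with P(4) show ?thesis by blast
        qed (use tr in simp)
        have "hs N (blk b) \<le> (real k - (1 / 160)\<^sup>2 / 4) ^ l * ?h"
          unfolding blk_def w_def K_def k_def
          using N orth[OF st(1) b] orth[OF st(2) b] X sep by (intro letter_contraction) auto
        also have "real k - (1 / 160)\<^sup>2 / 4 = real k * g" using k by (simp add: g_def right_diff_distrib)
        also have "(real k * g) ^ l * ?h = K * g ^ l * ?h" by (simp add: power_mult_distrib K_def)
        also have "\<dots> \<le> K * \<theta> * ?h" using l by (intro mult_right_mono mult_left_mono) auto
        finally show ?thesis .
      qed
      let ?V = "\<lambda>i. conj_by (U s i) (U t i) X"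
      have V: "?V i \<in> carrier_mat N N" "hs N (?V i) = ?h" for i using uU X by (auto simp: unitaryD(1) hs_conj_by)
      have split: "{..<n} = {..<B * K} \<union> {B * K..<n}" using B(2) by auto
      have "msum N ?V {..<n} = msum N ?V {..<B * K} + msum N ?V {B * K..<n}"
        unfolding split by (rule msum_union) auto
      then have "hs N (msum N ?V {..<n}) \<le> hs N (msum N ?V {..<B * K}) + hs N (msum N ?V {B * K..<n})"
        using hs_add[of "msum N ?V {..<B * K}" N "msum N ?V {B * K..<n}"] by simp
      also have "msum N ?V {..<B * K} = msum N (\<lambda>i. conj_by (w s (i div K) (i mod K)) (w t (i div K) (i mod K)) X) {..<B * K}"
        using st by (intro msum_cong) (auto simp: U_def)
      also have "\<dots> = msum N blk {..<B}"
        unfolding blk_def by (rule msum_div_mod[of N "\<lambda>b i. conj_by (w s b i) (w t b i) X"])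
      also have "hs N (msum N blk {..<B}) \<le> (\<Sum>b<B. hs N (blk b))"
        by (intro hs_msum) (auto simp: blk_def)
      also have "\<dots> \<le> B * (K * \<theta> * ?h) + card {b \<in> {..<B}. s \<noteq> t \<and> e s b = e t b} * (K * ?h)"
        using blk_le blk_good \<theta> by (intro sum_blocks_le) auto
      also have "\<dots> \<le> B * (K * \<theta> * ?h) + \<theta> * B * (K * ?h)"
      proof (intro add_left_mono mult_right_mono)
        show "card {b \<in> {..<B}. s \<noteq> t \<and> e s b = e t b} \<le> \<theta> * B"
        proof (cases "s = t")
          case True
          then show ?thesis using \<theta> by simp
        next
          case False
          then have "e s \<noteq> e t" using e st by (auto simp: bij_betw_def dest: inj_onD)
          with C(2)[OF eC[OF st(1)] eC[OF st(2)]] False show ?thesis by simp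
        qed
      qed simp
      also have "hs N (msum N ?V {B * K..<n}) \<le> (\<Sum>i\<in>{B * K..<n}. hs N (?V i))"
        using V by (intro hs_msum) auto
      also have "\<dots> = real (n - B * K) * ?h" by (simp add: V)
      also have "\<dots> \<le> K * ?h" using nB by (intro mult_right_mono) auto
      finally have "hs N (msum N ?V {..<n}) \<le> (2 * \<theta> * (B * K) + K) * ?h"
        by (simp add: algebra_simps)
      also have "\<dots> \<le> (n * \<delta>) * ?h"
      proof (intro mult_right_mono)
        have "2 * \<theta> * (real B * real K) \<le> 2 * \<theta> * n"
          using B(2) \<theta> by (intro mult_left_mono) (auto simp flip: of_nat_mult)
        then show "2 * \<theta> * (B * K) + K \<le> n * \<delta>" using nK by (simp add: \<theta>_def algebra_simps)
      qed simp
      finally show "hs N (msum N ?V {..<n}) \<le> n * \<delta> * ?h" .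
    next
      have "1 * K \<le> B * K" using B(1) by (intro mult_le_mono1) simp
      then have "n \<le> 2 * (B * K)" using nB unfolding distrib_right by linarith
      then have "real n \<le> real (2 * (B * K))" by (simp only: of_nat_le_iff)
      then have "\<beta> * n * (real N)\<^sup>2 \<le> \<beta> * real (2 * (B * K)) * (real N)\<^sup>2"
        using \<beta> by (intro mult_right_mono mult_left_mono) auto
      also have "\<dots> = B * (\<theta> * m * (real N)\<^sup>2 / 64)" using K by (simp add: \<beta>_def)
      finally have "exp (\<beta> * n * (real N)\<^sup>2) \<le> exp (\<theta> * m * (real N)\<^sup>2 / 64) ^ B"
        by (simp flip: exp_of_nat_mult)
      also have "\<dots> \<le> (card Q powr \<theta> / 2) ^ B"
        using \<theta> m N q by (intro power_mono powr_half_power_ge_exp) auto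
      also have "\<dots> \<le> card C" by (rule C(3))
      finally show "exp (\<beta> * n * (real N)\<^sup>2) \<le> card C" .
    qed
  qed
  with \<beta> show ?thesis by blast
qed

section \<open>The group generated by a family of tuples\<close>

lemma mult_unitary_group [simp]: "A \<otimes>\<^bsub>unitary_group n\<^esub> B = A * B"
  and one_unitary_group [simp]: "\<one>\<^bsub>unitary_group n\<^esub> = 1\<^sub>m n"
  by (simp_all add: unitary_group_def)

lemma group_unitary_group: "group (unitary_group n)"
proof (rule groupI)
  fix A B C assume "unitary n A" "unitary n B" "unitary n C"
  then show "A \<otimes>\<^bsub>unitary_group n\<^esub> B \<otimes>\<^bsub>unitary_group n\<^esub> C = A \<otimes>\<^bsub>unitary_group n\<^esub> (B \<otimes>\<^bsub>unitary_group n\<^esub> C)"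
    using unitaryD(1)[where n = n] by (simp add: assoc_mult_mat[of A n n B n C n])
next
  fix A assume A: "unitary n A"
  then show "\<exists>B\<in>carrier (unitary_group n). B \<otimes>\<^bsub>unitary_group n\<^esub> A = \<one>\<^bsub>unitary_group n\<^esub>"
    by (intro bexI[of _ "mat_adjoint A"]) (auto simp: unitaryD intro: unitary_adjoint)
qed (auto simp: unitary_mult unitaryD)

text \<open>Every element is a finite product over the countable set of generators and their
  inverses. Countability allows the group to be realised on the natural numbers.\<close>

lemma (in group) countable_generate:
  assumes "countable A" "A \<subseteq> carrier G"
  shows "countable (generate G A)"
proof -
  let ?B = "A \<union> m_inv G ` A" and ?p = "\<lambda>ws. foldr (\<otimes>) ws \<one>"
  have closed: "?p ws \<in> carrier G" if "ws \<in> lists ?B" for ws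
    using that assms by (induction ws) auto
  have append: "?p (vs @ ws) = ?p vs \<otimes> ?p ws" if "vs \<in> lists ?B" "ws \<in> lists ?B" for vs ws
    using that(1)
  proof (induction vs)
    case (Cons v vs)
    then have "v \<in> carrier G" "?p vs \<in> carrier G" using assms closed by auto
    then show ?case using Cons closed[OF that(2)] by (simp add: m_assoc)
  qed (use closed[OF that(2)] in simp)
  have "generate G A \<subseteq> ?p ` lists ?B"
  proof
    fix g assume "g \<in> generate G A"
    then show "g \<in> ?p ` lists ?B"
    proof (induction rule: generate.induct)
      case one
      show ?case by (rule image_eqI[of _ _ "[]"]) auto
    next
      case (incl h)
      then show ?case using assms by (intro image_eqI[of _ _ "[h]"]) auto
    next
      case (inv h)
      then show ?case using assms by (intro image_eqI[of _ _ "[inv h]"]) auto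
    next
      case (eng g h)
      then obtain vs ws where "g = ?p vs" "vs \<in> lists ?B" "h = ?p ws" "ws \<in> lists ?B" by blast
      then show ?case using append[of vs ws] by (intro image_eqI[of _ _ "vs @ ws"]) auto
    qed
  qed
  moreover have "countable (?p ` lists ?B)" using assms by auto
  ultimately show ?thesis by (rule countable_subset)
qed

text \<open>The integer factor only keeps the generators apart when some of the tuples \<open>U _ i\<close> coincide.\<close>

lemma group_of_unitary_tuples:
  fixes U :: "nat \<Rightarrow> nat \<Rightarrow> complex mat"
  assumes U: "\<And>t i. t < M \<Longrightarrow> unitary N (U t i)"
  obtains G :: "nat monoid" and s :: "nat \<Rightarrow> nat" and \<rho> :: "nat \<Rightarrow> nat \<Rightarrow> complex mat"
  where "group G" "inj_on s {..<n}" "s ` {..<n} \<subseteq> carrier G" "generate G (s ` {..<n}) = carrier G"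
    "\<And>t. t < M \<Longrightarrow> \<rho> t \<in> hom G (unitary_group N)" "\<And>t i. t < M \<Longrightarrow> i < n \<Longrightarrow> \<rho> t (s i) = U t i"
proof -
  define P where "P = product_group {..<M} (\<lambda>_. unitary_group N) \<times>\<times> integer_group"
  interpret P: group P
    unfolding P_def by (intro DirProd_group product_group group_unitary_group group_integer_group)
  define u where "u i = (\<lambda>t\<in>{..<M}. U t i, int i)" for i
  define H where "H = generate P (u ` {..<n})"
  have u: "u ` {..<n} \<subseteq> carrier P" using U by (auto simp: u_def P_def)
  have H: "subgroup H P" unfolding H_def by (rule P.generate_is_subgroup[OF u])
  interpret Q: group "P\<lparr>carrier := H\<rparr>" by (rule P.subgroup_imp_group[OF H])
  have uH: "u ` {..<n} \<subseteq> H" unfolding H_def by (auto intro: generate.incl)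
  \<comment> \<open>The product of unitary groups may be uncountable, but its finitely generated
    subgroup \<open>H\<close> is not, so it can be copied to a \<open>nat monoid\<close>.\<close>
  have "countable H" unfolding H_def by (rule P.countable_generate[OF _ u]) auto
  then obtain f :: "_ \<Rightarrow> nat" where f: "inj_on f H" by (auto simp: countable_def)
  define G where "G = image_group f (P\<lparr>carrier := H\<rparr>)"
  have iso: "f \<in> iso (P\<lparr>carrier := H\<rparr>) G"
    unfolding G_def by (rule inj_imp_image_group_iso) (simp add: f)
  have G: "group G"
    unfolding G_def by (rule Q.inj_imp_image_group_is_group) (simp add: f)
  interpret f: group_hom "P\<lparr>carrier := H\<rparr>" G f
    using iso G by (intro group_hom.intro group_hom_axioms.intro Q.group_axioms) (auto simp: iso_def)
  have carrier: "carrier G = f ` H" by (simp add: G_def image_group_carrier)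
  \<comment> \<open>A coordinate projection, read through the inverse of the copy map
    \<open>f\<close>.\<close>
  define \<rho> where "\<rho> t x = fst (inv_into H f x) t" for t x
  have \<rho>: "\<rho> t (f a) = fst a t" if "a \<in> H" for t a using that f by (simp add: \<rho>_def)
  show ?thesis
  proof (rule that[of G "f \<circ> u" \<rho>])
    show "group G" by (rule G)
    have "inj_on u {..<n}" by (auto simp: inj_on_def u_def)
    then show "inj_on (f \<circ> u) {..<n}" using f uH by (intro comp_inj_on) (auto intro: inj_on_subset)
    show "(f \<circ> u) ` {..<n} \<subseteq> carrier G" using uH carrier by auto
    have "generate G (f ` u ` {..<n}) = f ` generate (P\<lparr>carrier := H\<rparr>) (u ` {..<n})"
      by (rule f.generate_img) (simp add: uH)
    also have "generate (P\<lparr>carrier := H\<rparr>) (u ` {..<n}) = H"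
      unfolding P.generate_consistent[OF uH H] by (simp add: H_def)
    finally show "generate G ((f \<circ> u) ` {..<n}) = carrier G" by (simp add: carrier image_comp)
    show "\<rho> t (( f \<circ> u) i) = U t i" if "t < M" "i < n" for t i
      using \<rho>[of "u i" t] uH that by (auto simp: u_def)
    show "\<rho> t \<in> hom G (unitary_group N)" if t: "t < M" for t
    proof (rule homI)
      have HP: "H \<subseteq> carrier P" using H by (rule subgroup.subset)
      fix x y assume "x \<in> carrier G" "y \<in> carrier G"
      then obtain a b where ab: "a \<in> H" "x = f a" "b \<in> H" "y = f b" unfolding carrier by auto
      have "a \<in> carrier P" using ab HP by blast
      then have "fst a \<in> (\<Pi>\<^sub>E t\<in>{..<M}. carrier (unitary_group N))" by (simp add: P_def mem_Times_iff)
      then show "unitary N (\<rho> t x)" using ab \<rho> t by auto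
      have "x \<otimes>\<^bsub>G\<^esub> y = f (a \<otimes>\<^bsub>P\<^esub> b)" using f.hom_mult[of a b] ab by simp
      moreover have "a \<otimes>\<^bsub>P\<^esub> b \<in> H" using H ab by (simp add: subgroup.m_closed)
      moreover have "fst (a \<otimes>\<^bsub>P\<^esub> b) t = fst a t * fst b t"
        using t by (simp add: P_def DirProd_def case_prod_unfold)
      ultimately show "\<rho> t (x \<otimes>\<^bsub>G\<^esub> y) = \<rho> t x \<otimes>\<^bsub>unitary_group N\<^esub> \<rho> t y"
        using ab \<rho> by simp
    qed
  qed
qed

section \<open>Irreducibility and inequivalence from the spectral gap\<close>

lemma mat_eq_by_vec:
  fixes A B :: "complex mat"
  assumes A: "A \<in> carrier_mat n m" and B: "B \<in> carrier_mat n m"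
    and eq: "\<And>v. v \<in> carrier_vec m \<Longrightarrow> A *\<^sub>v v = B *\<^sub>v v"
  shows "A = B"
proof (rule eq_matI)
  fix i j assume "i < dim_row B" "j < dim_col B"
  then have ij: "i < n" "j < m" using B by auto
  have "(A *\<^sub>v unit_vec m j) $ i = (B *\<^sub>v unit_vec m j) $ i" by (simp add: eq)
  then show "A $$ (i, j) = B $$ (i, j)" using A B ij by simp
qed (use A B in auto)

text \<open>The range is only required to lie inside \<open>W\<close>, so that projections can be
  enlarged one dimension at a time.\<close>

definition projection_into :: "nat \<Rightarrow> complex vec set \<Rightarrow> complex mat \<Rightarrow> bool" where
  "projection_into n W P \<longleftrightarrow> P \<in> carrier_mat n n \<and> mat_adjoint P = P \<and> P * P = P \<and>
    (\<forall>v\<in>carrier_vec n. P *\<^sub>v v \<in> W)"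

lemma tr_projection:
  assumes "P \<in> carrier_mat n n" "mat_adjoint P = P" "P * P = P"
  shows "tr n P = complex_of_real ((hs n P)\<^sup>2)"
  using hs_power2_columns[OF assms(1)] assms by (simp add: tr_def)

text \<open>1 - P is a projection too, so its trace n - tr P is a squared norm.\<close>

lemma tr_projection_le:
  assumes P: "P \<in> carrier_mat n n" "mat_adjoint P = P" "P * P = P"
  shows "(hs n P)\<^sup>2 \<le> n"
proof -
  define Q where "Q = 1\<^sub>m n - P"
  have Q: "Q \<in> carrier_mat n n" using P by (simp add: Q_def minus_carrier_mat)
  have "mat_adjoint Q $$ (i, j) = Q $$ (i, j)" if "i < n" "j < n" for i j
  proof -
    have "cnj (P $$ (j, i)) = P $$ (i, j)"
      using mat_adjoint_index[of i P j] P that by simp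
    then show ?thesis using P that by (auto simp: Q_def)
  qed
  then have "mat_adjoint Q = Q" using Q by (intro eq_matI) auto
  moreover have "Q * Q = Q"
  proof -
    have "Q * Q = 1\<^sub>m n * Q - P * Q"
      using P Q by (subst (1) Q_def) (rule minus_mult_distrib_mat[of _ n n _ _ n]; simp)
    also have "P * Q = P * 1\<^sub>m n - P * P"
      using P unfolding Q_def by (intro mult_minus_distrib_mat[of _ n n _ n]) auto
    also have "\<dots> = 0\<^sub>m n n" using P by (simp add: minus_r_inv_mat)
    also have "1\<^sub>m n * Q - 0\<^sub>m n n = Q" using Q by (intro eq_matI) auto
    finally show ?thesis .
  qed
  ultimately have "tr n Q = complex_of_real ((hs n Q)\<^sup>2)" using Q by (rule tr_projection[rotated 1])
  moreover have "tr n Q = of_nat n - tr n P"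
  proof -
    have "tr n Q = (\<Sum>i<n. 1 - P $$ (i, i))" unfolding tr_def using P by (intro sum.cong) (auto simp: Q_def)
    then show ?thesis by (simp add: tr_def sum_subtractf)
  qed
  ultimately have "complex_of_real (real n) = complex_of_real ((hs n Q)\<^sup>2 + (hs n P)\<^sup>2)"
    using tr_projection[OF P] by (simp add: algebra_simps)
  then have "real n = (hs n Q)\<^sup>2 + (hs n P)\<^sup>2" unfolding of_real_eq_iff .
  then show ?thesis by simp
qed

text \<open>u = w - P w lies in \<open>W\<close>, is nonzero and is killed by \<open>P\<close>;
  adding the rank one projection \<open>Q\<close> onto \<open>u\<close> raises the trace by
  1.\<close>

lemma projection_extend:
  assumes P: "projection_into n W P"
    and W: "W \<subseteq> carrier_vec n" "\<And>v w. v \<in> W \<Longrightarrow> w \<in> W \<Longrightarrow> v + w \<in> W" "\<And>c v. v \<in> W \<Longrightarrow> c \<cdot>\<^sub>v v \<in> W"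
    and w: "w \<in> W" "P *\<^sub>v w \<noteq> w"
  shows "\<exists>P'. projection_into n W P' \<and> tr n P' = tr n P + 1"
proof -
  note P' = P[unfolded projection_into_def]
  have Pc: "P \<in> carrier_mat n n" and PP: "P * P = P" and Pa: "mat_adjoint P = P" using P' by auto
  have wc: "w \<in> carrier_vec n" using w W by auto
  have Pw: "P *\<^sub>v w \<in> W" "P *\<^sub>v w \<in> carrier_vec n" using P' wc W by auto
  define u where "u = w + (- 1) \<cdot>\<^sub>v (P *\<^sub>v w)"
  have uW: "u \<in> W" unfolding u_def using W w Pw by auto
  have uc: "u \<in> carrier_vec n" using uW W by auto
  have "P *\<^sub>v u = P *\<^sub>v w + (- 1) \<cdot>\<^sub>v (P *\<^sub>v (P *\<^sub>v w))"
    unfolding u_def using Pc wc Pw by (simp add: mult_add_distrib_mat_vec[of _ n n] mult_mat_vec[of _ n n])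
  also have "P *\<^sub>v (P *\<^sub>v w) = P *\<^sub>v w" using Pc wc PP by (metis assoc_mult_mat_vec)
  also have "P *\<^sub>v w + (- 1) \<cdot>\<^sub>v (P *\<^sub>v w) = 0\<^sub>v n"
  proof -
    have "x + (- 1) \<cdot>\<^sub>v x = 0\<^sub>v n" if "x \<in> carrier_vec n" for x :: "complex vec"
      using that by (intro eq_vecI) auto
    then show ?thesis using Pw(2) .
  qed
  finally have Pu: "P *\<^sub>v u = 0\<^sub>v n" .
  define s where "s = (\<Sum>i<n. (cmod (u $ i))\<^sup>2)"
  have "\<exists>i<n. u $ i \<noteq> 0"
  proof (rule ccontr)
    assume "\<not> ?thesis"
    then have z: "u $ i = 0" if "i < n" for i using that by blast
    have "P *\<^sub>v w = w"
    proof (rule eq_vecI)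
      fix i assume "i < dim_vec w"
      then have "i < n" using wc by auto
      then show "(P *\<^sub>v w) $ i = w $ i" using z[of i] wc Pw Pc by (simp add: u_def)
    qed (use wc Pw Pc in auto)
    with w show False by simp
  qed
  then have s: "0 < s" unfolding s_def by (auto intro!: sum_pos2)
  define Q where "Q = mat n n (\<lambda>(i, j). u $ i * cnj (u $ j) / s)"
  have Qc: "Q \<in> carrier_mat n n" by (simp add: Q_def)
  have Qa: "mat_adjoint Q = Q" by (rule eq_matI) (auto simp: Q_def)
  have cs: "(\<Sum>k<n. u $ k * cnj (u $ k)) = complex_of_real s"
    unfolding s_def of_real_sum complex_norm_square ..
  have QQ: "Q * Q = Q"
  proof (rule eq_matI)
    fix i j assume "i < dim_row Q" "j < dim_col Q"
    then have ij: "i < n" "j < n" using Qc by auto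
    have "(Q * Q) $$ (i, j) = (\<Sum>k<n. u $ i * cnj (u $ j) / s / s * (u $ k * cnj (u $ k)))"
      using ij by (subst index_mult_sum[OF Qc Qc]) (auto simp: Q_def intro!: sum.cong)
    also have "\<dots> = u $ i * cnj (u $ j) / s / s * complex_of_real s"
      unfolding sum_distrib_left[symmetric] cs by simp
    also have "\<dots> = Q $$ (i, j)" using s ij by (simp add: Q_def)
    finally show "(Q * Q) $$ (i, j) = Q $$ (i, j)" .
  qed (use Qc in auto)
  have PQ: "P * Q = 0\<^sub>m n n"
  proof (rule eq_matI)
    fix i j assume "i < dim_row (0\<^sub>m n n)" "j < dim_col (0\<^sub>m n n)"
    then have ij: "i < n" "j < n" by auto
    have "(\<Sum>k<n. P $$ (i, k) * u $ k) = (P *\<^sub>v u) $ i"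
      using ij Pc uc by (auto simp: scalar_prod_def atLeast0LessThan intro!: sum.cong)
    then have Pu0: "(\<Sum>k<n. P $$ (i, k) * u $ k) = 0" using Pu ij by simp
    have "(P * Q) $$ (i, j) = (\<Sum>k<n. P $$ (i, k) * u $ k * (cnj (u $ j) / s))"
      using ij by (subst index_mult_sum[OF Pc Qc]) (auto simp: Q_def intro!: sum.cong)
    also have "\<dots> = 0" unfolding sum_distrib_right[symmetric] Pu0 by simp
    finally show "(P * Q) $$ (i, j) = 0\<^sub>m n n $$ (i, j)" using ij by simp
  qed (use Pc Qc in auto)
  have QP: "Q * P = 0\<^sub>m n n"
  proof -
    have "Q * P = mat_adjoint (P * Q)" using mat_adjoint_mult[OF Pc Qc] Pa Qa by simp
    also have "\<dots> = 0\<^sub>m n n" unfolding PQ by (rule eq_matI) auto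
    finally show ?thesis .
  qed
  have "projection_into n W (P + Q)"
    unfolding projection_into_def
  proof (intro conjI ballI)
    show "P + Q \<in> carrier_mat n n" using Pc Qc by simp
    show "mat_adjoint (P + Q) = P + Q"
    proof (rule eq_matI)
      fix i j assume "i < dim_row (P + Q)" "j < dim_col (P + Q)"
      then have ij: "i < n" "j < n" using Qc by auto
      have "mat_adjoint P $$ (i, j) = P $$ (i, j)" "mat_adjoint Q $$ (i, j) = Q $$ (i, j)" using Pa Qa by simp_all
      then show "mat_adjoint (P + Q) $$ (i, j) = (P + Q) $$ (i, j)" using ij Pc Qc by simp
    qed (use Pc Qc in auto)
    have "(P + Q) * (P + Q) = P * (P + Q) + Q * (P + Q)"
      using Pc Qc by (intro add_mult_distrib_mat[of _ n n _ _ n]) auto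
    also have "P * (P + Q) = P * P + P * Q" using Pc Qc by (intro mult_add_distrib_mat[of _ n n _ n]) auto
    also have "Q * (P + Q) = Q * P + Q * Q" using Pc Qc by (intro mult_add_distrib_mat[of _ n n _ n]) auto
    finally show "(P + Q) * (P + Q) = P + Q" using PP QQ PQ QP Pc Qc by simp
    fix v :: "complex vec" assume v: "v \<in> carrier_vec n"
    have "Q *\<^sub>v v = ((\<Sum>j<n. cnj (u $ j) * v $ j) / s) \<cdot>\<^sub>v u"
    proof (rule eq_vecI)
      fix i assume "i < dim_vec (((\<Sum>j<n. cnj (u $ j) * v $ j) / s) \<cdot>\<^sub>v u)"
      then have i: "i < n" using uc by auto
      have "(Q *\<^sub>v v) $ i = (\<Sum>j<n. Q $$ (i, j) * v $ j)"
        using i Qc v by (auto simp: scalar_prod_def atLeast0LessThan intro!: sum.cong)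
      also have "\<dots> = (\<Sum>j<n. (cnj (u $ j) * v $ j) * (u $ i / s))"
        using i by (intro sum.cong) (auto simp: Q_def)
      also have "\<dots> = (((\<Sum>j<n. cnj (u $ j) * v $ j) / s) \<cdot>\<^sub>v u) $ i"
        unfolding sum_distrib_right[symmetric] using i uc by simp
      finally show "(Q *\<^sub>v v) $ i = (((\<Sum>j<n. cnj (u $ j) * v $ j) / s) \<cdot>\<^sub>v u) $ i" .
    qed (use Qc uc in auto)
    then have "Q *\<^sub>v v \<in> W" using W uW by simp
    moreover have "P *\<^sub>v v \<in> W" using P' v by blast
    moreover have "(P + Q) *\<^sub>v v = P *\<^sub>v v + Q *\<^sub>v v" using Pc Qc v by (rule add_mult_distrib_mat_vec)
    ultimately show "(P + Q) *\<^sub>v v \<in> W" using W by simp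
  qed
  moreover have "tr n (P + Q) = tr n P + 1"
  proof -
    have "tr n (P + Q) = tr n P + (\<Sum>i<n. u $ i * cnj (u $ i) / s)"
      unfolding tr_def sum.distrib[symmetric] using Pc Qc by (intro sum.cong) (auto simp: Q_def)
    also have "(\<Sum>i<n. u $ i * cnj (u $ i) / s) = 1"
      unfolding sum_divide_distrib[symmetric] cs using s by simp
    finally show ?thesis .
  qed
  ultimately show ?thesis by blast
qed

text \<open>The trace of a projection measures its rank. If no projection into \<open>W\<close>
  fixed all of \<open>W\<close>, repeated extension would reach trace n + 1, contrary to
  \<open>tr_projection_le\<close>.\<close>

lemma orthogonal_projection_exists:
  assumes W: "W \<subseteq> carrier_vec n" "0\<^sub>v n \<in> W" "\<And>v w. v \<in> W \<Longrightarrow> w \<in> W \<Longrightarrow> v + w \<in> W"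
    "\<And>c v. v \<in> W \<Longrightarrow> c \<cdot>\<^sub>v v \<in> W"
  shows "\<exists>P. projection_into n W P \<and> (\<forall>w\<in>W. P *\<^sub>v w = w)"
proof (rule ccontr)
  assume "\<not> ?thesis"
  then have none: "\<exists>w\<in>W. P *\<^sub>v w \<noteq> w" if "projection_into n W P" for P using that by blast
  have "\<exists>P. projection_into n W P \<and> tr n P = of_nat k" for k
  proof (induction k)
    case 0
    have "0\<^sub>m n n *\<^sub>v v = 0\<^sub>v n" if "v \<in> carrier_vec n" for v :: "complex vec"
      using that by (intro eq_vecI) (auto simp: scalar_prod_def)
    moreover have "mat_adjoint (0\<^sub>m n n) = (0\<^sub>m n n :: complex mat)" by (rule eq_matI) auto
    ultimately have "projection_into n W (0\<^sub>m n n)"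
      unfolding projection_into_def using W(2) by auto
    then show ?case by (intro exI[of _ "0\<^sub>m n n"]) (simp add: tr_def)
  next
    case (Suc k)
    then obtain P where P: "projection_into n W P" "tr n P = of_nat k" by blast
    with none obtain w where "w \<in> W" "P *\<^sub>v w \<noteq> w" by blast
    from projection_extend[OF P(1) W(1,3,4) this] P(2) show ?case by (simp add: add.commute)
  qed
  then obtain P where P: "projection_into n W P" "tr n P = of_nat (n + 1)" by blast
  note P1 = P(1)[unfolded projection_into_def]
  have "complex_of_real ((hs n P)\<^sup>2) = complex_of_real (real (n + 1))"
    using tr_projection[of P n] P1 P(2) by simp
  then have "(hs n P)\<^sup>2 = real (n + 1)" unfolding of_real_eq_iff .
  moreover have "(hs n P)\<^sup>2 \<le> n" using tr_projection_le[of P n] P1 by simp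
  ultimately show False by simp
qed

text \<open>The sum is n X, so the gap says |X| <= \<delta> |X| with \<delta> < 1.\<close>

lemma intertwiner_eq_0:
  assumes X: "X \<in> carrier_mat N N" and "0 < n" "\<delta> < 1"
    and fixed: "\<And>i. i < n \<Longrightarrow> conj_by (U i) (V i) X = X"
    and gap: "hs N (msum N (\<lambda>i. conj_by (U i) (V i) X) {..<n}) \<le> real n * \<delta> * hs N X"
  shows "X = 0\<^sub>m N N"
proof (rule hs_eq_0[OF X])
  have "msum N (\<lambda>i. conj_by (U i) (V i) X) {..<n} = of_nat n \<cdot>\<^sub>m X"
    using X fixed by (intro eq_matI) (auto simp: msum_def)
  then have "real n * hs N X \<le> real n * (\<delta> * hs N X)" using gap X by (simp add: hs_smult mult.assoc)
  then have "hs N X \<le> \<delta> * hs N X" using \<open>0 < n\<close> by simp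
  then have "0 \<le> (\<delta> - 1) * hs N X" by (simp add: algebra_simps)
  then show "hs N X = 0" using \<open>\<delta> < 1\<close> hs_nonneg[of N X] by (simp add: zero_le_mult_iff)
qed

lemma unitary_rep_inv:
  assumes G: "group G" and \<rho>: "unitary_rep G n \<rho>" and g: "g \<in> carrier G"
  shows "\<rho> (inv\<^bsub>G\<^esub> g) = mat_adjoint (\<rho> g)"
proof -
  interpret group_hom G "unitary_group n" \<rho>
    using G \<rho> group_unitary_group by (simp add: group_hom_def group_hom_axioms_def unitary_rep_def)
  have u: "unitary n (\<rho> g)" "unitary n (\<rho> (inv\<^bsub>G\<^esub> g))" using g by auto
  have "\<rho> (inv\<^bsub>G\<^esub> g) * \<rho> g = \<rho> (inv\<^bsub>G\<^esub> g \<otimes>\<^bsub>G\<^esub> g)"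
    using hom_mult[OF G.inv_closed[OF g] g] by (simp only: mult_unitary_group)
  also have "\<dots> = 1\<^sub>m n" unfolding G.l_inv[OF g] using hom_one by simp
  finally have "\<rho> (inv\<^bsub>G\<^esub> g) * \<rho> g * mat_adjoint (\<rho> g) = 1\<^sub>m n * mat_adjoint (\<rho> g)" by simp
  then show ?thesis
    using unitaryD[OF u(1)] unitaryD[OF u(2)] by (simp add: assoc_mult_mat[of _ n n _ n _ n])
qed

text \<open>The orthogonal projection \<open>P\<close> onto an invariant subspace commutes with the
  representation. Hence P - (tr P / N) 1 is a fixed point of trace zero, the gap makes it vanish,
  and a scalar projection has range zero or everything.\<close>

lemma irreducible_repI:
  assumes G: "group G" and \<rho>: "unitary_rep G N \<rho>" and "0 < N" "0 < n" "\<delta> < 1"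
    and s: "\<And>i. i < n \<Longrightarrow> s i \<in> carrier G"
    and gap: "\<And>X. X \<in> carrier_mat N N \<Longrightarrow> tr N X = 0 \<Longrightarrow>
      hs N (msum N (\<lambda>i. conj_by (\<rho> (s i)) (\<rho> (s i)) X) {..<n}) \<le> real n * \<delta> * hs N X"
  shows "irreducible_rep G N \<rho>"
  unfolding irreducible_rep_def
proof (intro conjI allI impI)
  fix W assume sub: "VectorSpace.subspace class_ring W (module_vec TYPE(complex) N)"
    and inv: "\<forall>g\<in>carrier G. \<forall>w\<in>W. \<rho> g *\<^sub>v w \<in> W"
  interpret submodule class_ring W "module_vec TYPE(complex) N"
    using sub by (simp add: subspace_def)
  have W: "W \<subseteq> carrier_vec N" "0\<^sub>v N \<in> W" "\<And>v w. v \<in> W \<Longrightarrow> w \<in> W \<Longrightarrow> v + w \<in> W"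
    "\<And>c v. v \<in> W \<Longrightarrow> c \<cdot>\<^sub>v v \<in> W"
    using subset zero_closed m_closed smult_closed by (auto simp: module_vec_simps class_ring_simps)
  obtain P where P: "projection_into N W P" "\<forall>w\<in>W. P *\<^sub>v w = w"
    using orthogonal_projection_exists[OF W] by blast
  note P' = P(1)[unfolded projection_into_def]
  have Pc: "P \<in> carrier_mat N N" and Pa: "mat_adjoint P = P" using P' by auto
  have u: "unitary N (\<rho> g)" if "g \<in> carrier G" for g using \<rho> that by (auto simp: unitary_rep_def hom_def)
  have PgP: "P * (\<rho> g * P) = \<rho> g * P" if g: "g \<in> carrier G" for g
  proof (rule mat_eq_by_vec[of _ N N])
    note gc = unitaryD(1)[OF u[OF g]]
    show "P * (\<rho> g * P) \<in> carrier_mat N N" "\<rho> g * P \<in> carrier_mat N N" using Pc gc by auto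
    fix v :: "complex vec" assume v: "v \<in> carrier_vec N"
    have "\<rho> g *\<^sub>v (P *\<^sub>v v) \<in> W" using P' v inv g by blast
    moreover have "(\<rho> g * P) *\<^sub>v v = \<rho> g *\<^sub>v (P *\<^sub>v v)" using gc Pc v by (rule assoc_mult_mat_vec)
    moreover have "(P * (\<rho> g * P)) *\<^sub>v v = P *\<^sub>v ((\<rho> g * P) *\<^sub>v v)"
      using gc Pc v by (intro assoc_mult_mat_vec[of _ N N _ N]) auto
    ultimately show "(P * (\<rho> g * P)) *\<^sub>v v = (\<rho> g * P) *\<^sub>v v" using P(2) by simp
  qed
  \<comment> \<open>\<open>PgP\<close> at the inverse element, after taking adjoints, gives P g P =
    P g in addition to P g P = g P.\<close>
  have comm: "\<rho> g * P = P * \<rho> g" if g: "g \<in> carrier G" for g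
  proof -
    note gc = unitaryD(1)[OF u[OF g]]
    interpret G: group G by (rule G)
    have "P * (mat_adjoint (\<rho> g) * P) = mat_adjoint (\<rho> g) * P"
      using PgP[of "inv\<^bsub>G\<^esub> g"] unitary_rep_inv[OF G \<rho> g] g by simp
    then have "mat_adjoint (P * (mat_adjoint (\<rho> g) * P)) = mat_adjoint (mat_adjoint (\<rho> g) * P)" by simp
    then have "P * \<rho> g * P = P * \<rho> g"
      using gc Pc Pa by (simp add: mat_adjoint_mult[of _ N N _ N])
    then show ?thesis using PgP[OF g] gc Pc by (simp add: assoc_mult_mat[of _ N N _ N _ N])
  qed
  define c where "c = tr N P / of_nat N"
  define X where "X = P + (- c) \<cdot>\<^sub>m 1\<^sub>m N"
  have Xc: "X \<in> carrier_mat N N" using Pc by (simp add: X_def)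
  have "tr N X = (\<Sum>i<N. P $$ (i, i) - c)" unfolding tr_def using Pc by (intro sum.cong) (auto simp: X_def)
  then have trX: "tr N X = 0" using \<open>0 < N\<close> by (simp add: sum_subtractf tr_def[symmetric] c_def)
  have "X = 0\<^sub>m N N"
  proof (rule intertwiner_eq_0[OF Xc \<open>0 < n\<close> \<open>\<delta> < 1\<close> _ gap[OF Xc trX]])
    fix i assume "i < n"
    then have g: "s i \<in> carrier G" using s by simp
    note gc = unitaryD[OF u[OF g]]
    have "\<rho> (s i) * X = X * \<rho> (s i)"
    proof -
      have I: "(- c) \<cdot>\<^sub>m 1\<^sub>m N \<in> carrier_mat N N" by simp
      have "\<rho> (s i) * X = \<rho> (s i) * P + \<rho> (s i) * ((- c) \<cdot>\<^sub>m 1\<^sub>m N)"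
        unfolding X_def by (rule mult_add_distrib_mat[OF gc(1) Pc I])
      also have "\<rho> (s i) * ((- c) \<cdot>\<^sub>m 1\<^sub>m N) = (- c) \<cdot>\<^sub>m \<rho> (s i)"
        using mult_smult_distrib[OF gc(1), of "1\<^sub>m N" N "- c"] gc by simp
      also have "(- c) \<cdot>\<^sub>m \<rho> (s i) = ((- c) \<cdot>\<^sub>m 1\<^sub>m N) * \<rho> (s i)"
        using mult_smult_assoc_mat[of "1\<^sub>m N" N N "\<rho> (s i)" N "- c"] gc by simp
      also have "\<rho> (s i) * P + \<dots> = X * \<rho> (s i)"
        unfolding X_def comm[OF g] by (rule add_mult_distrib_mat[OF Pc I gc(1), symmetric])
      finally show ?thesis .
    qed
    then have "conj_by (\<rho> (s i)) (\<rho> (s i)) X = X * \<rho> (s i) * mat_adjoint (\<rho> (s i))"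
      by (simp add: conj_by_def)
    also have "\<dots> = X * (\<rho> (s i) * mat_adjoint (\<rho> (s i)))"
      using Xc gc(1) by (intro assoc_mult_mat[of _ N N _ N _ N]) auto
    finally show "conj_by (\<rho> (s i)) (\<rho> (s i)) X = X" using Xc gc by simp
  qed
  have Pv: "P *\<^sub>v v = c \<cdot>\<^sub>v v" if v: "v \<in> carrier_vec N" for v
  proof -
    have "P = c \<cdot>\<^sub>m 1\<^sub>m N"
    proof (rule eq_matI)
      fix i j assume "i < dim_row (c \<cdot>\<^sub>m 1\<^sub>m N)" "j < dim_col (c \<cdot>\<^sub>m 1\<^sub>m N)"
      then have ij: "i < N" "j < N" by auto
      have "X $$ (i, j) = 0" using \<open>X = 0\<^sub>m N N\<close> ij by simp
      then show "P $$ (i, j) = (c \<cdot>\<^sub>m 1\<^sub>m N) $$ (i, j)" using ij Pc by (simp add: X_def)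
    qed (use Pc in auto)
    then show ?thesis using v by (intro eq_vecI) (auto simp: smult_scalar_prod_distrib[of _ N])
  qed
  show "W = {0\<^sub>v N} \<or> W = carrier_vec N"
  proof (cases "c = 0")
    case True
    have "w = 0\<^sub>v N" if "w \<in> W" for w
    proof -
      have "w \<in> carrier_vec N" using that W by auto
      then have "w = 0 \<cdot>\<^sub>v w" using bspec[OF P(2) that] Pv True by metis
      also have "\<dots> = 0\<^sub>v N" using \<open>w \<in> carrier_vec N\<close> by auto
      finally show ?thesis .
    qed
    then show ?thesis using W(2) by blast
  next
    case False
    have "v \<in> W" if v: "v \<in> carrier_vec N" for v
    proof -
      have "c \<cdot>\<^sub>v v \<in> W" using P' v Pv[OF v] by metis
      then have "inverse c \<cdot>\<^sub>v (c \<cdot>\<^sub>v v) \<in> W" by (rule W(4))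
      then show ?thesis using False v by (simp add: smult_smult_assoc)
    qed
    then show ?thesis using W(1) by blast
  qed
qed (rule \<open>0 < N\<close>)

text \<open>The adjoint of an equivalence \<open>U\<close> would be a nonzero intertwiner, which a
  gap on all matrices excludes.\<close>

lemma not_unitarily_equivalentI:
  assumes \<rho>: "unitary_rep G N \<rho>" and \<sigma>: "unitary_rep G N \<sigma>" and "0 < N" "0 < n" "\<delta> < 1"
    and s: "\<And>i. i < n \<Longrightarrow> s i \<in> carrier G"
    and gap: "\<And>X. X \<in> carrier_mat N N \<Longrightarrow>
      hs N (msum N (\<lambda>i. conj_by (\<rho> (s i)) (\<sigma> (s i)) X) {..<n}) \<le> real n * \<delta> * hs N X"
  shows "\<not> unitarily_equivalent G N \<rho> \<sigma>"
proof
  assume "unitarily_equivalent G N \<rho> \<sigma>"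
  then obtain U where U: "unitary N U" "\<And>g. g \<in> carrier G \<Longrightarrow> \<sigma> g = U * \<rho> g * mat_adjoint U"
    unfolding unitarily_equivalent_def by blast
  note Uc = unitaryD[OF U(1)]
  have X: "mat_adjoint U \<in> carrier_mat N N" using Uc by simp
  have "mat_adjoint U = 0\<^sub>m N N"
  proof (rule intertwiner_eq_0[OF X \<open>0 < n\<close> \<open>\<delta> < 1\<close> _ gap[OF X]])
    fix i assume "i < n"
    then have g: "s i \<in> carrier G" using s by simp
    have r: "unitary N (\<rho> (s i))" using \<rho> g by (auto simp: unitary_rep_def hom_def)
    note rc = unitaryD[OF r]
    have "mat_adjoint (\<sigma> (s i)) = U * (mat_adjoint (\<rho> (s i)) * mat_adjoint U)"
      unfolding U(2)[OF g] using Uc rc by (simp add: mat_adjoint_mult[of _ N N _ N])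
    then have "conj_by (\<rho> (s i)) (\<sigma> (s i)) (mat_adjoint U)
      = \<rho> (s i) * (mat_adjoint U * (U * (mat_adjoint (\<rho> (s i)) * mat_adjoint U)))"
      unfolding conj_by_def using Uc rc by (simp add: assoc_mult_mat[of _ N N _ N _ N])
    also have "mat_adjoint U * (U * (mat_adjoint (\<rho> (s i)) * mat_adjoint U))
      = (mat_adjoint U * U) * (mat_adjoint (\<rho> (s i)) * mat_adjoint U)"
      using Uc(1) rc(1) by (simp add: assoc_mult_mat[of _ N N _ N _ N])
    also have "\<dots> = mat_adjoint (\<rho> (s i)) * mat_adjoint U" using Uc rc(1) by simp
    also have "\<rho> (s i) * \<dots> = \<rho> (s i) * mat_adjoint (\<rho> (s i)) * mat_adjoint U"
      using Uc(1) rc(1) by (simp add: assoc_mult_mat[of _ N N _ N _ N])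
    also have "\<dots> = mat_adjoint U" using Uc(1) rc by simp
    finally show "conj_by (\<rho> (s i)) (\<sigma> (s i)) (mat_adjoint U) = mat_adjoint U" .
  qed
  moreover have "hs N (mat_adjoint U) = sqrt N"
    using Uc hs_unitary_left[OF U(1) one_carrier_mat] by (simp add: hs_adjoint hs_one)
  ultimately show False using \<open>0 < N\<close> by simp
qed

section \<open>Block diagonal representations and their tensor square\<close>

lemma sum_split:
  fixes F :: "nat \<Rightarrow> 'a::comm_monoid_add"
  shows "(\<Sum>x<m * n. F x) = (\<Sum>a<m. \<Sum>b<n. F (a * n + b))"
  using sum_div_mod[of "\<lambda>a b. F (a * n + b)" n m] by simp

lemma block_index_less: "a < R \<Longrightarrow> i < N \<Longrightarrow> a * N + i < R * (N :: nat)"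
proof -
  assume "a < R" "i < N"
  then have "a * N + i < Suc a * N" by simp
  also have "\<dots> \<le> R * N" using \<open>a < R\<close> by (intro mult_right_mono) auto
  finally show ?thesis .
qed

lemma block_index_div: "j < m \<Longrightarrow> (i * m + j) div m = (i :: nat)"
  and block_index_mod: "j < m \<Longrightarrow> (i * m + j) mod m = (j :: nat)"
  by simp_all

text \<open>Equal block sizes permit explicit entries through div and mod in place of the recursion
  of \<open>diag_block_mat\<close>; \<open>diag_block_mat_eq_blockdiag\<close> connects the
  two.\<close>

definition blockdiag :: "nat \<Rightarrow> nat \<Rightarrow> (nat \<Rightarrow> complex mat) \<Rightarrow> complex mat" where
  "blockdiag R N f = mat (R * N) (R * N)
    (\<lambda>(p, q). if p div N = q div N then f (p div N) $$ (p mod N, q mod N) else 0)"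

lemma blockdiag_carrier [simp]: "blockdiag R N f \<in> carrier_mat (R * N) (R * N)"
  by (simp add: blockdiag_def)

lemma blockdiag_dim [simp]: "dim_row (blockdiag R N f) = R * N" "dim_col (blockdiag R N f) = R * N"
  by (simp_all add: blockdiag_def)

lemma blockdiag_index:
  assumes "a < R" "b < R" "i < N" "j < N"
  shows "blockdiag R N f $$ (a * N + i, b * N + j) = (if a = b then f a $$ (i, j) else 0)"
  using assms by (simp add: blockdiag_def block_index_less)

lemma sum_blockdiag:
  assumes "a < R" "i < N"
  shows "(\<Sum>q<R * N. blockdiag R N f $$ (a * N + i, q) * h q) = (\<Sum>j<N. f a $$ (i, j) * h (a * N + j))"
proof -
  have "(\<Sum>q<R * N. blockdiag R N f $$ (a * N + i, q) * h q)
    = (\<Sum>b<R. if b = a then (\<Sum>j<N. f a $$ (i, j) * h (a * N + j)) else 0)"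
    unfolding sum_split using assms by (intro sum.cong refl) (auto simp: blockdiag_index)
  then show ?thesis using assms by simp
qed

lemma blockdiag_eqI:
  assumes "A \<in> carrier_mat (R * N) (R * N)" "B \<in> carrier_mat (R * N) (R * N)"
    and eq: "\<And>a b i j. a < R \<Longrightarrow> b < R \<Longrightarrow> i < N \<Longrightarrow> j < N \<Longrightarrow> A $$ (a * N + i, b * N + j) = B $$ (a * N + i, b * N + j)"
  shows "A = B"
proof (rule eq_matI)
  fix p q assume "p < dim_row B" "q < dim_col B"
  then have pq: "p < R * N" "q < R * N" using assms by auto
  then have "0 < N" by (cases "N = 0") auto
  with pq eq[of "p div N" "q div N" "p mod N" "q mod N"] show "A $$ (p, q) = B $$ (p, q)"
    by (simp add: less_mult_imp_div_less)
qed (use assms in auto)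

lemma blockdiag_cong:
  assumes "\<And>a. a < R \<Longrightarrow> f a = g a"
  shows "blockdiag R N f = blockdiag R N g"
  using assms by (intro blockdiag_eqI[of _ R N]) (simp_all add: blockdiag_index)

lemma blockdiag_mult:
  assumes "\<And>a. a < R \<Longrightarrow> f a \<in> carrier_mat N N" "\<And>a. a < R \<Longrightarrow> g a \<in> carrier_mat N N"
  shows "blockdiag R N f * blockdiag R N g = blockdiag R N (\<lambda>a. f a * g a)"
proof (rule blockdiag_eqI)
  fix a b i j assume *: "a < R" "b < R" "i < N" "j < N"
  have "(blockdiag R N f * blockdiag R N g) $$ (a * N + i, b * N + j)
    = (\<Sum>q<R * N. blockdiag R N f $$ (a * N + i, q) * blockdiag R N g $$ (q, b * N + j))"
    using * by (intro index_mult_sum) (auto simp: block_index_less)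
  also have "\<dots> = (\<Sum>k<N. f a $$ (i, k) * blockdiag R N g $$ (a * N + k, b * N + j))"
    using * by (intro sum_blockdiag)
  also have "\<dots> = (if a = b then \<Sum>k<N. f a $$ (i, k) * g a $$ (k, j) else 0)"
    using * by (auto simp: blockdiag_index)
  also have "\<dots> = blockdiag R N (\<lambda>a. f a * g a) $$ (a * N + i, b * N + j)"
    using * assms by (simp add: blockdiag_index index_mult_sum[of _ N N _ N] del: index_mult_mat(1))
  finally show "(blockdiag R N f * blockdiag R N g) $$ (a * N + i, b * N + j)
    = blockdiag R N (\<lambda>a. f a * g a) $$ (a * N + i, b * N + j)" .
qed simp_all

lemma blockdiag_adjoint:
  assumes "\<And>a. a < R \<Longrightarrow> f a \<in> carrier_mat N N"
  shows "mat_adjoint (blockdiag R N f) = blockdiag R N (\<lambda>a. mat_adjoint (f a))"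
proof (rule blockdiag_eqI)
  fix a b i j assume *: "a < R" "b < R" "i < N" "j < N"
  then show "mat_adjoint (blockdiag R N f) $$ (a * N + i, b * N + j)
    = blockdiag R N (\<lambda>a. mat_adjoint (f a)) $$ (a * N + i, b * N + j)"
    using carrier_matD[OF assms[OF *(1)]] carrier_matD[OF assms[OF *(2)]]
    by (simp add: block_index_less blockdiag_index)
qed simp_all

lemma blockdiag_one:
  assumes "\<And>a. a < R \<Longrightarrow> f a = 1\<^sub>m N"
  shows "blockdiag R N f = 1\<^sub>m (R * N)"
proof (rule blockdiag_eqI)
  fix a b i j assume *: "a < R" "b < R" "i < N" "j < N"
  have "a * N + i = b * N + j \<longleftrightarrow> a = b \<and> i = j"
  proof
    assume eq: "a * N + i = b * N + j"
    then have "(a * N + i) div N = (b * N + j) div N" "(a * N + i) mod N = (b * N + j) mod N" by simp_all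
    then show "a = b \<and> i = j" using * by simp
  qed simp
  then show "blockdiag R N f $$ (a * N + i, b * N + j) = 1\<^sub>m (R * N) $$ (a * N + i, b * N + j)"
    using * assms by (simp add: block_index_less blockdiag_index)
qed simp_all

lemma unitary_blockdiag:
  assumes "\<And>a. a < R \<Longrightarrow> unitary N (f a)"
  shows "unitary (R * N) (blockdiag R N f)"
  using unitaryD[OF assms]
  by (intro unitaryI) (simp_all add: blockdiag_adjoint blockdiag_mult blockdiag_one)

lemma unitary_rep_blockdiag:
  assumes "\<And>a. a < R \<Longrightarrow> unitary_rep G N (\<sigma> a)"
  shows "unitary_rep G (R * N) (\<lambda>g. blockdiag R N (\<lambda>a. \<sigma> a g))"
  unfolding unitary_rep_def
proof (rule homI)
  fix x y assume xy: "x \<in> carrier G" "y \<in> carrier G"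
  have u: "unitary N (\<sigma> a g)" if "a < R" "g \<in> carrier G" for a g
    using assms[OF that(1)] that(2) by (auto simp: unitary_rep_def hom_def)
  then show "unitary (R * N) (blockdiag R N (\<lambda>a. \<sigma> a x))" using xy by (intro unitary_blockdiag)
  have "\<sigma> a (x \<otimes>\<^bsub>G\<^esub> y) = \<sigma> a x * \<sigma> a y" if "a < R" for a
    using assms[OF that] xy by (simp add: unitary_rep_def hom_def)
  then have "blockdiag R N (\<lambda>a. \<sigma> a (x \<otimes>\<^bsub>G\<^esub> y)) = blockdiag R N (\<lambda>a. \<sigma> a x * \<sigma> a y)"
    by (rule blockdiag_cong)
  also have "\<dots> = blockdiag R N (\<lambda>a. \<sigma> a x) * blockdiag R N (\<lambda>a. \<sigma> a y)"
    using u xy unitaryD(1) by (intro blockdiag_mult[symmetric]) auto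
  finally show "blockdiag R N (\<lambda>a. \<sigma> a (x \<otimes>\<^bsub>G\<^esub> y))
    = blockdiag R N (\<lambda>a. \<sigma> a x) \<otimes>\<^bsub>unitary_group (R * N)\<^esub> blockdiag R N (\<lambda>a. \<sigma> a y)" by simp
qed

lemma diag_block_mat_eq_blockdiag:
  assumes "\<And>A. A \<in> set As \<Longrightarrow> A \<in> carrier_mat N N"
  shows "diag_block_mat As = blockdiag (length As) N ((!) As)"
  using assms
proof (induction As)
  case Nil
  show ?case by (rule eq_matI) auto
next
  case (Cons A As)
  then have IH: "diag_block_mat As = blockdiag (length As) N ((!) As)" and A: "A \<in> carrier_mat N N" by auto
  have eq: "diag_block_mat (A # As) = four_block_mat A (0\<^sub>m N (length As * N)) (0\<^sub>m (length As * N) N) (blockdiag (length As) N ((!) As))"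
    using A by (simp add: Let_def IH)
  show ?case
  proof (rule blockdiag_eqI)
    show "diag_block_mat (A # As) \<in> carrier_mat (length (A # As) * N) (length (A # As) * N)"
      unfolding eq using A by (intro carrier_matI) auto
    fix a b i j assume *: "a < length (A # As)" "b < length (A # As)" "i < N" "j < N"
    note idx = block_index_less[OF *(1,3)] block_index_less[OF *(2,4)]
    show "diag_block_mat (A # As) $$ (a * N + i, b * N + j) = blockdiag (length (A # As)) N ((!) (A # As)) $$ (a * N + i, b * N + j)"
    proof (cases a)
      case 0
      then show ?thesis unfolding blockdiag_index[OF *] unfolding eq
        using A * idx by (cases b) (auto simp: block_index_less)
    next
      case (Suc a')
      then show ?thesis unfolding blockdiag_index[OF *] unfolding eq
        using A * idx by (cases b) (auto simp: block_index_less blockdiag_index)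
    qed
  qed (rule blockdiag_carrier)
qed

lemma nth_concat_replicate:
  assumes "a < M * d"
  shows "concat (map (\<lambda>t. replicate d (f t)) [0..<M]) ! a = f (a div d)"
  using assms
proof (induction M)
  case (Suc M)
  have len: "length (concat (map (\<lambda>t. replicate d (f t)) [0..<M])) = M * d"
    by (simp add: length_concat comp_def sum_list_triv)
  show ?case
  proof (cases "a < M * d")
    case True
    then show ?thesis using Suc len by (simp add: nth_append)
  next
    case False
    then have "a div d = M" using Suc.prems by (intro div_nat_eqI) (auto simp: algebra_simps)
    then show ?thesis using False Suc.prems len by (simp add: nth_append)
  qed
qed simp

text \<open>Each index is repeated d times in the concatenated list, so position \<open>a\<close>
  belongs to the representation with index a div d.\<close>

lemma isotypic_sum_eq_blockdiag:
  assumes "\<And>t. t < M \<Longrightarrow> \<sigma> t g \<in> carrier_mat N N"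
  shows "isotypic_sum {..<M} d \<sigma> g = blockdiag (M * d) N (\<lambda>a. \<sigma> (a div d) g)"
proof -
  let ?As = "concat (map (\<lambda>t. replicate d (\<sigma> t g)) [0..<M])"
  have len: "length ?As = M * d" by (simp add: length_concat comp_def sum_list_triv)
  have "isotypic_sum {..<M} d \<sigma> g = diag_block_mat ?As"
    by (simp add: isotypic_sum_def lessThan_atLeast0)
  also have "\<dots> = blockdiag (M * d) N ((!) ?As)"
    using assms by (subst diag_block_mat_eq_blockdiag[where N = N]) (auto simp: len)
  also have "\<dots> = blockdiag (M * d) N (\<lambda>a. \<sigma> (a div d) g)"
    by (rule blockdiag_cong) (rule nth_concat_replicate)
  finally show ?thesis .
qed

section \<open>Vectors of the tensor square as block matrices\<close>

definition block :: "nat \<Rightarrow> nat \<Rightarrow> complex vec \<Rightarrow> nat \<Rightarrow> nat \<Rightarrow> complex mat" where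
  "block R N \<xi> a b = mat N N (\<lambda>(i, j). \<xi> $ ((a * N + i) * (R * N) + (b * N + j)))"

lemma block_carrier [simp]: "block R N \<xi> a b \<in> carrier_mat N N"
  by (simp add: block_def)

text \<open>
  Vectors of the tensor square are matrices, on which \<open>\<pi> \<otimes> \<pi>\<close>-bar acts by \<open>X \<mapsto> \<pi> X \<pi>\<^sup>*\<close>, hence
  blockwise for a block diagonal \<open>\<pi>\<close>.
\<close>

lemma kronecker_blockdiag:
  fixes f R N
  defines "A \<equiv> blockdiag R N f"
  assumes f: "\<And>a. a < R \<Longrightarrow> f a \<in> carrier_mat N N"
    and \<xi>: "\<xi> \<in> carrier_vec ((R * N) * (R * N))" and idx: "a < R" "b < R" "i < N" "j < N"
  shows "(kronecker_mat A (map_mat cnj A) *\<^sub>v \<xi>) $ ((a * N + i) * (R * N) + (b * N + j))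
    = conj_by (f a) (f b) (block R N \<xi> a b) $$ (i, j)"
proof -
  let ?m = "R * N" and ?p = "a * N + i" and ?q = "b * N + j"
  have p: "?p < ?m" "?q < ?m" using idx by (auto simp: block_index_less)
  have x: "?p * ?m + ?q < ?m * ?m" using p by (rule block_index_less)
  have A: "dim_row A = ?m" "dim_col A = ?m" by (auto simp: A_def)
  have "(kronecker_mat A (map_mat cnj A) *\<^sub>v \<xi>) $ (?p * ?m + ?q)
    = (\<Sum>y<?m * ?m. kronecker_mat A (map_mat cnj A) $$ (?p * ?m + ?q, y) * \<xi> $ y)"
    using x A \<xi> by (auto simp: kronecker_mat_def scalar_prod_def atLeast0LessThan intro!: sum.cong)
  also have "\<dots> = (\<Sum>y<?m. \<Sum>z<?m. A $$ (?p, y) * (cnj (A $$ (?q, z)) * \<xi> $ (y * ?m + z)))"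
    unfolding sum_split[of _ ?m ?m] using p x A
    by (intro sum.cong refl) (simp add: kronecker_mat_def block_index_less block_index_div block_index_mod)
  \<comment> \<open>Conjugating the inner sum frees the entries of \<open>A\<close> from their
    conjugate, so \<open>sum_blockdiag\<close> applies to both sums.\<close>
  also have "\<dots> = (\<Sum>y<?m. A $$ (?p, y) * cnj (\<Sum>z<?m. A $$ (?q, z) * cnj (\<xi> $ (y * ?m + z))))"
    by (simp add: sum_distrib_left)
  also have "\<dots> = (\<Sum>y<?m. A $$ (?p, y) * cnj (\<Sum>z<N. f b $$ (j, z) * cnj (\<xi> $ (y * ?m + (b * N + z)))))"
    unfolding A_def by (subst sum_blockdiag[OF idx(2,4)]) simp
  also have "\<dots> = (\<Sum>y<N. f a $$ (i, y) * cnj (\<Sum>z<N. f b $$ (j, z) * cnj (\<xi> $ ((a * N + y) * ?m + (b * N + z)))))"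
    unfolding A_def by (rule sum_blockdiag[OF idx(1,3)])
  also have "\<dots> = conj_by (f a) (f b) (block R N \<xi> a b) $$ (i, j)"
    using f idx by (subst conj_by_index[of _ N]) (auto simp: sum_distrib_left block_def mult_ac)
  finally show ?thesis .
qed

lemma sum_blocks:
  fixes F :: "nat \<Rightarrow> 'a::comm_monoid_add"
  shows "(\<Sum>x<(R * N) * (R * N). F x)
    = (\<Sum>a<R. \<Sum>b<R. \<Sum>i<N. \<Sum>j<N. F ((a * N + i) * (R * N) + (b * N + j)))"
proof -
  have "(\<Sum>x<(R * N) * (R * N). F x)
    = (\<Sum>a<R. \<Sum>i<N. \<Sum>b<R. \<Sum>j<N. F ((a * N + i) * (R * N) + (b * N + j)))"
    by (simp only: sum_split[of F "R * N" "R * N"] sum_split[of "\<lambda>y. F (_ * (R * N) + y)" R N] sum_split[of _ R N])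
  also have "\<dots> = (\<Sum>a<R. \<Sum>b<R. \<Sum>i<N. \<Sum>j<N. F ((a * N + i) * (R * N) + (b * N + j)))"
    by (rule sum.cong[OF refl], rule sum.swap)
  finally show ?thesis .
qed

lemma Re_inner_le_hs:
  "Re (\<Sum>i<N. \<Sum>j<N. Y $$ (i, j) * cnj (X $$ (i, j))) \<le> hs N Y * hs N X"
proof -
  have "Re (\<Sum>i<N. \<Sum>j<N. Y $$ (i, j) * cnj (X $$ (i, j)))
    \<le> (\<Sum>i<N. \<Sum>j<N. cmod (Y $$ (i, j)) * cmod (X $$ (i, j)))"
    unfolding Re_sum
  proof (intro sum_mono)
    fix i j
    show "Re (Y $$ (i, j) * cnj (X $$ (i, j))) \<le> cmod (Y $$ (i, j)) * cmod (X $$ (i, j))"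
      using complex_Re_le_cmod[of "Y $$ (i, j) * cnj (X $$ (i, j))"] by (simp add: norm_mult)
  qed
  also have "\<dots> = (\<Sum>p\<in>{..<N} \<times> {..<N}. \<bar>case p of (i, j) \<Rightarrow> cmod (Y $$ (i, j))\<bar> * \<bar>case p of (i, j) \<Rightarrow> cmod (X $$ (i, j))\<bar>)"
    by (simp add: sum.cartesian_product case_prod_unfold)
  also have "\<dots> \<le> hs N Y * hs N X" unfolding hs_def by (rule L2_set_mult_ineq)
  finally show ?thesis .
qed

lemma conj_by_zero: "U \<in> carrier_mat N N \<Longrightarrow> V \<in> carrier_mat N N \<Longrightarrow> conj_by U V (0\<^sub>m N N) = 0\<^sub>m N N"
  by (rule eq_matI) (auto simp: conj_by_index[of _ N] carrier_matD[OF conj_by_carrier])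

text \<open>The vector \<open>w\<close> with the identity in block (a, b) and zero elsewhere is
  invariant, since both sides are acted on by the same unitary; orthogonality to it is the trace
  condition. The case a \<noteq> b concerns two copies of one representation, which is how the
  multiplicity is handled.\<close>

lemma block_trace_eq_0:
  fixes \<sigma> :: "nat \<Rightarrow> 'g \<Rightarrow> complex mat"
  assumes \<sigma>: "\<And>a. a < R \<Longrightarrow> unitary_rep G N (\<sigma> a)"
    and \<xi>: "\<xi> \<in> hermitian_complement ((R * N) * (R * N)) (invariant_vectors G ((R * N) * (R * N))
      (tensor_rep (\<lambda>g. blockdiag R N (\<lambda>a. \<sigma> a g)) (conj_rep (\<lambda>g. blockdiag R N (\<lambda>a. \<sigma> a g)))))"
    and ab: "a < R" "b < R" "\<sigma> a = \<sigma> b"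
  shows "tr N (block R N \<xi> a b) = 0"
proof -
  let ?m = "R * N" and ?A = "\<lambda>g. blockdiag R N (\<lambda>a. \<sigma> a g)"
  define w where "w = vec (?m * ?m) (\<lambda>x. if (x div ?m) div N = a \<and> (x mod ?m) div N = b \<and>
    (x div ?m) mod N = (x mod ?m) mod N then 1 else 0 :: complex)"
  have w: "w \<in> carrier_vec (?m * ?m)" by (simp add: w_def)
  have w_index: "w $ ((a' * N + i) * ?m + (b' * N + j)) = (if a' = a \<and> b' = b \<and> i = j then 1 else 0)"
    if "a' < R" "b' < R" "i < N" "j < N" for a' b' i j
  proof -
    have pq: "a' * N + i < ?m" "b' * N + j < ?m" using that by (auto simp: block_index_less)
    then have "(a' * N + i) * ?m + (b' * N + j) < ?m * ?m" by (rule block_index_less)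
    moreover have "((a' * N + i) * ?m + (b' * N + j)) div ?m = a' * N + i"
      "((a' * N + i) * ?m + (b' * N + j)) mod ?m = b' * N + j"
      using block_index_div[OF pq(2)] block_index_mod[OF pq(2)] by blast+
    ultimately show ?thesis using that by (simp add: w_def)
  qed
  have block_w: "block R N w a' b' = (if a' = a \<and> b' = b then 1\<^sub>m N else 0\<^sub>m N N)"
    if "a' < R" "b' < R" for a' b'
  proof (rule eq_matI)
    fix i j assume "i < dim_row (if a' = a \<and> b' = b then 1\<^sub>m N else 0\<^sub>m N N :: complex mat)"
      "j < dim_col (if a' = a \<and> b' = b then 1\<^sub>m N else 0\<^sub>m N N :: complex mat)"
    then have ij: "i < N" "j < N" by (auto split: if_splits)
    show "block R N w a' b' $$ (i, j) = (if a' = a \<and> b' = b then 1\<^sub>m N else 0\<^sub>m N N) $$ (i, j)"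
      using w_index[OF that ij] ij by (simp add: block_def)
  qed (auto simp: block_def)
  have "kronecker_mat (?A g) (map_mat cnj (?A g)) *\<^sub>v w = w" if g: "g \<in> carrier G" for g
  proof (rule eq_vecI)
    have u: "unitary N (\<sigma> a' g)" if "a' < R" for a' using \<sigma>[OF that] g by (auto simp: unitary_rep_def hom_def)
    fix x assume "x < dim_vec w"
    then have x: "x < ?m * ?m" using w by auto
    define p q where "p = x div ?m" and "q = x mod ?m"
    have m0: "0 < ?m" using x by (cases "?m = 0") auto
    have pq: "p < ?m" "q < ?m" using x m0 by (auto simp: p_def q_def less_mult_imp_div_less)
    have x_pq: "x = p * ?m + q" by (simp only: p_def q_def div_mult_mod_eq)
    have N0: "0 < N" using m0 by (cases "N = 0") auto
    have idx: "p div N < R" "q div N < R" "p mod N < N" "q mod N < N" using pq N0 by (auto simp: less_mult_imp_div_less)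
    have x_eq: "x = (p div N * N + p mod N) * ?m + (q div N * N + q mod N)" using x_pq by simp
    have "(kronecker_mat (?A g) (map_mat cnj (?A g)) *\<^sub>v w) $ x
      = conj_by (\<sigma> (p div N) g) (\<sigma> (q div N) g) (block R N w (p div N) (q div N)) $$ (p mod N, q mod N)"
      unfolding x_eq using unitaryD(1)[OF u] by (intro kronecker_blockdiag w idx) auto
    also have "conj_by (\<sigma> (p div N) g) (\<sigma> (q div N) g) (block R N w (p div N) (q div N)) = block R N w (p div N) (q div N)"
    proof (cases "p div N = a \<and> q div N = b")
      case True
      have "conj_by (\<sigma> a g) (\<sigma> b g) (1\<^sub>m N) = 1\<^sub>m N"
        using unitaryD[OF u[OF ab(1)]] ab(3) by (simp add: conj_by_def)
      then show ?thesis using True block_w ab by simp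
    next
      case False
      then have "block R N w (p div N) (q div N) = 0\<^sub>m N N" unfolding block_w[OF idx(1,2)] by auto
      then show ?thesis using unitaryD(1)[OF u] idx by (simp add: conj_by_zero)
    qed
    also have "block R N w (p div N) (q div N) $$ (p mod N, q mod N) = w $ x"
      using idx x_eq by (simp add: block_def)
    finally show "(kronecker_mat (?A g) (map_mat cnj (?A g)) *\<^sub>v w) $ x = w $ x" .
  qed (use w in \<open>simp add: kronecker_mat_def\<close>)
  then have "w \<in> invariant_vectors G (?m * ?m) (tensor_rep ?A (conj_rep ?A))"
    using w by (simp add: invariant_vectors_def tensor_rep_def conj_rep_def)
  with \<xi> have "\<xi> \<bullet>c w = 0" by (simp add: hermitian_complement_def)
  moreover have "\<xi> \<bullet>c w = tr N (block R N \<xi> a b)"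
  proof -
    have "\<xi> \<bullet>c w = (\<Sum>x<?m * ?m. \<xi> $ x * cnj (w $ x))"
      using w by (auto simp: scalar_prod_def atLeast0LessThan intro!: sum.cong)
    also have "\<dots> = (\<Sum>a'<R. \<Sum>b'<R. \<Sum>i<N. \<Sum>j<N. \<xi> $ ((a' * N + i) * ?m + (b' * N + j))
        * cnj (w $ ((a' * N + i) * ?m + (b' * N + j))))"
      by (rule sum_blocks)
    also have "\<dots> = (\<Sum>a'<R. \<Sum>b'<R. \<Sum>i<N. \<Sum>j<N. if j = i then if b' = b then if a' = a
        then \<xi> $ ((a * N + i) * ?m + (b * N + i)) else 0 else 0 else 0)"
      by (intro sum.cong refl) (auto simp: w_index)
    also have "\<dots> = (\<Sum>i<N. \<xi> $ ((a * N + i) * ?m + (b * N + i)))"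
    proof -
      have "(\<Sum>a'<R. \<Sum>b'<R. \<Sum>i<N. if b' = b then if a' = a then h i else 0 else 0) = (\<Sum>i<N. h i)"
        for h :: "nat \<Rightarrow> complex"
      proof -
        have "(\<Sum>a'<R. \<Sum>b'<R. \<Sum>i<N. if b' = b then if a' = a then h i else 0 else 0)
          = (\<Sum>a'<R. \<Sum>b'<R. if b' = b then if a' = a then (\<Sum>i<N. h i) else 0 else 0)"
          by (intro sum.cong refl) auto
        then show ?thesis using ab by simp
      qed
      then show ?thesis by simp
    qed
    finally show ?thesis by (simp add: tr_def block_def)
  qed
  ultimately show ?thesis by simp
qed

text \<open>The action preserves the blocks, so the quadratic form is a sum over blocks. The gap and
  Cauchy-Schwarz bound each by n \<delta> times the squared norm of the block, and these squares add
  up to 1.\<close>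

lemma rep_lambda_blockdiag_le:
  fixes \<sigma> :: "nat \<Rightarrow> 'g \<Rightarrow> complex mat"
  defines "\<pi> \<equiv> \<lambda>R N g. blockdiag R N (\<lambda>a. \<sigma> a g)"
  assumes \<sigma>: "\<And>a. a < R \<Longrightarrow> unitary_rep G N (\<sigma> a)"
    and s: "inj_on s {..<n}" "s ` {..<n} \<subseteq> carrier G" and "0 < n"
    and gap: "\<And>a b X. a < R \<Longrightarrow> b < R \<Longrightarrow> X \<in> carrier_mat N N \<Longrightarrow> (\<sigma> a = \<sigma> b \<Longrightarrow> tr N X = 0) \<Longrightarrow>
      hs N (msum N (\<lambda>i. conj_by (\<sigma> a (s i)) (\<sigma> b (s i)) X) {..<n}) \<le> real n * \<delta> * hs N X"
  shows "rep_lambda G ((R * N) * (R * N)) (tensor_rep (\<pi> R N) (conj_rep (\<pi> R N))) (s ` {..<n}) \<le> ereal \<delta>"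
proof -
  let ?m = "R * N" and ?S = "s ` {..<n}" and ?\<rho> = "tensor_rep (\<pi> R N) (conj_rep (\<pi> R N))"
  have bound: "Re (finsum_vec TYPE(complex) (?m * ?m) (\<lambda>g. ?\<rho> g *\<^sub>v \<xi>) ?S \<bullet>c \<xi>) \<le> n * \<delta>"
    if \<xi>: "\<xi> \<in> hermitian_complement (?m * ?m) (invariant_vectors G (?m * ?m) ?\<rho>)" and norm: "\<xi> \<bullet>c \<xi> = 1" for \<xi>
  proof -
    have \<xi>c: "\<xi> \<in> carrier_vec (?m * ?m)" using \<xi> by (simp add: hermitian_complement_def)
    let ?F = "finsum_vec TYPE(complex) (?m * ?m) (\<lambda>g. ?\<rho> g *\<^sub>v \<xi>) ?S"
    let ?X = "block R N \<xi>"
    define Y where "Y a b = msum N (\<lambda>i. conj_by (\<sigma> a (s i)) (\<sigma> b (s i)) (?X a b)) {..<n}" for a b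
    have u: "unitary N (\<sigma> a (s i))" if "a < R" "i < n" for a i
      using \<sigma>[OF that(1)] s(2) that(2) by (auto simp: unitary_rep_def hom_def)
    have X_index: "\<xi> $ ((a * N + i) * ?m + (b * N + j)) = ?X a b $$ (i, j)" if "i < N" "j < N" for a b i j
      using that by (simp add: block_def)
    have carrier: "(\<lambda>g. ?\<rho> g *\<^sub>v \<xi>) \<in> ?S \<rightarrow> carrier_vec (?m * ?m)"
      by (auto simp: tensor_rep_def conj_rep_def kronecker_mat_def \<pi>_def intro!: carrier_vecI)
    have F: "?F $ ((a * N + i) * ?m + (b * N + j)) = Y a b $$ (i, j)"
      if "a < R" "b < R" "i < N" "j < N" for a b i j
    proof -
      have x: "(a * N + i) * ?m + (b * N + j) < ?m * ?m" using that by (intro block_index_less) auto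
      have "?F $ ((a * N + i) * ?m + (b * N + j))
        = (\<Sum>g\<in>?S. (?\<rho> g *\<^sub>v \<xi>) $ ((a * N + i) * ?m + (b * N + j)))"
        by (rule index_finsum_vec[OF _ x carrier]) simp
      also have "\<dots> = (\<Sum>k<n. (?\<rho> (s k) *\<^sub>v \<xi>) $ ((a * N + i) * ?m + (b * N + j)))"
        using s(1) by (simp add: sum.reindex)
      also have "\<dots> = (\<Sum>k<n. conj_by (\<sigma> a (s k)) (\<sigma> b (s k)) (?X a b) $$ (i, j))"
      proof (intro sum.cong refl)
        fix k assume "k \<in> {..<n}"
        then show "(?\<rho> (s k) *\<^sub>v \<xi>) $ ((a * N + i) * ?m + (b * N + j))
          = conj_by (\<sigma> a (s k)) (\<sigma> b (s k)) (?X a b) $$ (i, j)"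
          unfolding tensor_rep_def conj_rep_def \<pi>_def
          using unitaryD(1)[OF u] by (intro kronecker_blockdiag \<xi>c that) auto
      qed
      also have "\<dots> = Y a b $$ (i, j)" using that by (simp add: Y_def msum_index)
      finally show ?thesis .
    qed
    have "?F \<bullet>c \<xi>
      = (\<Sum>x<?m * ?m. ?F $ x * cnj (\<xi> $ x))"
      using \<xi>c by (auto simp: scalar_prod_def atLeast0LessThan intro!: sum.cong)
    also have "\<dots> = (\<Sum>a<R. \<Sum>b<R. \<Sum>i<N. \<Sum>j<N. Y a b $$ (i, j) * cnj (?X a b $$ (i, j)))"
      unfolding sum_blocks by (intro sum.cong refl) (simp add: F X_index)
    finally have "Re (?F \<bullet>c \<xi>)
      = (\<Sum>a<R. \<Sum>b<R. Re (\<Sum>i<N. \<Sum>j<N. Y a b $$ (i, j) * cnj (?X a b $$ (i, j))))"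
      by simp
    also have "\<dots> \<le> (\<Sum>a<R. \<Sum>b<R. (n * \<delta>) * (hs N (?X a b))\<^sup>2)"
    proof (intro sum_mono)
      fix a b assume ab: "a \<in> {..<R}" "b \<in> {..<R}"
      have "tr N (?X a b) = 0" if "\<sigma> a = \<sigma> b"
        using ab that by (intro block_trace_eq_0[OF \<sigma> \<xi>[unfolded \<pi>_def]]) auto
      then have "hs N (Y a b) \<le> n * \<delta> * hs N (?X a b)" unfolding Y_def using ab by (intro gap) auto
      then have "hs N (Y a b) * hs N (?X a b) \<le> n * \<delta> * hs N (?X a b) * hs N (?X a b)"
        by (intro mult_right_mono) auto
      with Re_inner_le_hs[where N = N and Y = "Y a b" and X = "?X a b"]
      show "Re (\<Sum>i<N. \<Sum>j<N. Y a b $$ (i, j) * cnj (?X a b $$ (i, j))) \<le> (n * \<delta>) * (hs N (?X a b))\<^sup>2"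
        by (simp add: power2_eq_square mult.assoc)
    qed
    also have "\<dots> = (n * \<delta>) * (\<Sum>a<R. \<Sum>b<R. (hs N (?X a b))\<^sup>2)"
      by (simp add: sum_distrib_left)
    also have "(\<Sum>a<R. \<Sum>b<R. (hs N (?X a b))\<^sup>2) = 1"
    proof -
      have "complex_of_real (\<Sum>a<R. \<Sum>b<R. (hs N (?X a b))\<^sup>2) = (\<Sum>x<?m * ?m. \<xi> $ x * cnj (\<xi> $ x))"
        unfolding sum_blocks of_real_sum hs_power2 complex_norm_square
        by (intro sum.cong refl) (simp add: X_index)
      also have "\<dots> = \<xi> \<bullet>c \<xi>"
        using \<xi>c by (auto simp: scalar_prod_def atLeast0LessThan intro!: sum.cong)
      finally have "complex_of_real (\<Sum>a<R. \<Sum>b<R. (hs N (?X a b))\<^sup>2) = complex_of_real 1" using norm by simp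
      then show ?thesis unfolding of_real_eq_iff .
    qed
    finally show ?thesis by simp
  qed
  have card: "card ?S = n" using s(1) by (simp add: card_image)
  \<comment> \<open>\<open>Sup_least\<close> also covers the case that no unit vector qualifies and
    the supremum is empty.\<close>
  have "rep_lambda G (?m * ?m) ?\<rho> ?S \<le> ereal (inverse (real n)) * ereal (n * \<delta>)"
    unfolding rep_lambda_def card
    by (intro ereal_mult_left_mono Sup_least) (auto intro: bound)
  also have "\<dots> = ereal \<delta>" using \<open>0 < n\<close> by simp
  finally show ?thesis .
qed

theorem theorem2p11:
  fixes \<epsilon> :: real
  assumes "0 < \<epsilon>" and "\<epsilon> < 1"
  shows "\<exists>\<beta> > (0::real). \<exists>n0 :: nat. \<forall>n \<ge> n0. \<forall>N \<ge> (1::nat). \<forall>d \<ge> (1::nat).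
    \<exists>(G :: nat monoid) (S :: nat set) (m :: nat) (\<pi> :: nat \<Rightarrow> complex mat)
      (T :: nat set) (\<sigma> :: nat \<Rightarrow> nat \<Rightarrow> complex mat).
      group G \<and>
      S \<subseteq> carrier G \<and> finite S \<and> card S = n \<and> generate G S = carrier G \<and>
      unitary_rep G m \<pi> \<and>
      rep_lambda G (m * m) (tensor_rep \<pi> (conj_rep \<pi>)) S \<le> ereal (1 - \<epsilon>) \<and>
      finite T \<and>
      (\<forall>t \<in> T. unitary_rep G N (\<sigma> t) \<and> irreducible_rep G N (\<sigma> t)) \<and>
      (\<forall>s \<in> T. \<forall>t \<in> T. s \<noteq> t \<longrightarrow> \<not> unitarily_equivalent G N (\<sigma> s) (\<sigma> t)) \<and>
      unitarily_equivalent G m \<pi> (isotypic_sum T d \<sigma>) \<and>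
      real (card T) \<ge> exp (\<beta> * real n * (real N)\<^sup>2)"
proof -
  define \<delta> where "\<delta> = 1 - \<epsilon>"
  have \<delta>: "0 < \<delta>" "\<delta> < 1" using assms by (auto simp: \<delta>_def)
  from many_separated_tuples[OF this] obtain \<beta> n0 where "0 < \<beta>"
    and tuples: "\<forall>n\<ge>n0. \<forall>N\<ge>1. \<exists>M U. separated_tuples n N \<delta> M U \<and>
      exp (\<beta> * real n * (real N)\<^sup>2) \<le> real M" by blast
  show ?thesis
  proof (intro exI[of _ \<beta>] conjI \<open>0 < \<beta>\<close> exI[of _ "n0 + 1"] allI impI)
    fix n N d :: nat assume n: "n0 + 1 \<le> n" and N: "1 \<le> N" and d: "1 \<le> d"
    \<comment> \<open>The threshold was raised by one to secure n > 0, without which a gap relative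
      to n would say nothing.\<close>
    from n have n0: "0 < n" by simp
    from tuples n N obtain M U where tup: "separated_tuples n N \<delta> M U"
      and M: "exp (\<beta> * real n * (real N)\<^sup>2) \<le> real M" by (meson add_leD1)
    note U = tup[unfolded separated_tuples_def, THEN conjunct1]
      and gap = tup[unfolded separated_tuples_def, THEN conjunct2]
    show "\<exists>(G :: nat monoid) S m \<pi> T \<sigma>. group G \<and>
      S \<subseteq> carrier G \<and> finite S \<and> card S = n \<and> generate G S = carrier G \<and>
      unitary_rep G m \<pi> \<and>
      rep_lambda G (m * m) (tensor_rep \<pi> (conj_rep \<pi>)) S \<le> ereal (1 - \<epsilon>) \<and>
      finite T \<and>
      (\<forall>t \<in> T. unitary_rep G N (\<sigma> t) \<and> irreducible_rep G N (\<sigma> t)) \<and>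
      (\<forall>s \<in> T. \<forall>t \<in> T. s \<noteq> t \<longrightarrow> \<not> unitarily_equivalent G N (\<sigma> s) (\<sigma> t)) \<and>
      unitarily_equivalent G m \<pi> (isotypic_sum T d \<sigma>) \<and>
      real (card T) \<ge> exp (\<beta> * real n * (real N)\<^sup>2)"
    proof (rule group_of_unitary_tuples[OF U[rule_format], where n = n])
      fix G :: "nat monoid" and s \<sigma>
      assume G: "group G" and s: "inj_on s {..<n}" "s ` {..<n} \<subseteq> carrier G"
        and gen: "generate G (s ` {..<n}) = carrier G"
        and \<sigma>: "\<And>t. t < M \<Longrightarrow> \<sigma> t \<in> hom G (unitary_group N)"
        and \<sigma>U: "\<And>t i. t < M \<Longrightarrow> i < n \<Longrightarrow> \<sigma> t (s i) = U t i"
      have rep: "unitary_rep G N (\<sigma> t)" if "t < M" for t using \<sigma>[OF that] by (simp add: unitary_rep_def)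
      have u: "unitary N (\<sigma> t g)" if "t < M" "g \<in> carrier G" for t g using \<sigma>[OF that(1)] that(2) by (auto simp: hom_def)
      have sG: "s i \<in> carrier G" if "i < n" for i using s(2) that by auto
      have \<sigma>gap: "hs N (msum N (\<lambda>i. conj_by (\<sigma> t (s i)) (\<sigma> t' (s i)) X) {..<n}) \<le> real n * \<delta> * hs N X"
        if "t < M" "t' < M" "X \<in> carrier_mat N N" "t = t' \<Longrightarrow> tr N X = 0" for t t' X
      proof -
        have "msum N (\<lambda>i. conj_by (\<sigma> t (s i)) (\<sigma> t' (s i)) X) {..<n} = msum N (\<lambda>i. conj_by (U t i) (U t' i) X) {..<n}"
          using \<sigma>U that by (intro msum_cong) auto
        then show ?thesis using gap that by simp
      qed
      have div: "a div d < M" if "a < M * d" for a using that by (simp add: less_mult_imp_div_less)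
      \<comment> \<open>\<pi> is the block sum itself, so the identity matrix realises its
        equivalence with \<open>isotypic_sum\<close>.\<close>
      define \<pi> where "\<pi> g = blockdiag (M * d) N (\<lambda>a. \<sigma> (a div d) g)" for g
      show ?thesis
      proof (rule exI[of _ G], rule exI[of _ "s ` {..<n}"], rule exI[of _ "M * d * N"], rule exI[of _ \<pi>],
          rule exI[of _ "{..<M}"], rule exI[of _ \<sigma>], intro conjI ballI impI)
        show "card (s ` {..<n}) = n" using s(1) by (simp add: card_image)
        show "unitary_rep G (M * d * N) \<pi>"
          unfolding \<pi>_def using rep div by (intro unitary_rep_blockdiag) auto
        show "rep_lambda G (M * d * N * (M * d * N)) (tensor_rep \<pi> (conj_rep \<pi>)) (s ` {..<n}) \<le> ereal (1 - \<epsilon>)"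
          unfolding \<pi>_def \<delta>_def[symmetric]
          by (rule rep_lambda_blockdiag_le[OF _ s n0]) (use rep div \<sigma>gap in auto)
        show "unitarily_equivalent G (M * d * N) \<pi> (isotypic_sum {..<M} d \<sigma>)"
          unfolding unitarily_equivalent_def
        proof (intro bexI[of _ "1\<^sub>m (M * d * N)"] ballI)
          fix g assume g: "g \<in> carrier G"
          have "isotypic_sum {..<M} d \<sigma> g = \<pi> g"
            unfolding \<pi>_def using unitaryD(1)[OF u[OF _ g]] by (intro isotypic_sum_eq_blockdiag)
          moreover have "\<pi> g \<in> carrier_mat (M * d * N) (M * d * N)" by (simp add: \<pi>_def)
          ultimately show "isotypic_sum {..<M} d \<sigma> g = 1\<^sub>m (M * d * N) * \<pi> g * mat_adjoint (1\<^sub>m (M * d * N))" by simp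
        qed simp
        show "exp (\<beta> * real n * (real N)\<^sup>2) \<le> real (card {..<M})" using M by simp
        fix t assume t: "t \<in> {..<M}"
        then show "unitary_rep G N (\<sigma> t)" by (simp add: rep)
        show "irreducible_rep G N (\<sigma> t)"
          by (rule irreducible_repI[OF G _ _ n0 \<delta>(2) sG]) (use t N rep \<sigma>gap in auto)
        fix t' assume "t' \<in> {..<M}" "t \<noteq> t'"
        then show "\<not> unitarily_equivalent G N (\<sigma> t) (\<sigma> t')"
          by (intro not_unitarily_equivalentI[OF _ _ _ n0 \<delta>(2) sG]) (use t N rep \<sigma>gap in auto)
      qed (use G s gen in auto)
    qed
  qed
qed

end
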